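(* Let $G$ be the fundamental group of a finite graph of groups with finitely generated vertex groups $\{G_v\}$ and finite edge groups. Then \[ \operatorname{sep}_{G}(r)\simeq \max_v\{\operatorname{sep}_{G_v}(r)\}, \] where the maximum is over the (finitely many) vertices $v$ of the underlying graph.
   Context: For a finite graph $\Gamma=(V\Gamma,E\Gamma)$, the cutsize $\operatorname{cut}(\Gamma)$ is the minimum cardinality of a subset $S\subseteq V\Gamma$ such that every connected component of $\Gamma-S$ contains at most $\frac12|V\Gamma|$ vertices. For any graph $X$, the separation profile of $X$ is the function $\operatorname{sep}_X:\mathbb N\to\mathbb N$, \[ \operatorname{sep}_X(r)=\max\{\operatorname{cut}(\Gamma) : \Gamma\leq X,\ |V\Gamma|\leq r\}, \] where $\Gamma\leq X$ means $\Gamma$ is a (finite) subgraph of $X$. For functions $f,g:\mathbb N\to\mathbb N$, write $f\lesssim g$ if there is a constant $C$ such that $f(r)\leq Cg(Cr)+C$ for all $r\in\mathbb N$, and $f\simeq g$ if $f\lesssim g$ and $g\lesssim f$. For a finitely generated group $G$, $\operatorname{sep}_G$ denotes the separation profile of a Cayley graph of $G$ with respect to a finite generating set. It is considered up to $\simeq$, and up to $\simeq$ it does not depend on the choice of finite generating set. *)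

theory Defs
  imports "HOL-Algebra.Generated_Groups" "Graph_Theory.Graph_Theory"
begin

section \<open>Separation profiles\<close>

text \<open>
  Undirected graphs are symmetric digraphs; the locale \<^locale>\<open>graph\<close> describes the finite simple
  graphs. The connected components of a symmetric digraph are its strongly connected components.
\<close>

definition cutsize :: "('a, 'b) pre_digraph \<Rightarrow> nat" where
  "cutsize \<Gamma> = Min (card ` {S. S \<subseteq> verts \<Gamma> \<and>
     (\<forall>K \<in> pre_digraph.sccs (induce_subgraph \<Gamma> (verts \<Gamma> - S)). 2 * card (verts K) \<le> card (verts \<Gamma>))})"

definition sep :: "('a, 'b) pre_digraph \<Rightarrow> nat \<Rightarrow> nat" where
  "sep X r = Max {cutsize \<Gamma> | \<Gamma>. subgraph \<Gamma> X \<and> graph \<Gamma> \<and> card (verts \<Gamma>) \<le> r}"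

definition asymp_le :: "(nat \<Rightarrow> nat) \<Rightarrow> (nat \<Rightarrow> nat) \<Rightarrow> bool" (infix \<open>\<lesssim>\<close> 50) where
  "f \<lesssim> g \<longleftrightarrow> (\<exists>C. \<forall>r. f r \<le> C * g (C * r) + C)"

definition asymp_eq :: "(nat \<Rightarrow> nat) \<Rightarrow> (nat \<Rightarrow> nat) \<Rightarrow> bool" (infix \<open>\<simeq>\<close> 50) where
  "f \<simeq> g \<longleftrightarrow> f \<lesssim> g \<and> g \<lesssim> f"

section \<open>Cayley graphs\<close>

definition finite_generating_set :: "('a, 'm) monoid_scheme \<Rightarrow> 'a set \<Rightarrow> bool" where
  "finite_generating_set G S \<longleftrightarrow> finite S \<and> S \<subseteq> carrier G \<and> generate G S = carrier G"

definition finitely_generated :: "('a, 'm) monoid_scheme \<Rightarrow> bool" where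
  "finitely_generated G \<longleftrightarrow> (\<exists>S. finite_generating_set G S)"

text \<open>The simple undirected Cayley graph: orientations, labels, loops and multiplicities are dropped.\<close>

definition cayley_graph :: "('a, 'm) monoid_scheme \<Rightarrow> 'a set \<Rightarrow> ('a, 'a \<times> 'a) pre_digraph" where
  "cayley_graph G S =
    \<lparr> verts = carrier G,
      arcs = {(g, h). g \<in> carrier G \<and> h \<in> carrier G \<and> g \<noteq> h \<and>
                (\<exists>s \<in> S. h = g \<otimes>\<^bsub>G\<^esub> s \<or> g = h \<otimes>\<^bsub>G\<^esub> s)},
      tail = fst, head = snd \<rparr>"

section \<open>Graphs of groups\<close>

text \<open>
  The underlying graph may have loops and multiple edges. Each of its unoriented edges is given
  by a single arc, with an arbitrary orientation; \<open>tail_map\<close> and \<open>head_map\<close> embed the edge group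
  into the groups of the two endpoints.
\<close>

record ('v, 'e, 'a, 'b) pre_graph_of_groups =
  base_graph :: "('v, 'e) pre_digraph"
  vgroup :: "'v \<Rightarrow> 'a monoid"
  egroup :: "'e \<Rightarrow> 'b monoid"
  tail_map :: "'e \<Rightarrow> 'b \<Rightarrow> 'a"
  head_map :: "'e \<Rightarrow> 'b \<Rightarrow> 'a"

locale graph_of_groups =
  fixes \<G> :: "('v, 'e, 'a, 'b) pre_graph_of_groups"
  assumes wf_base_graph: "wf_digraph (base_graph \<G>)"
    and connected_base_graph: "connected (base_graph \<G>)"
    and group_vgroup: "v \<in> verts (base_graph \<G>) \<Longrightarrow> group (vgroup \<G> v)"
    and group_egroup: "e \<in> arcs (base_graph \<G>) \<Longrightarrow> group (egroup \<G> e)"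
    and tail_map_mon: "e \<in> arcs (base_graph \<G>) \<Longrightarrow>
          tail_map \<G> e \<in> mon (egroup \<G> e) (vgroup \<G> (tail (base_graph \<G>) e))"
    and head_map_mon: "e \<in> arcs (base_graph \<G>) \<Longrightarrow>
          head_map \<G> e \<in> mon (egroup \<G> e) (vgroup \<G> (head (base_graph \<G>) e))"

locale finite_graph_of_groups = graph_of_groups \<G> + fin_digraph "base_graph \<G>"
  for \<G> :: "('v, 'e, 'a, 'b) pre_graph_of_groups"

section \<open>The fundamental group\<close>

text \<open>
  This is Serre's construction. The path group is generated by the vertex groups and the oriented
  edges, subject to the relations of the vertex groups, the relations making the two orientations of
  an edge inverse to each other, and \<open>e \<cdot> head_map e a \<cdot> e\<inverse> = tail_map e a\<close>. All generators
  being invertible, it is presented as a monoid. The fundamental group at a vertex consists of the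
  elements of the path group that are represented by closed paths at that vertex.

  \<open>Edge e True\<close> is the arc \<open>e\<close> traversed from tail to head, \<open>Edge e False\<close> its reverse. Unlike in
  Serre's normal form, the vertex and edge letters of a path need not alternate; inserting identities
  and multiplying adjacent vertex letters shows that the same elements are represented.
\<close>

datatype ('v, 'e, 'a) letter = Vert 'v 'a | Edge 'e bool

definition letters :: "('v, 'e, 'a, 'b) pre_graph_of_groups \<Rightarrow> ('v, 'e, 'a) letter set" where
  "letters \<G> = {Vert v g | v g. v \<in> verts (base_graph \<G>) \<and> g \<in> carrier (vgroup \<G> v)} \<union>
               {Edge e b | e b. e \<in> arcs (base_graph \<G>)}"

inductive_set word_cong ::
    "('v, 'e, 'a, 'b) pre_graph_of_groups \<Rightarrow> (('v, 'e, 'a) letter list \<times> ('v, 'e, 'a) letter list) set"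
  for \<G> :: "('v, 'e, 'a, 'b) pre_graph_of_groups" where
  vert_mult: "\<lbrakk>v \<in> verts (base_graph \<G>); g \<in> carrier (vgroup \<G> v); h \<in> carrier (vgroup \<G> v)\<rbrakk> \<Longrightarrow>
      ([Vert v g, Vert v h], [Vert v (g \<otimes>\<^bsub>vgroup \<G> v\<^esub> h)]) \<in> word_cong \<G>"
| vert_one: "v \<in> verts (base_graph \<G>) \<Longrightarrow> ([Vert v \<one>\<^bsub>vgroup \<G> v\<^esub>], []) \<in> word_cong \<G>"
| edge_inv: "e \<in> arcs (base_graph \<G>) \<Longrightarrow> ([Edge e b, Edge e (\<not> b)], []) \<in> word_cong \<G>"
| edge_conj: "\<lbrakk>e \<in> arcs (base_graph \<G>); a \<in> carrier (egroup \<G> e)\<rbrakk> \<Longrightarrow>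
      ([Edge e True, Vert (head (base_graph \<G>) e) (head_map \<G> e a), Edge e False],
       [Vert (tail (base_graph \<G>) e) (tail_map \<G> e a)]) \<in> word_cong \<G>"
| refl: "w \<in> lists (letters \<G>) \<Longrightarrow> (w, w) \<in> word_cong \<G>"
| sym: "(u, w) \<in> word_cong \<G> \<Longrightarrow> (w, u) \<in> word_cong \<G>"
| trans: "\<lbrakk>(u, w) \<in> word_cong \<G>; (w, z) \<in> word_cong \<G>\<rbrakk> \<Longrightarrow> (u, z) \<in> word_cong \<G>"
| append: "\<lbrakk>(u, u') \<in> word_cong \<G>; (w, w') \<in> word_cong \<G>\<rbrakk> \<Longrightarrow> (u @ w, u' @ w') \<in> word_cong \<G>"

definition path_group :: "('v, 'e, 'a, 'b) pre_graph_of_groups \<Rightarrow> ('v, 'e, 'a) letter list set monoid" where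
  "path_group \<G> =
    \<lparr> carrier = lists (letters \<G>) // word_cong \<G>,
      monoid.mult = (\<lambda>A B. \<Union>u \<in> A. \<Union>w \<in> B. word_cong \<G> `` {u @ w}),
      one = word_cong \<G> `` {[]} \<rparr>"

fun is_path :: "('v, 'e, 'a, 'b) pre_graph_of_groups \<Rightarrow> 'v \<Rightarrow> ('v, 'e, 'a) letter list \<Rightarrow> 'v \<Rightarrow> bool" where
  "is_path \<G> u [] v \<longleftrightarrow> u = v \<and> u \<in> verts (base_graph \<G>)"
| "is_path \<G> u (Vert x g # w) v \<longleftrightarrow>
     x = u \<and> u \<in> verts (base_graph \<G>) \<and> g \<in> carrier (vgroup \<G> u) \<and> is_path \<G> u w v"
| "is_path \<G> u (Edge e b # w) v \<longleftrightarrow> e \<in> arcs (base_graph \<G>) \<and>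
     (if b then tail (base_graph \<G>) e = u \<and> is_path \<G> (head (base_graph \<G>) e) w v
      else head (base_graph \<G>) e = u \<and> is_path \<G> (tail (base_graph \<G>) e) w v)"

definition fundamental_group ::
    "('v, 'e, 'a, 'b) pre_graph_of_groups \<Rightarrow> 'v \<Rightarrow> ('v, 'e, 'a) letter list set monoid" where
  "fundamental_group \<G> v =
     (path_group \<G>)\<lparr>carrier := {word_cong \<G> `` {w} | w. is_path \<G> v w v}\<rparr>"

end

theory Submission
  imports Defs
begin

text \<open>
  Paths from \<open>v\<^sub>0\<close> have normal forms \<open>(p, g)\<close>: the reduced prefix \<open>p\<close> is a vertex of the Bass--Serre
  tree, and the forms with a fixed prefix make up a copy of a Cayley graph of a vertex group. Neighbouring copies are joined through boundedly many points because the edge groups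
  are finite. The letters act on normal forms by bijections respecting the relations of the path
  group, so vertex groups embed in \<open>G\<close> and \<open>G\<close> embeds in the graph of normal forms, in both cases by
  injective Lipschitz maps; these cannot decrease the separation profile up to \<open>\<simeq>\<close>.

  For the upper bound, a finite set of normal forms has a centroid prefix \<open>p\<close>. Projecting onto the
  piece at \<open>p\<close> gives a weighted finite subset of a vertex group, and it suffices to separate
  the weight there. That weighted separators are no more expensive, up to a constant, than separators
  balanced with respect to cardinality in all subsets is a form of the theorem of Dvorak and Norin on
  treewidth and balanced separations.
\<close>

section \<open>Balanced separators\<close>

text \<open>Arbitrarily many branches may hang at a single point of the centroid piece. A separator
  that halves the number of points of the piece may therefore leave almost all of the projected mass
  in one component, which is why weights enter. The large constant \<open>400\<close> comes from
  that step alone.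

  The Lipschitz maps are only asked to be injective, and their images may be sparse. So
  \<open>G\<close> can be placed inside a larger graph in which all pieces look alike, and a change
  of generating set is one more instance of the same comparison. All comparisons are between
  instances of \<open>separable\<close>, a statement about finite sets with an explicit bound;
  \<open>Max\<close> and subgraphs occur only where \<open>separable\<close> is tied to
  \<open>sep\<close>.

  That different normal forms represent different elements is obtained in the manner of van der
  Waerden: letting words act on the forms takes the place of a confluence argument for
  rewriting.\<close>

definition connected_set :: "('a \<Rightarrow> 'a \<Rightarrow> bool) \<Rightarrow> 'a set \<Rightarrow> bool" where
  "connected_set E R \<longleftrightarrow> (\<forall>Q \<subseteq> R. Q \<noteq> {} \<longrightarrow> (\<forall>x \<in> Q. \<forall>y \<in> R. E x y \<longrightarrow> y \<in> Q) \<longrightarrow> Q = R)"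

text \<open>With connectivity defined by closed subsets instead of paths, this is an induction
  principle: what holds at \<open>q\<close> and spreads along edges inside \<open>R\<close> holds on
  \<open>R\<close>. For a relation that is not symmetric the notion is strong connectivity, in
  agreement with the components in \<open>cutsize\<close>.\<close>

lemma connected_setD:
  assumes "connected_set E R" "Q \<subseteq> R" "q \<in> Q" "\<And>x y. x \<in> Q \<Longrightarrow> y \<in> R \<Longrightarrow> E x y \<Longrightarrow> y \<in> Q"
  shows "Q = R"
  using assms unfolding connected_set_def by blast

lemma connected_set_singleton [simp]: "connected_set E {x}"
  unfolding connected_set_def by blast

lemma connected_set_Union:
  assumes "\<And>R. R \<in> \<R> \<Longrightarrow> connected_set E R \<and> x \<in> R"
  shows "connected_set E (\<Union>\<R>)"
  unfolding connected_set_def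
proof (intro allI impI)
  fix Q assume Q: "Q \<subseteq> \<Union>\<R>" "Q \<noteq> {}" and cl: "\<forall>x\<in>Q. \<forall>y\<in>\<Union>\<R>. E x y \<longrightarrow> y \<in> Q"
  have sub: "R \<subseteq> Q" if R: "R \<in> \<R>" "q \<in> Q" "q \<in> R" for R q
  proof -
    have "Q \<inter> R = R"
      by (rule connected_setD[of E R _ q]) (use assms R cl in blast)+
    then show ?thesis by blast
  qed
  obtain q R0 where "q \<in> Q" "q \<in> R0" "R0 \<in> \<R>" using Q by blast
  then have "x \<in> Q" using sub assms by blast
  then show "Q = \<Union>\<R>" using sub assms Q by blast
qed

lemma connected_set_Un:
  assumes "connected_set E R" "connected_set E R'" "x \<in> R" "x \<in> R'"
  shows "connected_set E (R \<union> R')"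
  using connected_set_Union[of "{R, R'}" E x] assms by auto

lemma connected_set_insert:
  assumes "symp E" "connected_set E R" "u \<in> R" "E u v"
  shows "connected_set E (insert v R)"
proof -
  have "connected_set E {u, v}"
    using assms(1,4) unfolding connected_set_def symp_def by blast
  then have "connected_set E (R \<union> {u, v})"
    by (rule connected_set_Un[OF assms(2) _ assms(3)]) simp
  then show ?thesis using assms(3) by (simp add: insert_absorb)
qed

definition component :: "('a \<Rightarrow> 'a \<Rightarrow> bool) \<Rightarrow> 'a set \<Rightarrow> 'a \<Rightarrow> 'a set" where
  "component E U x = \<Union>{R. connected_set E R \<and> x \<in> R \<and> R \<subseteq> U}"

lemma connected_component: "connected_set E (component E U x)"
  unfolding component_def by (rule connected_set_Union[where x = x]) blast

lemma component_subset: "component E U x \<subseteq> U"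
  unfolding component_def by blast

lemma component_refl: "x \<in> U \<Longrightarrow> x \<in> component E U x"
  unfolding component_def by (rule UnionI[of "{x}"]) auto

lemma component_maximal:
  assumes "connected_set E R" "R \<subseteq> U" "y \<in> R" "y \<in> component E U x"
  shows "R \<subseteq> component E U x"
proof -
  have x: "x \<in> U" "x \<in> component E U x"
    using assms(4) unfolding component_def by auto
  have "connected_set E (component E U x \<union> R)"
    using connected_set_Un connected_component assms by fast
  then have "component E U x \<union> R \<in> {R. connected_set E R \<and> x \<in> R \<and> R \<subseteq> U}"
    using x assms component_subset by fast
  then show ?thesis unfolding component_def by blast
qed

lemma component_step:
  assumes "symp E" "u \<in> component E U x" "E u v" "v \<in> U"
  shows "v \<in> component E U x"
proof -
  have "connected_set E {u, v}" using connected_set_insert[OF assms(1), of "{u}" u v] assms(3)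
    by (simp add: insert_commute)
  then have "{u, v} \<subseteq> component E U x"
    by (rule component_maximal[where y = u]) (use assms component_subset in \<open>auto dest: subsetD[OF component_subset]\<close>)
  then show ?thesis by simp
qed

lemma component_eq:
  assumes "y \<in> component E U x"
  shows "component E U y = component E U x"
proof -
  have x: "x \<in> component E U x" "y \<in> U"
    using assms unfolding component_def by auto
  have "component E U x \<subseteq> component E U y"
    by (rule component_maximal[of _ _ _ y])
      (use x assms in \<open>auto simp: connected_component component_refl intro: subsetD[OF component_subset]\<close>)
  moreover have "component E U y \<subseteq> component E U x"
    by (rule component_maximal[of _ _ _ y])
      (use x assms in \<open>auto simp: connected_component component_refl intro: subsetD[OF component_subset]\<close>)
  ultimately show ?thesis by blast
qed

text \<open>The form of a bound on \<open>sep\<close> that is transported between graphs. Subgraphs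
  that are not induced are covered too, because removing edges leaves fewer connected sets.\<close>

definition separable :: "('a \<Rightarrow> 'a \<Rightarrow> bool) \<Rightarrow> 'a set \<Rightarrow> nat \<Rightarrow> nat \<Rightarrow> bool" where
  "separable E V m a \<longleftrightarrow> (\<forall>F. finite F \<and> F \<subseteq> V \<and> card F \<le> m \<longrightarrow>
     (\<exists>S \<subseteq> F. card S \<le> a \<and> (\<forall>R \<subseteq> F - S. connected_set E R \<longrightarrow> 2 * card R \<le> card F)))"

lemma separableE:
  assumes "separable E V m a" "finite F" "F \<subseteq> V" "card F \<le> m"
  obtains S where "S \<subseteq> F" "card S \<le> a"
    "\<And>R. R \<subseteq> F - S \<Longrightarrow> connected_set E R \<Longrightarrow> 2 * card R \<le> card F"
proof -
  have "\<exists>S \<subseteq> F. card S \<le> a \<and> (\<forall>R \<subseteq> F - S. connected_set E R \<longrightarrow> 2 * card R \<le> card F)"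
    using assms(1)[unfolded separable_def, rule_format, of F] assms(2-4) by simp
  then show thesis using that by (elim exE conjE) simp
qed

lemma separable_mono:
  assumes "separable E V m a" "m' \<le> m" "a \<le> a'" "V' \<subseteq> V"
  shows "separable E V' m' a'"
  unfolding separable_def
proof (intro allI impI)
  fix F assume F: "finite F \<and> F \<subseteq> V' \<and> card F \<le> m'"
  obtain S where "S \<subseteq> F" "card S \<le> a" "\<And>R. R \<subseteq> F - S \<Longrightarrow> connected_set E R \<Longrightarrow> 2 * card R \<le> card F"
    by (rule separableE[OF assms(1), of F]) (use F assms in auto)
  then show "\<exists>S\<subseteq>F. card S \<le> a' \<and> (\<forall>R\<subseteq>F - S. connected_set E R \<longrightarrow> 2 * card R \<le> card F)"
    using assms(3) by (intro exI[of _ S]) auto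
qed

text \<open>At most \<open>2 ^ Suc j\<close> disjoint components can have more than
  \<open>card F / 2 ^ Suc j\<close> points each, and each of these is separated once more. The costs
  \<open>2 + 4 + ... + 2 ^ j\<close> add up to \<open>2 ^ Suc j - 2\<close> separators of size
  \<open>a\<close>.\<close>

lemma separable_iterate:
  assumes "separable E V m a" "finite F" "F \<subseteq> V" "card F \<le> m"
  shows "\<exists>S \<subseteq> F. card S \<le> (2 ^ Suc j - 2) * a \<and>
    (\<forall>R \<subseteq> F - S. connected_set E R \<longrightarrow> 2 ^ j * card R \<le> card F)"
proof (induction j)
  case 0
  then show ?case using assms(2) by (intro exI[of _ "{}"]) (auto intro: card_mono)
next
  case (Suc j)
  then obtain S where S: "S \<subseteq> F" "card S \<le> (2 ^ Suc j - 2) * a"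
    "\<And>R. R \<subseteq> F - S \<Longrightarrow> connected_set E R \<Longrightarrow> 2 ^ j * card R \<le> card F" by blast
  define \<K> where "\<K> = {K \<in> component E (F - S) ` (F - S). card F < 2 ^ Suc j * card K}"
  have \<K>: "finite \<K>" "\<And>K. K \<in> \<K> \<Longrightarrow> K \<subseteq> F - S \<and> connected_set E K \<and> card F < 2 ^ Suc j * card K"
  proof -
    show "finite \<K>" unfolding \<K>_def using assms(2) by simp
    show "K \<subseteq> F - S \<and> connected_set E K \<and> card F < 2 ^ Suc j * card K" if "K \<in> \<K>" for K
      using that component_subset[of E "F - S"] connected_component[of E "F - S"] unfolding \<K>_def by blast
  qed
  have disj: "pairwise disjnt \<K>"
    unfolding pairwise_def disjnt_def \<K>_def using component_eq[of _ E "F - S"] by blast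
  have cardK: "card \<K> \<le> 2 ^ Suc j"
  proof (rule ccontr)
    assume big: "\<not> card \<K> \<le> 2 ^ Suc j"
    have "2 ^ Suc j * card F \<le> card \<K> * card F" using big by (intro mult_right_mono) auto
    also have "\<dots> = (\<Sum>K\<in>\<K>. card F)" by simp
    also have "\<dots> < (\<Sum>K\<in>\<K>. 2 ^ Suc j * card K)"
      by (rule sum_strict_mono) (use \<K> big in auto)
    also have "\<dots> = 2 ^ Suc j * card (\<Union>\<K>)"
      unfolding sum_distrib_left[symmetric]
      by (subst card_Union_disjoint[OF disj]) (use \<K> assms(2) finite_subset in \<open>auto, blast\<close>)
    also have "\<dots> \<le> 2 ^ Suc j * card F"
      by (intro mult_left_mono card_mono) (use \<K> assms(2) in auto)
    finally show False by simp
  qed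
  have "\<exists>T \<subseteq> K. card T \<le> a \<and> (\<forall>R \<subseteq> K - T. connected_set E R \<longrightarrow> 2 * card R \<le> card K)" if "K \<in> \<K>" for K
  proof -
    have K: "K \<subseteq> F" using \<K>(2) that by blast
    then have "finite K" "K \<subseteq> V" "card K \<le> m"
      using assms finite_subset card_mono[OF assms(2) K] by auto
    then show ?thesis using assms(1) unfolding separable_def by blast
  qed
  then obtain T where T: "\<And>K. K \<in> \<K> \<Longrightarrow> T K \<subseteq> K \<and> card (T K) \<le> a \<and>
      (\<forall>R \<subseteq> K - T K. connected_set E R \<longrightarrow> 2 * card R \<le> card K)"
    by metis
  let ?S = "S \<union> (\<Union>K\<in>\<K>. T K)"
  have "card ?S \<le> card S + card (\<Union>K\<in>\<K>. T K)" by (rule card_Un_le)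
  also have "card (\<Union>K\<in>\<K>. T K) \<le> (\<Sum>K\<in>\<K>. card (T K))" by (rule card_UN_le[OF \<K>(1)])
  also have "\<dots> \<le> card \<K> * a" using T sum_bounded_above[of \<K> "\<lambda>K. card (T K)" a] by auto
  also have "\<dots> \<le> 2 ^ Suc j * a" using cardK by (rule mult_right_mono) simp
  also have "card S + 2 ^ Suc j * a \<le> (2 ^ Suc j - 2) * a + 2 ^ Suc j * a" using S by simp
  also have "\<dots> = (2 ^ Suc (Suc j) - 2) * a"
  proof -
    have "(2 ^ Suc j - 2) + 2 ^ Suc j = (2 ^ Suc (Suc j) - 2 :: nat)" by simp
    then show ?thesis by (metis distrib_right)
  qed
  finally have "card ?S \<le> (2 ^ Suc (Suc j) - 2) * a" by simp
  moreover have "?S \<subseteq> F"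
  proof -
    have "T K \<subseteq> F" if "K \<in> \<K>" for K using T[OF that] \<K>(2)[OF that] by blast
    then show ?thesis using S(1) by blast
  qed
  moreover have "2 ^ Suc j * card R \<le> card F" if R: "R \<subseteq> F - ?S" "connected_set E R" for R
  proof (cases "R = {}")
    case False
    then obtain x where x: "x \<in> R" by blast
    define K where "K = component E (F - S) x"
    have "R \<subseteq> K" unfolding K_def
      by (rule component_maximal[of _ _ _ x]) (use R x in \<open>auto intro: component_refl\<close>)
    have K: "K \<subseteq> F - S" "connected_set E K"
      unfolding K_def by (rule component_subset connected_component)+
    have "finite K" using K(1) assms(2) by (meson finite_Diff finite_subset)
    show ?thesis
    proof (cases "K \<in> \<K>")
      case True
      then have "R \<subseteq> K - T K" using \<open>R \<subseteq> K\<close> R by blast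
      then have "2 * card R \<le> card K" using T[OF True] R(2) by blast
      then have "2 ^ j * (2 * card R) \<le> 2 ^ j * card K" by simp
      also have "\<dots> \<le> card F" using S(3) K by blast
      finally show ?thesis by (simp add: mult.assoc mult.left_commute)
    next
      case False
      have "K \<in> component E (F - S) ` (F - S)" unfolding K_def using R x by blast
      then have "2 ^ Suc j * card K \<le> card F" using False unfolding \<K>_def by auto
      moreover have "card R \<le> card K" using \<open>R \<subseteq> K\<close> \<open>finite K\<close> by (simp add: card_mono)
      ultimately show ?thesis by (meson le_trans mult_le_mono2)
    qed
  qed auto
  ultimately show ?case by meson
qed

section \<open>Weighted separators\<close>

text \<open>The vertex cut belonging to \<open>R\<close> as source side: the points of
  \<open>D\<close> outside \<open>R\<close> that flow enters from \<open>R\<close>, or at which it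
  starts.\<close>

definition frontier :: "('a \<Rightarrow> 'a \<Rightarrow> bool) \<Rightarrow> 'a set \<Rightarrow> 'a set \<Rightarrow> 'a set \<Rightarrow> 'a set" where
  "frontier E X D R = {v \<in> D - R. v \<in> X \<or> (\<exists>u \<in> R. E u v)}"

text \<open>
  The min-cut condition for a flow in which every vertex of \<open>X\<close> is a source, every vertex of \<open>D\<close>
  absorbs one unit and lets at most \<open>s\<close> units pass.
\<close>

definition saturated :: "('a \<Rightarrow> 'a \<Rightarrow> bool) \<Rightarrow> 'a set \<Rightarrow> nat \<Rightarrow> 'a set \<Rightarrow> bool" where
  "saturated E X s D \<longleftrightarrow> (\<forall>R \<subseteq> D. card D \<le> card R + s * card (frontier E X D R))"

lemma frontier_subset: "frontier E X D R \<subseteq> D"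
  unfolding frontier_def by blast

lemma frontier_submodular:
  assumes "finite D"
  shows "card (frontier E X D (R \<union> R')) + card (frontier E X D (R \<inter> R'))
    \<le> card (frontier E X D R) + card (frontier E X D R')" (is "card ?U + card ?I \<le> card ?A + card ?B")
proof -
  have fin: "finite (frontier E X D Q)" for Q using assms frontier_subset finite_subset by metis
  have "card ?U + card ?I = card (?U \<union> ?I) + card (?U \<inter> ?I)" by (rule card_Un_Int[OF fin fin])
  also have "\<dots> \<le> card (?A \<union> ?B) + card (?A \<inter> ?B)"
    by (intro add_mono card_mono finite_UnI finite_Int disjI1 fin) (auto simp: frontier_def)
  also have "\<dots> = card ?A + card ?B" by (rule card_Un_Int[OF fin fin, symmetric])
  finally show ?thesis .
qed

text \<open>
  Tight sets are closed under intersection by submodularity. Any outside neighbour of the least tight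
  set can be added to \<open>D\<close>; if there is none, that set is a cut.
\<close>

lemma saturated_extend_or_cut:
  assumes A: "finite A" "D \<subseteq> A" and sat: "saturated E X s D" and s: "0 < s"
  shows "(\<exists>v \<in> A - D. saturated E X s (insert v D)) \<or>
    (\<exists>R \<subseteq> D. card R + s * card (frontier E X A R) = card D)"
proof -
  have D: "finite D" using A finite_subset by blast
  define tight where "tight R \<longleftrightarrow> R \<subseteq> D \<and> card R + s * card (frontier E X D R) = card D" for R
  have tight_Int: "tight (R \<inter> R')" if "tight R" "tight R'" for R R'
  proof -
    have R: "R \<subseteq> D" "R' \<subseteq> D" using that by (auto simp: tight_def)
    then have fin: "finite R" "finite R'" using D finite_subset by blast+
    have "card D \<le> card (R \<inter> R') + s * card (frontier E X D (R \<inter> R'))"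
         "card D \<le> card (R \<union> R') + s * card (frontier E X D (R \<union> R'))"
      using sat R unfolding saturated_def by (blast, simp)
    moreover have "card R + card R' = card (R \<union> R') + card (R \<inter> R')"
      by (rule card_Un_Int[OF fin])
    moreover have "s * card (frontier E X D (R \<union> R')) + s * card (frontier E X D (R \<inter> R'))
        \<le> s * card (frontier E X D R) + s * card (frontier E X D R')"
      unfolding distrib_left[symmetric] by (rule mult_le_mono2[OF frontier_submodular[OF D]])
    ultimately show ?thesis using that R unfolding tight_def by auto
  qed
  have "frontier E X D D = {}" unfolding frontier_def by blast
  then have "tight D" unfolding tight_def by simp
  then obtain R0 where R0: "tight R0" "\<And>R. tight R \<Longrightarrow> card R0 \<le> card R"
    by (metis arg_min_natI arg_min_nat_le)
  have least: "R0 \<subseteq> R" if "tight R" for R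
  proof -
    have "finite R0" using R0(1) D unfolding tight_def using finite_subset by blast
    moreover have "card R0 \<le> card (R \<inter> R0)" using R0 tight_Int that by blast
    ultimately have "R \<inter> R0 = R0" by (intro card_seteq) auto
    then show ?thesis by blast
  qed
  have R0D: "R0 \<subseteq> D" using R0 unfolding tight_def by blast
  show ?thesis
  proof (cases "frontier E X A R0 \<subseteq> D")
    case True
    then have "frontier E X A R0 = frontier E X D R0" unfolding frontier_def using A by blast
    then show ?thesis using R0(1) R0D unfolding tight_def by auto
  next
    case False
    then obtain v where v: "v \<in> A - D" "v \<in> X \<or> (\<exists>u \<in> R0. E u v)"
      unfolding frontier_def by blast
    \<comment> \<open>The demand rises by one. If \<open>v \<in> R\<close>, then
      \<open>card R\<close> pays for it; if \<open>R\<close> is not tight, its slack does; if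
      \<open>R\<close> is tight, it contains \<open>R0\<close>, so \<open>v\<close> joins its
      frontier and contributes \<open>s \<ge> 1\<close>.\<close>
    have "saturated E X s (insert v D)" unfolding saturated_def
    proof (intro allI impI)
      fix R assume R: "R \<subseteq> insert v D"
      have finR: "finite R" using R D finite_subset by blast
      have fin: "finite (frontier E X (insert v D) Q)" for Q using D by (simp add: frontier_def)
      have cardD: "card (insert v D) = Suc (card D)" using v D by simp
      show "card (insert v D) \<le> card R + s * card (frontier E X (insert v D) R)"
      proof (cases "v \<in> R")
        case True
        have "card D \<le> card (R - {v}) + s * card (frontier E X D (R - {v}))"
          using sat R unfolding saturated_def by blast
        moreover have "card (frontier E X D (R - {v})) \<le> card (frontier E X (insert v D) R)"
          by (rule card_mono[OF fin]) (use True v in \<open>auto simp: frontier_def\<close>)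
        then have "s * card (frontier E X D (R - {v})) \<le> s * card (frontier E X (insert v D) R)" by simp
        moreover have "card R = Suc (card (R - {v}))" using True finR by (metis card_Suc_Diff1)
        ultimately show ?thesis using cardD by linarith
      next
        case False
        then have RD: "R \<subseteq> D" using R by blast
        have le: "card D \<le> card R + s * card (frontier E X D R)"
          using sat RD unfolding saturated_def by blast
        have sub: "frontier E X D R \<subseteq> frontier E X (insert v D) R" by (auto simp: frontier_def)
        show ?thesis
        proof (cases "tight R")
          case True
          then have "v \<in> frontier E X (insert v D) R" using least[OF True] v False
            unfolding frontier_def by blast
          moreover have "v \<notin> frontier E X D R" using v unfolding frontier_def by blast
          ultimately have "frontier E X D R \<subset> frontier E X (insert v D) R" using sub by blast
          then have "Suc (card (frontier E X D R)) \<le> card (frontier E X (insert v D) R)"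
            using psubset_card_mono[OF fin] by (simp add: Suc_leI)
          then have "s * Suc (card (frontier E X D R)) \<le> s * card (frontier E X (insert v D) R)"
            by (rule mult_le_mono2)
          then show ?thesis using le s cardD by simp
        next
          case False
          have "s * card (frontier E X D R) \<le> s * card (frontier E X (insert v D) R)"
            using card_mono[OF fin sub] by simp
          then show ?thesis using le False RD cardD unfolding tight_def by linarith
        qed
      qed
    qed
    then show ?thesis using v by blast
  qed
qed

text \<open>A saturated set is grown from the empty set one vertex at a time. If it gets stuck
  before reaching size \<open>q\<close>, the cut that blocks it has value
  \<open>card D < q\<close>.\<close>

lemma saturated_or_cut:
  assumes "finite A" "0 < s"
  obtains D where "D \<subseteq> A" "saturated E X s D" "card D = q"
  | R where "R \<subseteq> A" "card R + s * card (frontier E X A R) < q"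
proof -
  let ?P = "\<lambda>D. D \<subseteq> A \<and> saturated E X s D \<and> card D \<le> q"
  have "?P {}" by (simp add: saturated_def)
  then obtain D where D: "?P D" "\<And>D'. ?P D' \<Longrightarrow> card D' \<le> card D"
    using ex_has_greatest_nat[of ?P "{}" card "Suc q"] by (auto simp: less_Suc_eq_le)
  show thesis
  proof (cases "card D = q")
    case True
    then show thesis using D that by blast
  next
    case False
    then have less: "card D < q" using D by simp
    have "\<not> saturated E X s (insert v D)" if "v \<in> A - D" for v
    proof
      assume "saturated E X s (insert v D)"
      moreover have "card (insert v D) = Suc (card D)"
        using that D finite_subset[OF _ assms(1)] by auto
      ultimately have "Suc (card D) \<le> card D" using D(2)[of "insert v D"] D(1) that less by auto
      then show False by simp
    qed
    then obtain R where "R \<subseteq> D" "card R + s * card (frontier E X A R) = card D"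
      using saturated_extend_or_cut[OF assms(1) _ _ assms(2), of D E X] D by blast
    then show thesis using that(2)[of R] D less by auto
  qed
qed

section \<open>From balanced separators to weighted ones\<close>

definition boundary :: "('a \<Rightarrow> 'a \<Rightarrow> bool) \<Rightarrow> 'a set \<Rightarrow> 'a set \<Rightarrow> 'a set" where
  "boundary E F B = {v \<in> F - B. \<exists>u \<in> B. E u v}"

text \<open>
  If the claim fails, every small set leaves a unique heavy component. Among the heavy sets \<open>B\<close> with
  boundary \<open>X\<close> of size at most \<open>200 a\<close>, minimise \<open>|B| 2^(|X| / 2a)\<close>. A balanced separator of \<open>B\<close>
  would improve this unless \<open>X\<close> is nearly as large as allowed. Minimality also shows that \<open>X\<close> stays
  attached to the heavy part of \<open>B\<close> after deleting few vertices, and that a set \<open>D\<close> with \<open>|D| = |B|\<close>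
  can be fed from \<open>X\<close> outside \<open>B\<close>. Then a small separator of \<open>B \<union> D\<close> leaves a component with a
  fixed proportion of \<open>D\<close>, which is absurd.
\<close>

theorem weighted_separator:
  fixes w :: "'a \<Rightarrow> nat"
  assumes E: "symp E" and F: "finite F" and sep: "separable E F (2 * card F) a" and a: "0 < a"
  shows "\<exists>S \<subseteq> F. card S \<le> 400 * a \<and>
    (\<forall>R \<subseteq> F - S. connected_set E R \<longrightarrow> 2 * sum w R \<le> sum w F)"
proof (rule ccontr)
  assume "\<not> ?thesis"
  then have heavy_ex: "\<exists>R \<subseteq> F - S. connected_set E R \<and> sum w F < 2 * sum w R"
    if "S \<subseteq> F" "card S \<le> 400 * a" for S
    using that by (meson not_le)
  define heavy where "heavy R \<longleftrightarrow> R \<subseteq> F \<and> sum w F < 2 * sum w R" for R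
  have finB: "finite R" if "R \<subseteq> F" for R using that F finite_subset by blast
  have heavy_meet: "R \<inter> R' \<noteq> {}" if "heavy R" "heavy R'" for R R'
  proof
    assume "R \<inter> R' = {}"
    then have "sum w R + sum w R' = sum w (R \<union> R')"
      using that finB unfolding heavy_def by (intro sum.union_disjoint[symmetric]) auto
    also have "\<dots> \<le> sum w F" using that F unfolding heavy_def by (intro sum_mono2) auto
    finally show False using that unfolding heavy_def by linarith
  qed
  have bd_sub: "boundary E F B \<subseteq> F - B" for B unfolding boundary_def by blast
  \<comment> \<open>Passing from a heavy connected set to its whole component in
    \<open>F - S\<close> forces the boundary into \<open>S\<close>.\<close>
  have region: "\<exists>B. B \<subseteq> F - S \<and> connected_set E B \<and> heavy B \<and> boundary E F B \<subseteq> S"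
    if S: "S \<subseteq> F" "card S \<le> 400 * a" for S
  proof -
    obtain R where R: "R \<subseteq> F - S" "connected_set E R" "sum w F < 2 * sum w R"
      using heavy_ex[OF S] by (elim exE conjE)
    then have "R \<noteq> {}" by auto
    then obtain x where x: "x \<in> R" by blast
    define B where "B = component E (F - S) x"
    have B: "B \<subseteq> F - S" "connected_set E B" unfolding B_def
      by (rule component_subset connected_component)+
    have "x \<in> B" unfolding B_def by (rule component_refl) (use x R in blast)
    then have "R \<subseteq> B" unfolding B_def by (rule component_maximal[OF R(2,1) x])
    then have "sum w R \<le> sum w B" using B(1) finB[of B] by (intro sum_mono2) auto
    then have "heavy B" using R(3) B(1) unfolding heavy_def by auto
    moreover have "boundary E F B \<subseteq> S"
    proof
      fix v assume v: "v \<in> boundary E F B"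
      then obtain u where "u \<in> B" "E u v" "v \<in> F" "v \<notin> B" unfolding boundary_def by blast
      then show "v \<in> S" using component_step[OF E, of u "F - S" x v] unfolding B_def by blast
    qed
    ultimately show ?thesis using B by blast
  qed
  \<comment> \<open>Two heavy sets share a point, and a connected set can leave \<open>B\<close>
    only through the boundary of \<open>B\<close>.\<close>
  have inside: "B' \<subseteq> B" if B: "heavy B" "heavy B'" "connected_set E B'" "B' \<inter> boundary E F B = {}" for B B'
  proof -
    obtain x where x: "x \<in> B" "x \<in> B'" using heavy_meet B by blast
    have "B' \<inter> B = B'"
    proof (rule connected_setD[OF B(3), of _ x])
      fix u v assume "u \<in> B' \<inter> B" "v \<in> B'" "E u v"
      then show "v \<in> B' \<inter> B" using B unfolding boundary_def heavy_def by blast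
    qed (use x in auto)
    then show ?thesis by blast
  qed
  \<comment> \<open>Otherwise \<open>B\<close> and its boundary could be deleted together at a cost
    of at most \<open>400 * a\<close>, and a second heavy set disjoint from \<open>B\<close> would
    remain.\<close>
  have bound_big: "200 * a < card B" if B: "heavy B" "card (boundary E F B) \<le> 200 * a" for B
  proof (rule ccontr)
    assume "\<not> 200 * a < card B"
    then have "card (B \<union> boundary E F B) \<le> 400 * a"
      using card_Un_le[of B "boundary E F B"] B by linarith
    moreover have "B \<union> boundary E F B \<subseteq> F" using B bd_sub unfolding heavy_def by blast
    ultimately obtain R where R: "R \<subseteq> F - (B \<union> boundary E F B)" "sum w F < 2 * sum w R"
      using heavy_ex[of "B \<union> boundary E F B"] by blast
    then have "heavy R" unfolding heavy_def by blast
    then show False using heavy_meet[OF B(1)] R by blast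
  qed

  \<comment> \<open>The announced potential raised to the power \<open>2 * a\<close>, so that it is
    a natural number.\<close>
  define f where "f B = card B ^ (2 * a) * 2 ^ card (boundary E F B)" for B
  define P where "P B \<longleftrightarrow> heavy B \<and> card (boundary E F B) \<le> 200 * a" for B
  have "\<exists>B. P B" using region[of "{}"] by (auto simp: P_def)
  then obtain B where B: "P B" and minB: "\<And>B'. P B' \<Longrightarrow> f B \<le> f B'"
    by (metis arg_min_natI arg_min_nat_le)
  define X where "X = boundary E F B"
  have hB: "heavy B" "card X \<le> 200 * a" "B \<subseteq> F" "finite B" "X \<subseteq> F - B" "finite X"
  proof -
    show "heavy B" "card X \<le> 200 * a" using B unfolding P_def X_def by blast+
    then show "B \<subseteq> F" unfolding heavy_def by blast
    then show "finite B" by (rule finB)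
    show "X \<subseteq> F - B" unfolding X_def by (rule bd_sub)
    then show "finite X" using F by (meson finite_Diff finite_subset)
  qed
  have cardB: "200 * a < card B" using bound_big B unfolding P_def by blast
  have card_le_F: "card B \<le> card F" using F hB(3) by (rule card_mono)

  \<comment> \<open>Separating \<open>B\<close> halves it, which divides \<open>f\<close> by
    \<open>2 ^ (2 * a)\<close>, while the boundary grows by at most \<open>a\<close> and so costs
    only \<open>2 ^ a\<close>. The gap between \<open>199 * a\<close> and \<open>200 * a\<close> is
    the room for this growth.\<close>
  have X_big: "199 * a < card X"
  proof (rule ccontr)
    assume small: "\<not> 199 * a < card X"
    have "card B \<le> 2 * card F" using card_le_F by linarith
    then obtain S where S: "S \<subseteq> B" "card S \<le> a"
      "\<And>R. R \<subseteq> B - S \<Longrightarrow> connected_set E R \<Longrightarrow> 2 * card R \<le> card B"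
      by (rule separableE[OF sep hB(4,3)]) (rule that)
    have finS: "finite S" using S(1) hB(4) by (rule finite_subset)
    have cXS: "card (X \<union> S) \<le> card X + a" using card_Un_le[of X S] S(2) by linarith
    obtain B' where B': "B' \<subseteq> F - (X \<union> S)" "connected_set E B'" "heavy B'" "boundary E F B' \<subseteq> X \<union> S"
    proof -
      have "X \<union> S \<subseteq> F" "card (X \<union> S) \<le> 400 * a" using hB(2,3,5) S(1) cXS by auto
      from region[OF this] show thesis using that by blast
    qed
    have "B' \<subseteq> B" using inside[OF hB(1) B'(3,2)] B'(1) unfolding X_def by blast
    then have "B' \<subseteq> B - S" using B'(1) by blast
    then have half: "2 * card B' \<le> card B" by (rule S(3)[OF _ B'(2)])
    have bd: "card (boundary E F B') \<le> card X + a"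
      using card_mono[OF _ B'(4)] cXS hB(6) finS by simp
    have "f B \<le> f B'" using minB[of B'] B' bd small unfolding P_def by auto
    have "2 ^ (2 * a) * f B' = (2 * card B') ^ (2 * a) * 2 ^ card (boundary E F B')"
      unfolding f_def by (simp add: power_mult_distrib)
    also have "\<dots> \<le> card B ^ (2 * a) * 2 ^ (card X + a)"
      by (intro mult_le_mono power_mono half power_increasing bd) auto
    also have "\<dots> = 2 ^ a * f B" unfolding f_def X_def by (simp add: power_add)
    also have "\<dots> \<le> 2 ^ a * f B'" using \<open>f B \<le> f B'\<close> by simp
    finally have "2 ^ (2 * a) * f B' \<le> 2 ^ a * f B'" .
    moreover have "0 < f B'" using \<open>f B \<le> f B'\<close> cardB unfolding f_def by (intro gr0I) auto
    ultimately have "(2::nat) ^ (2 * a) \<le> 2 ^ a" by simp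
    then show False using a by simp
  qed

  \<comment> \<open>The denominator is twice the bound \<open>28 * a\<close> obtained below for a
    frontier, so at most half of the demand \<open>card B\<close> can pass through that frontier. By
    \<open>cardB\<close> the quotient is positive, and rounding loses at most a factor of
    two.\<close>
  define s where "s = card B div (56 * a)"
  have s: "0 < s" "56 * a * s \<le> card B"
    unfolding s_def using cardB a by (auto simp: div_greater_zero_iff)
  have s_big: "card B < 112 * a * s"
  proof -
    have "card B < 56 * a * Suc s" unfolding s_def using a
      by (metis dividend_less_times_div mult_Suc_right mult_pos_pos zero_less_numeral)
    also have "\<dots> \<le> 112 * a * s" using s(1) by (cases s) auto
    finally show ?thesis .
  qed
  have "finite (F - B)" using F by simp
  show False
  proof (cases rule: saturated_or_cut[OF \<open>finite (F - B)\<close> s(1), where E = E and X = X and q = "card B",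
      case_names saturated cut])
    \<comment> \<open>Adding \<open>R\<close> at most doubles \<open>B\<close> but brings the
      boundary down to \<open>112 * a\<close>. The potential would shrink, because
      \<open>2 ^ (2 * a) * 2 ^ (112 * a)\<close> is less than \<open>2 ^ (199 * a)\<close>.\<close>
    case (cut R)
    let ?Z = "frontier E X (F - B) R"
    have finR: "finite R" using cut F finite_subset by blast
    have "s * card ?Z < 112 * a * s" using cut(2) s_big by linarith
    then have Z: "card ?Z < 112 * a" by (simp add: mult.commute[of _ s])
    have bdsub: "boundary E F (B \<union> R) \<subseteq> ?Z"
      unfolding frontier_def X_def boundary_def using cut(1) by blast
    have "finite ?Z" using F frontier_subset finite_subset by (metis finite_Diff)
    then have bd: "card (boundary E F (B \<union> R)) \<le> 112 * a" using card_mono[OF _ bdsub] Z by simp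
    have cBR: "card (B \<union> R) \<le> 2 * card B" using card_Un_le[of B R] cut(2) by linarith
    have "sum w B \<le> sum w (B \<union> R)" using hB finR by (intro sum_mono2) auto
    then have "heavy (B \<union> R)" using hB(1) cut unfolding heavy_def by auto
    then have "f B \<le> f (B \<union> R)" using minB bd unfolding P_def by auto
    also have "\<dots> \<le> (2 * card B) ^ (2 * a) * 2 ^ (112 * a)"
      unfolding f_def by (intro mult_le_mono power_mono cBR power_increasing bd) auto
    also have "\<dots> = card B ^ (2 * a) * 2 ^ (114 * a)"
      by (simp add: power_mult_distrib flip: power_add)
    finally have "card B ^ (2 * a) * 2 ^ card X \<le> card B ^ (2 * a) * 2 ^ (114 * a)"
      unfolding f_def X_def .
    then have "(2::nat) ^ card X \<le> 2 ^ (114 * a)" using cardB by simp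
    then have "card X \<le> 114 * a" by simp
    then show False using X_big a by simp
  next
    case (saturated D)
    define H where "H = B \<union> D"
    have fD: "finite D" using saturated F finite_subset by blast
    have H: "finite H" "H \<subseteq> F" "card H \<le> 2 * card B"
      unfolding H_def using hB fD saturated card_Un_le[of B D] by auto
    \<comment> \<open>Three halvings cost \<open>(2 ^ 4 - 2) * a\<close> and leave components of at
      most \<open>card H / 8 \<le> card B / 4\<close> points. The component \<open>U\<close> below
      will have at least \<open>card B / 2\<close>.\<close>
    obtain S where S: "S \<subseteq> H" "card S \<le> 14 * a"
      "\<And>R. R \<subseteq> H - S \<Longrightarrow> connected_set E R \<Longrightarrow> 8 * card R \<le> card H"
    proof -
      have "card H \<le> 2 * card F" using H card_le_F by linarith
      from separable_iterate[OF sep H(1,2) this, of 3]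
      show thesis using that by (elim exE conjE) (simp add: numeral_eq_Suc)
    qed
    have finS: "finite S" using S H finite_subset by blast
    have "card (X \<union> (S \<inter> B)) \<le> 400 * a" "X \<union> (S \<inter> B) \<subseteq> F"
      using card_Un_le[of X "S \<inter> B"] card_mono[OF finS, of "S \<inter> B"] hB S by auto
    then obtain C where C: "C \<subseteq> F - (X \<union> (S \<inter> B))" "connected_set E C" "heavy C"
      "boundary E F C \<subseteq> X \<union> (S \<inter> B)"
      using region by meson
    have CB: "C \<subseteq> B" using inside[OF hB(1) C(3,2)] C(1) unfolding X_def by blast
    then have finC: "finite C" using hB finite_subset by blast
    have CX: "card X \<le> card (boundary E F C)"
    proof (rule ccontr)
      assume less: "\<not> ?thesis"
      then have "P C" using C hB unfolding P_def by auto
      then have le: "f B \<le> f C" by (rule minB)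
      have "f C < f B" unfolding f_def
      proof (rule mult_le_less_imp_less)
        show "card C ^ (2 * a) \<le> card B ^ (2 * a)" by (intro power_mono card_mono CB hB) auto
        show "(2::nat) ^ card (boundary E F C) < 2 ^ card (boundary E F B)"
          using less unfolding X_def by simp
        show "0 < card C ^ (2 * a)" using le cardB unfolding f_def
          by (metis gr0I mult_eq_0_iff le_zero_eq power_eq_0_iff less_nat_zero_code zero_neq_numeral)
      qed simp
      then show False using le by simp
    qed
    \<comment> \<open>By minimality the boundary of \<open>C\<close> is at least as large as
      \<open>X\<close>. As it lies in \<open>X \<union> S\<close>, it can miss at most
      \<open>card S\<close> points of \<open>X\<close>: nearly all sources touch
      \<open>C\<close>.\<close>
    have missX: "card (X - boundary E F C) \<le> 14 * a"
    proof -
      have "card (boundary E F C) \<le> card ((boundary E F C \<inter> X) \<union> S)"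
        using C(4) hB finS by (intro card_mono) auto
      also have "\<dots> \<le> card (boundary E F C \<inter> X) + 14 * a"
        using card_Un_le[of "boundary E F C \<inter> X" S] S(2) by linarith
      finally have "card X \<le> card (X \<inter> boundary E F C) + 14 * a" using CX by (simp add: Int_commute)
      then show ?thesis using card_Diff_subset_Int[of X "boundary E F C"] hB(6) by simp
    qed
    obtain x where x: "x \<in> C" using heavy_meet[OF C(3,3)] by blast
    define U where "U = component E (H - S) x"
    have U: "U \<subseteq> H - S" "connected_set E U" unfolding U_def
      by (rule component_subset connected_component)+
    have CHS: "C \<subseteq> H - S" using C CB unfolding H_def by blast
    have "C \<subseteq> U" unfolding U_def
      by (rule component_maximal[OF C(2) CHS x]) (use CHS x in \<open>auto intro: component_refl\<close>)
    \<comment> \<open>A source in \<open>D\<close> that touches \<open>C\<close> belongs to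
      \<open>U\<close> unless it was deleted, since \<open>U\<close> is the component of
      \<open>H - S\<close> around \<open>C\<close>. So only deleted points and the few sources
      detached from \<open>C\<close> feed the part of \<open>D\<close> outside
      \<open>U\<close>.\<close>
    have fr: "frontier E X D (U \<inter> D) \<subseteq> S \<union> (X - boundary E F C)"
    proof
      fix v assume v: "v \<in> frontier E X D (U \<inter> D)"
      show "v \<in> S \<union> (X - boundary E F C)"
      proof (rule ccontr)
        assume n: "v \<notin> S \<union> (X - boundary E F C)"
        have "\<exists>u \<in> U. E u v"
        proof (cases "v \<in> X")
          case True
          then have "v \<in> boundary E F C" using n by blast
          then show ?thesis using \<open>C \<subseteq> U\<close> unfolding boundary_def by blast
        qed (use v in \<open>auto simp: frontier_def\<close>)
        moreover have "v \<in> H - S" "v \<notin> U" using v n unfolding frontier_def H_def by blast+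
        ultimately show False using component_step[OF E, of _ "H - S" x v] unfolding U_def by blast
      qed
    qed
    have "card (frontier E X D (U \<inter> D)) \<le> card (S \<union> (X - boundary E F C))"
      using fr finS hB(6) by (intro card_mono) auto
    also have "\<dots> \<le> 28 * a" using card_Un_le[of S "X - boundary E F C"] S(2) missX by linarith
    finally have "s * card (frontier E X D (U \<inter> D)) \<le> s * (28 * a)" by simp
    moreover have "card D \<le> card (U \<inter> D) + s * card (frontier E X D (U \<inter> D))"
      using saturated(2) unfolding saturated_def by blast
    ultimately have "card B \<le> card (U \<inter> D) + s * (28 * a)" using saturated(3) by linarith
    moreover have "2 * (s * (28 * a)) \<le> card B" using s(2) by (simp add: mult.commute mult.left_commute)
    moreover have "card (U \<inter> D) \<le> card U"
      using U H by (intro card_mono) (auto intro: finite_subset)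
    ultimately have "card B \<le> 2 * card U" by linarith
    moreover have "8 * card U \<le> card H" using S(3) U by blast
    ultimately show False using H(3) cardB by linarith
  qed
qed

section \<open>Lipschitz maps and trees of pieces\<close>

primrec nball :: "('a \<Rightarrow> 'a \<Rightarrow> bool) \<Rightarrow> nat \<Rightarrow> 'a \<Rightarrow> 'a set" where
  "nball E 0 x = {x}"
| "nball E (Suc n) x = nball E n x \<union> {z. \<exists>y \<in> nball E n x. E y z}"

lemma nball_self [simp]: "x \<in> nball E n x"
  by (induction n) auto

lemma nball_mono: "n \<le> m \<Longrightarrow> nball E n x \<subseteq> nball E m x"
  by (induction m) (auto simp: le_Suc_eq)

lemma nball_trans: "y \<in> nball E n x \<Longrightarrow> z \<in> nball E m y \<Longrightarrow> z \<in> nball E (n + m) x"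
  by (induction m arbitrary: z) auto

lemma nball_sym:
  assumes "symp E"
  shows "y \<in> nball E n x \<Longrightarrow> x \<in> nball E n y"
proof (induction n arbitrary: y)
  case (Suc n)
  show ?case
  proof (cases "y \<in> nball E n x")
    case True
    then show ?thesis using Suc.IH by simp
  next
    case False
    then obtain z where z: "z \<in> nball E n x" "E z y" using Suc.prems by auto
    then have "z \<in> nball E 1 y" using assms by (auto simp: symp_def)
    then show ?thesis using nball_trans[of z E 1 y x n] Suc.IH[OF z(1)] by simp
  qed
qed simp

lemma connected_nball:
  assumes "symp E"
  shows "connected_set E (nball E n x)"
proof (induction n)
  case (Suc n)
  have "connected_set E (\<Union> (insert (nball E n x) {insert z (nball E n x) | z. \<exists>y \<in> nball E n x. E y z}))"
    by (rule connected_set_Union[where x = x]) (use Suc connected_set_insert[OF assms Suc] in auto)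
  moreover have "\<Union> (insert (nball E n x) {insert z (nball E n x) | z. \<exists>y \<in> nball E n x. E y z})
      = nball E (Suc n) x" by auto
  ultimately show ?case by simp
qed simp

lemma nball_bounded:
  assumes "\<And>x. finite {y. E x y} \<and> card {y. E x y} \<le> d"
  shows "finite (nball E n x) \<and> card (nball E n x) \<le> Suc d ^ n"
proof (induction n)
  case (Suc n)
  have eq: "nball E (Suc n) x = nball E n x \<union> (\<Union>y\<in>nball E n x. {z. E y z})" by auto
  have "card (nball E (Suc n) x) \<le> card (nball E n x) + (\<Sum>y\<in>nball E n x. card {z. E y z})"
    unfolding eq using Suc by (intro order_trans[OF card_Un_le] add_mono order_refl card_UN_le) auto
  also have "\<dots> \<le> card (nball E n x) + card (nball E n x) * d"
    using sum_bounded_above[of "nball E n x" "\<lambda>y. card {z. E y z}" d] assms by auto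
  also have "\<dots> = Suc d * card (nball E n x)" by simp
  also have "\<dots> \<le> Suc d * Suc d ^ n" using Suc by (intro mult_le_mono2) auto
  finally show ?case unfolding eq using Suc assms by auto
qed simp

lemma nball_subset:
  assumes "\<And>x y. E x y \<Longrightarrow> y \<in> V" "x \<in> V"
  shows "nball E n x \<subseteq> V"
  using assms by (induction n) auto

text \<open>The counterpart of \<open>asymp_le\<close> for \<open>separable\<close>, with one
  constant as scale, factor and summand. The first graph is the one with the smaller
  profile.\<close>

definition sep_le ::
    "('a \<Rightarrow> 'a \<Rightarrow> bool) \<Rightarrow> 'a set \<Rightarrow> ('b \<Rightarrow> 'b \<Rightarrow> bool) \<Rightarrow> 'b set \<Rightarrow> bool" where
  "sep_le E V E' V' \<longleftrightarrow> (\<exists>C. \<forall>m a. separable E' V' (C * m) a \<longrightarrow> separable E V m (C * a + C))"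

text \<open>Edges of \<open>F\<close> are replaced by connected balls of radius \<open>L\<close>
  around the image of \<open>F\<close>. A separator of the union of these balls is pulled back to
  the points whose ball meets it; by injectivity and bounded degree each of its points is met by
  boundedly many balls.\<close>

lemma sep_le_lipschitz:
  assumes E': "symp E'" and V': "\<And>x y. E' x y \<Longrightarrow> y \<in> V'"
    and deg: "\<And>x. finite {y. E' x y} \<and> card {y. E' x y} \<le> d"
    and f: "inj_on f V" "f ` V \<subseteq> V'"
    and lip: "\<And>x y. x \<in> V \<Longrightarrow> y \<in> V \<Longrightarrow> E x y \<Longrightarrow> f y \<in> nball E' L (f x)"
  shows "sep_le E V E' V'"
proof -
  define D where "D = Suc d ^ L"
  have ball: "finite (nball E' L z)" "card (nball E' L z) \<le> D" for z
    using nball_bounded[OF deg] unfolding D_def by auto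
  \<comment> \<open>The union of the balls has up to \<open>D * card F\<close> points, so its pieces
    must be smaller by a factor \<open>2 * D\<close>; that many halvings suffice as
    \<open>2 * D \<le> 2 ^ (2 * D)\<close>. The pull-back costs the further factor
    \<open>D\<close>.\<close>
  define C where "C = D * 2 ^ Suc (2 * D)"
  have "separable E V m (C * a + C)" if sep: "separable E' V' (C * m) a" for m a
    unfolding separable_def
  proof (intro allI impI, elim conjE)
    fix F assume F: "finite F" "F \<subseteq> V" "card F \<le> m"
    define F' where "F' = (\<Union>x\<in>F. nball E' L (f x))"
    have "finite F'" unfolding F'_def using F ball by simp
    have "card F' \<le> (\<Sum>x\<in>F. card (nball E' L (f x)))" unfolding F'_def by (rule card_UN_le[OF F(1)])
    also have "\<dots> \<le> card F * D" using sum_bounded_above[of F "\<lambda>x. card (nball E' L (f x))" D] ball by simp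
    finally have cF': "card F' \<le> D * card F" by (simp add: mult.commute)
    have "D * card F \<le> C * m" unfolding C_def
      using mult_le_mono[of D "D * 2 ^ Suc (2 * D)" "card F" m] F by simp
    then have cm: "card F' \<le> C * m" using cF' by linarith
    have "nball E' L (f x) \<subseteq> V'" if "x \<in> F" for x
      by (rule nball_subset[OF V']) (use that F f in auto)
    then have "F' \<subseteq> V'" unfolding F'_def by blast
    from separable_iterate[OF sep \<open>finite F'\<close> this cm, of "2 * D"]
    obtain S' where S': "S' \<subseteq> F'" "card S' \<le> (2 ^ Suc (2 * D) - 2) * a"
      and S'_sep: "\<forall>R \<subseteq> F' - S'. connected_set E' R \<longrightarrow> 2 ^ (2 * D) * card R \<le> card F'"
      by (elim exE conjE)
    define S where "S = {x \<in> F. nball E' L (f x) \<inter> S' \<noteq> {}}"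
    have "S \<subseteq> (\<Union>z\<in>S'. {x \<in> F. f x \<in> nball E' L z})"
      unfolding S_def using nball_sym[OF E'] by blast
    moreover have "finite S'" using S' \<open>finite F'\<close> finite_subset by blast
    moreover have fib: "card {x \<in> F. f x \<in> nball E' L z} \<le> D" for z
    proof -
      have "inj_on f {x \<in> F. f x \<in> nball E' L z}" using f F by (auto intro: inj_on_subset)
      then have "card {x \<in> F. f x \<in> nball E' L z} \<le> card (nball E' L z)"
        by (rule card_inj_on_le) (use ball in auto)
      then show ?thesis using ball le_trans by blast
    qed
    ultimately have "card S \<le> card (\<Union>z\<in>S'. {x \<in> F. f x \<in> nball E' L z})"
      using F by (intro card_mono) auto
    also have "\<dots> \<le> (\<Sum>z\<in>S'. card {x \<in> F. f x \<in> nball E' L z})" by (rule card_UN_le[OF \<open>finite S'\<close>])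
    also have "\<dots> \<le> card S' * D"
      using sum_bounded_above[of S' "\<lambda>z. card {x \<in> F. f x \<in> nball E' L z}" D] fib by simp
    also have "\<dots> \<le> (2 ^ Suc (2 * D) * a) * D"
      using S'(2) by (intro mult_le_mono1) (meson diff_le_self le_trans mult_le_mono1)
    also have "\<dots> \<le> C * a + C" unfolding C_def by (simp add: ac_simps)
    finally have "card S \<le> C * a + C" .
    moreover have "2 * card R \<le> card F" if R: "R \<subseteq> F - S" "connected_set E R" for R
    proof (cases "R = {}")
      case False
      then obtain x0 where x0: "x0 \<in> R" by blast
      have avoid: "nball E' L (f x) \<subseteq> F' - S'" if "x \<in> R" for x
        using that R unfolding S_def F'_def by blast
      define U where "U = component E' (F' - S') (f x0)"
      have U: "U \<subseteq> F' - S'" "connected_set E' U" unfolding U_def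
        by (rule component_subset connected_component)+
      have "{x \<in> R. f x \<in> U} = R"
      proof (rule connected_setD[OF R(2), of _ x0])
        have "f x0 \<in> F' - S'" by (rule subsetD[OF avoid[OF x0] nball_self])
        then show "x0 \<in> {x \<in> R. f x \<in> U}" using x0 unfolding U_def by (simp add: component_refl)
        fix x y assume xy: "x \<in> {x \<in> R. f x \<in> U}" "y \<in> R" "E x y"
        then have "f y \<in> nball E' L (f x)" using lip R F by blast
        moreover have "nball E' L (f x) \<subseteq> U" unfolding U_def
          by (rule component_maximal[OF connected_nball[OF E'] avoid nball_self])
            (use xy in \<open>auto simp: U_def\<close>)
        ultimately show "y \<in> {x \<in> R. f x \<in> U}" using xy by blast
      qed blast
      then have "f ` R \<subseteq> U" by blast
      moreover have "finite U" using U \<open>finite F'\<close> by (meson finite_Diff finite_subset)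
      moreover have "inj_on f R" using f(1) by (rule inj_on_subset) (use R F in blast)
      ultimately have "card R \<le> card U" using card_inj_on_le by blast
      then have "2 ^ (2 * D) * card R \<le> 2 ^ (2 * D) * card U" by simp
      also have "\<dots> \<le> card F'" using S'_sep U by simp
      finally have "2 ^ (2 * D) * card R \<le> D * card F" using cF' by linarith
      moreover have "2 * D * card R \<le> 2 ^ (2 * D) * card R"
        by (rule mult_le_mono1) (metis less_exp less_imp_le)
      moreover have "D * (2 * card R) = 2 * D * card R" by simp
      ultimately have "D * (2 * card R) \<le> D * card F" by linarith
      moreover have "0 < D" unfolding D_def by simp
      ultimately show ?thesis by simp
    qed simp
    moreover have "S \<subseteq> F" unfolding S_def by blast
    ultimately show "\<exists>S \<subseteq> F. card S \<le> C * a + C \<and>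
        (\<forall>R \<subseteq> F - S. connected_set E R \<longrightarrow> 2 * card R \<le> card F)" by meson
  qed
  then show ?thesis unfolding sep_le_def by blast
qed

text \<open>
  A prefix \<open>c # p\<close> is a child of \<open>p\<close>; its branch is attached to the piece at \<open>p\<close> near the point \<open>rp c\<close>.
\<close>

lemma tree_separable:
  fixes E :: "'c list \<times> 'a \<Rightarrow> 'c list \<times> 'a \<Rightarrow> bool"
  assumes symP: "\<And>p. symp (P p)"
    and edge: "\<And>p g p' g'. E (p, g) (p', g') \<Longrightarrow> p = p' \<and> P p g g' \<or>
      (\<exists>c. p' = c # p \<and> g \<in> At p (rp c) \<and> g' \<in> Pt p') \<or>
      (\<exists>c. p = c # p' \<and> g' \<in> At p' (rp c) \<and> g \<in> Pt p)"
    and At: "\<And>p r. finite (At p r) \<and> card (At p r) \<le> D"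
      "\<And>p r g. g \<in> At p r \<Longrightarrow> g = r \<or> P p r g"
    and Pt: "\<And>p. finite (Pt p) \<and> card (Pt p) \<le> D"
    and W: "\<And>p g. (p, g) \<in> V \<Longrightarrow> g \<in> W p" "\<And>l c p g. (l @ c # p, g) \<in> V \<Longrightarrow> rp c \<in> W p"
    and piece: "\<And>p. separable (P p) (W p) (2 * m) a"
  shows "separable E V m (400 * Suc a * Suc D + D)"
  unfolding separable_def
proof (intro allI impI, elim conjE)
  fix F assume F: "finite F" "F \<subseteq> V" "card F \<le> m"
  show "\<exists>S \<subseteq> F. card S \<le> 400 * Suc a * Suc D + D \<and>
        (\<forall>R \<subseteq> F - S. connected_set E R \<longrightarrow> 2 * card R \<le> card F)"
  proof (cases "F = {}")
    case False
    define T where "T p = {x \<in> F. \<exists>l. fst x = l @ p}" for p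
    have finT: "finite (T p)" for p unfolding T_def using F by simp
    have "T [] = F" unfolding T_def by simp
    moreover have "0 < card F" using False F by (simp add: card_gt_0_iff)
    ultimately have root: "card F < 2 * card (T [])" by simp
    have len: "length p < Suc (Max ((length \<circ> fst) ` F))" if "card F < 2 * card (T p)" for p
    proof -
      have "T p \<noteq> {}" using that by auto
      then obtain x where x: "x \<in> T p" by blast
      then have "length p \<le> (length \<circ> fst) x" unfolding T_def by auto
      also have "\<dots> \<le> Max ((length \<circ> fst) ` F)" using x F unfolding T_def by (intro Max_ge) auto
      finally show ?thesis by simp
    qed
    \<comment> \<open>The centroid: more than half of \<open>F\<close> lies in the subtree at
      \<open>p\<close>, at most half in the subtree at any child. It exists because the prefixes
      occurring in \<open>F\<close> have bounded length.\<close>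
    obtain p where p: "card F < 2 * card (T p)"
      and deepest: "\<And>q. card F < 2 * card (T q) \<Longrightarrow> length q \<le> length p"
      using ex_has_greatest_nat[of "\<lambda>p. card F < 2 * card (T p)", OF root] len by blast
    have child: "2 * card (T (c # p)) \<le> card F" for c
      using deepest[of "c # p"] by (auto simp: not_less[symmetric])
    \<comment> \<open>A point of the piece at \<open>p\<close> stays; a point of a branch goes to
      where the branch is attached. Prefixes grow at the front, so this index picks the entry
      \<open>c\<close> directly in front of \<open>p\<close>.\<close>
    define \<rho> where "\<rho> x = (if fst x = p then snd x else rp (fst x ! (length (fst x) - Suc (length p))))" for x
    have \<rho>_piece: "\<rho> (p, g) = g" for g unfolding \<rho>_def by simp
    have \<rho>_branch: "\<rho> (l @ c # p, g) = rp c" for l c g unfolding \<rho>_def by (simp add: nth_append)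
    have T_cases: "(\<exists>g. x = (p, g)) \<or> (\<exists>l c g. x = (l @ c # p, g))" if x: "x \<in> T p" for x
    proof -
      obtain l g where lg: "x = (l @ p, g)" using x unfolding T_def by (cases x) auto
      show ?thesis
      proof (cases l rule: rev_cases)
        case Nil
        then show ?thesis using lg by auto
      next
        case (snoc ys y)
        then show ?thesis using lg by auto
      qed
    qed
    define A where "A = \<rho> ` T p"
    have A: "finite A" "A \<subseteq> W p" "card A \<le> m"
    proof -
      show "finite A" unfolding A_def using finT by simp
      have "\<rho> x \<in> W p" if "x \<in> T p" for x
        using T_cases[OF that] that F(2) W unfolding T_def by (auto simp: \<rho>_piece \<rho>_branch)
      then show "A \<subseteq> W p" unfolding A_def by blast
      have "card A \<le> card (T p)" unfolding A_def using finT by (rule card_image_le)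
      also have "\<dots> \<le> card F" unfolding T_def using F(1) by (intro card_mono) auto
      finally show "card A \<le> m" using F(3) by simp
    qed
    define w where "w r = card {x \<in> T p. \<rho> x = r}" for r
    have w_sum: "sum w A = card (T p)"
      unfolding w_def A_def card_eq_sum by (rule sum.image_gen[OF finT, symmetric])
    \<comment> \<open>\<open>Suc a\<close>, because \<open>weighted_separator\<close> asks for a
      positive bound.\<close>
    have "separable (P p) A (2 * card A) (Suc a)"
      by (rule separable_mono[OF piece[of p]]) (use A in auto)
    from weighted_separator[OF symP A(1) this, of w]
    obtain Z where Z: "Z \<subseteq> A" "card Z \<le> 400 * Suc a"
      and Z_sep: "\<forall>R \<subseteq> A - Z. connected_set (P p) R \<longrightarrow> 2 * sum w R \<le> sum w A" by auto
    have finZ: "finite Z" using Z A finite_subset by blast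
    \<comment> \<open>Deleting \<open>At p r\<close> for \<open>r \<in> Z\<close> detaches all
      branches that project to \<open>Z\<close>, and deleting the port of \<open>p\<close> detaches
      everything outside \<open>T p\<close>. All deleted points lie in the piece at
      \<open>p\<close>, so their number does not depend on how many branches there are.\<close>
    define Q where "Q = (\<Union>r\<in>Z. insert r (At p r)) \<union> Pt p"
    have finQ: "finite Q" unfolding Q_def using finZ At Pt by auto
    define S where "S = F \<inter> {p} \<times> Q"
    have "card S \<le> card ({p} \<times> Q)" unfolding S_def using finQ by (intro card_mono) auto
    also have "\<dots> = card Q" by (simp add: card_cartesian_product_singleton)
    also have "\<dots> \<le> card (\<Union>r\<in>Z. insert r (At p r)) + card (Pt p)" unfolding Q_def by (rule card_Un_le)
    also have "\<dots> \<le> (\<Sum>r\<in>Z. card (insert r (At p r))) + D"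
      using Pt by (intro add_mono card_UN_le finZ) auto
    also have "(\<Sum>r\<in>Z. card (insert r (At p r))) \<le> card Z * Suc D"
    proof -
      have "card (insert r (At p r)) \<le> Suc D" for r
        using card_insert_le_m1[of "Suc D" "At p r" r] At(1)[of p r] by simp
      then show ?thesis using sum_bounded_above[of Z "\<lambda>r. card (insert r (At p r))" "Suc D"] by simp
    qed
    also have "card Z * Suc D \<le> 400 * Suc a * Suc D" using Z(2) by (rule mult_le_mono1)
    finally have cS: "card S \<le> 400 * Suc a * Suc D + D" by simp
    have "2 * card R \<le> card F" if R: "R \<subseteq> F - S" "connected_set E R" for R
    proof (cases "R \<inter> T p = {}")
      case True
      then have "card R \<le> card (F - T p)" using R F by (intro card_mono) auto
      also have "\<dots> = card F - card (T p)"
        unfolding T_def using F by (intro card_Diff_subset) auto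
      finally show ?thesis using p by linarith
    next
      case False
      have in_S: "(p, g) \<in> S" if "(p, g) \<in> R" "g \<in> Q" for g
        using that R unfolding S_def by blast
      \<comment> \<open>The only exit from \<open>T p\<close> leads through the deleted
        port.\<close>
      have "R \<inter> T p = R"
      proof -
        obtain x0 where x0: "x0 \<in> R \<inter> T p" using False by blast
        show ?thesis
        proof (rule connected_setD[OF R(2) _ x0])
          fix x y assume x: "x \<in> R \<inter> T p" and y: "y \<in> R" and xy: "E x y"
          obtain l g p' g' where lg: "x = (l @ p, g)" "y = (p', g')"
            using x unfolding T_def by (cases x; cases y) auto
          have "\<exists>l'. p' = l' @ p"
            using edge[OF xy[unfolded lg]]
          proof (elim disjE exE conjE)
            fix c assume c: "l @ p = c # p'" "g \<in> Pt (l @ p)"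
            show ?thesis
            proof (cases l)
              case Nil
              then have "(p, g) \<in> S" using in_S x lg c unfolding Q_def by auto
              then show ?thesis using x lg Nil R by auto
            qed (use c in auto)
          qed auto
          then show "y \<in> R \<inter> T p" using y R lg unfolding T_def by auto
        qed blast
      qed
      then have RT: "R \<subseteq> T p" by blast
      \<comment> \<open>If \<open>R\<close> meets a branch attached at a point of \<open>Z\<close>,
        it is trapped there and the choice of \<open>p\<close> bounds it. Otherwise its projection
        avoids \<open>Z\<close> and the weighted separator bounds it.\<close>
      show ?thesis
      proof (cases "\<exists>c. rp c \<in> Z \<and> R \<inter> T (c # p) \<noteq> {}")
        case True
        then obtain c x0 where c: "rp c \<in> Z" and x0: "x0 \<in> R \<inter> T (c # p)" by blast
        have "R \<inter> T (c # p) = R"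
        proof (rule connected_setD[OF R(2) _ x0])
          fix x y assume x: "x \<in> R \<inter> T (c # p)" and y: "y \<in> R" and xy: "E x y"
          obtain l g p' g' where lg: "x = (l @ c # p, g)" "y = (p', g')"
            using x unfolding T_def by (cases x; cases y) auto
          have "\<exists>l'. p' = l' @ c # p"
            using edge[OF xy[unfolded lg]]
          proof (elim disjE exE conjE)
            fix c' assume c': "l @ c # p = c' # p'" "g' \<in> At p' (rp c')"
            show ?thesis
            proof (cases l)
              case Nil
              then have "(p, g') \<in> S" using in_S y lg c c' unfolding Q_def by auto
              then show ?thesis using y lg Nil c' R by auto
            qed (use c' in auto)
          qed auto
          then show "y \<in> R \<inter> T (c # p)" using y R lg unfolding T_def by auto
        qed blast
        then have "card R \<le> card (T (c # p))" using finT by (intro card_mono) auto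
        then show ?thesis using child[of c] by linarith
      next
        case False
        have not_Z: "\<rho> x \<notin> Z" if x: "x \<in> R" for x
        proof
          assume Z': "\<rho> x \<in> Z"
          have "x \<in> T p" using RT x by blast
          from T_cases[OF this] show False
          proof (elim disjE exE)
            fix g assume "x = (p, g)"
            then show False using in_S[of g] x Z' R unfolding Q_def by (auto simp: \<rho>_piece)
          next
            fix l c g assume lc: "x = (l @ c # p, g)"
            then have "x \<in> T (c # p)" using x R unfolding T_def by auto
            then show False using False x Z' lc by (auto simp: \<rho>_branch)
          qed
        qed
        \<comment> \<open>The projection is constant on each branch. An edge between a branch and
          the piece projects to \<open>rp c\<close> and a point of \<open>At p (rp c)\<close>, which
          are equal or adjacent.\<close>
        have \<rho>_edge: "\<rho> x = \<rho> y \<or> P p (\<rho> x) (\<rho> y)" if xy: "E x y" "x \<in> T p" "y \<in> T p" for x y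
        proof -
          have sym: "P p r r'" if "P p r' r" for r r' using symP that by (simp add: symp_def)
          have step: "\<rho> (p1, g1) = \<rho> (c # p1, g2) \<or> P p (\<rho> (c # p1, g2)) (\<rho> (p1, g1))"
            if "(p1, g1) \<in> T p" "g1 \<in> At p1 (rp c)" for p1 g1 c g2
            using T_cases[OF that(1)]
          proof (elim disjE exE)
            fix g assume "(p1, g1) = (p, g)"
            then show ?thesis using At(2)[of g1 p "rp c"] that(2) \<rho>_piece \<rho>_branch[of "[]"] by auto
          next
            fix l c' g assume "(p1, g1) = (l @ c' # p, g)"
            then show ?thesis using \<rho>_branch[of l c'] \<rho>_branch[of "c # l" c'] by auto
          qed
          obtain p1 g1 p2 g2 where xy': "x = (p1, g1)" "y = (p2, g2)" by (cases x; cases y)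
          have T': "(p1, g1) \<in> T p" "(p2, g2) \<in> T p" using xy xy' by auto
          from edge[OF xy(1)[unfolded xy']] show ?thesis unfolding xy'
          proof (elim disjE exE conjE)
            assume e: "p1 = p2" "P p1 g1 g2"
            from T_cases[OF T'(1)] show "\<rho> (p1, g1) = \<rho> (p2, g2) \<or> P p (\<rho> (p1, g1)) (\<rho> (p2, g2))"
              using e by (auto simp: \<rho>_piece \<rho>_branch)
          next
            fix c assume "p2 = c # p1" "g1 \<in> At p1 (rp c)"
            then show "\<rho> (p1, g1) = \<rho> (p2, g2) \<or> P p (\<rho> (p1, g1)) (\<rho> (p2, g2))"
              using step[OF T'(1), of c g2] sym by metis
          next
            fix c assume "p1 = c # p2" "g2 \<in> At p2 (rp c)"
            then show "\<rho> (p1, g1) = \<rho> (p2, g2) \<or> P p (\<rho> (p1, g1)) (\<rho> (p2, g2))"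
              using step[OF T'(2), of c g1] by metis
          qed
        qed
        have "connected_set (P p) (\<rho> ` R)"
          unfolding connected_set_def
        proof (intro allI impI)
          fix Y assume Y: "Y \<subseteq> \<rho> ` R" "Y \<noteq> {}" "\<forall>x\<in>Y. \<forall>y\<in>\<rho> ` R. P p x y \<longrightarrow> y \<in> Y"
          then obtain x0 where x0: "x0 \<in> {x \<in> R. \<rho> x \<in> Y}" by blast
          have "{x \<in> R. \<rho> x \<in> Y} = R"
          proof (rule connected_setD[OF R(2) _ x0])
            fix x y assume xy: "x \<in> {x \<in> R. \<rho> x \<in> Y}" "y \<in> R" "E x y"
            then have "\<rho> x = \<rho> y \<or> P p (\<rho> x) (\<rho> y)" using \<rho>_edge[OF xy(3)] RT by blast
            then show "y \<in> {x \<in> R. \<rho> x \<in> Y}"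
              using xy(1,2) Y(3)[rule_format, of "\<rho> x" "\<rho> y"] by auto
          qed blast
          then show "Y = \<rho> ` R" using Y(1) by blast
        qed
        moreover have "\<rho> ` R \<subseteq> A - Z" using not_Z RT unfolding A_def by blast
        ultimately have "2 * sum w (\<rho> ` R) \<le> card (T p)" using Z_sep w_sum by simp
        moreover have "card R \<le> sum w (\<rho> ` R)"
        proof -
          have finR: "finite R" using RT finT finite_subset by blast
          have "card R = (\<Sum>r\<in>\<rho> ` R. card {x \<in> R. \<rho> x = r})"
            unfolding card_eq_sum by (rule sum.image_gen[OF finR])
          also have "\<dots> \<le> sum w (\<rho> ` R)"
            unfolding w_def by (intro sum_mono card_mono) (use RT finT in auto)
          finally show ?thesis .
        qed
        moreover have "card (T p) \<le> card F" unfolding T_def using F by (intro card_mono) auto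
        ultimately show ?thesis by linarith
      qed
    qed
    moreover have "S \<subseteq> F" unfolding S_def by blast
    ultimately show ?thesis using cS by (intro exI[of _ S]) blast
  qed (simp)
qed

section \<open>Separation profiles of Cayley graphs\<close>

text \<open>Cayley graphs may be infinite, which the locale \<open>graph\<close> excludes. Finite
  induced subgraphs of such graphs do satisfy that locale.\<close>

definition is_pair_graph :: "('a, 'a \<times> 'a) pre_digraph \<Rightarrow> bool" where
  "is_pair_graph X \<longleftrightarrow> arcs X \<subseteq> verts X \<times> verts X \<and> tail X = fst \<and> head X = snd \<and>
     sym (arcs X) \<and> irrefl (arcs X)"

abbreviation adjacent :: "('a, 'b) pre_digraph \<Rightarrow> 'a \<Rightarrow> 'a \<Rightarrow> bool" where
  "adjacent X u v \<equiv> u \<rightarrow>\<^bsub>X\<^esub> v"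

lemma is_pair_graph_arcs_ends: "tail X = fst \<Longrightarrow> head X = snd \<Longrightarrow> arcs_ends X = arcs X"
  unfolding arcs_ends_conv by simp

lemma is_pair_graph_induce: "is_pair_graph X \<Longrightarrow> F \<subseteq> verts X \<Longrightarrow> is_pair_graph (X \<restriction> F)"
  unfolding is_pair_graph_def sym_def irrefl_def by auto

lemma is_pair_graph_wf: "is_pair_graph X \<Longrightarrow> wf_digraph X"
  unfolding is_pair_graph_def by unfold_locales auto

lemma is_pair_graph_sym: "is_pair_graph X \<Longrightarrow> sym_digraph X"
  by (rule wf_digraph.sym_digraphI[OF is_pair_graph_wf])
    (auto simp: symmetric_def is_pair_graph_arcs_ends is_pair_graph_def)

lemma is_pair_graph_graph:
  assumes "is_pair_graph X" "finite (verts X)"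
  shows "graph X"
proof -
  interpret sym_digraph X using assms is_pair_graph_sym by blast
  have "finite (arcs X)"
    using assms unfolding is_pair_graph_def by (meson finite_SigmaI finite_subset)
  moreover have "tail X = fst" "head X = snd" "irrefl (arcs X)" using assms unfolding is_pair_graph_def by auto
  ultimately show ?thesis
    using assms(2) by unfold_locales (auto simp: arc_to_ends_def irrefl_def prod_eq_iff)
qed

lemma strongly_connected_connected_set:
  assumes "wf_digraph K" "strongly_connected K" and sub: "arcs_ends K \<subseteq> {(u, v). E u v}"
  shows "connected_set E (verts K)"
  unfolding connected_set_def
proof (intro allI impI)
  interpret wf_digraph K by fact
  fix Q assume Q: "Q \<subseteq> verts K" "Q \<noteq> {}" and cl: "\<forall>x\<in>Q. \<forall>y\<in>verts K. E x y \<longrightarrow> y \<in> Q"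
  then obtain q where q: "q \<in> Q" by blast
  have "v \<in> Q" if "q \<rightarrow>\<^sup>*\<^bsub>K\<^esub> v" for v
    using that
  proof (induction rule: reachable_induct)
    case (step x y)
    then show ?case using cl sub adj_in_verts(2) by blast
  qed (rule q)
  moreover have "q \<rightarrow>\<^sup>*\<^bsub>K\<^esub> v" if "v \<in> verts K" for v
    using assms(2) q Q that unfolding strongly_connected_def by blast
  ultimately show "Q = verts K" using Q by blast
qed

text \<open>\<open>E\<close> may have more edges than \<open>\<Gamma>\<close>. A strong component
  left in \<open>\<Gamma>\<close> is a connected set for \<open>E\<close>, so a separator found in
  the ambient graph also serves its subgraphs.\<close>

lemma cutsize_le:
  assumes fin: "finite (verts \<Gamma>)" and S: "S \<subseteq> verts \<Gamma>" and wf: "wf_digraph \<Gamma>"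
    and sub: "arcs_ends \<Gamma> \<subseteq> {(u, v). E u v}"
    and small: "\<And>R. R \<subseteq> verts \<Gamma> - S \<Longrightarrow> connected_set E R \<Longrightarrow> 2 * card R \<le> card (verts \<Gamma>)"
  shows "cutsize \<Gamma> \<le> card S"
  unfolding cutsize_def
proof (rule Min_le)
  show "card S \<in> card ` {S. S \<subseteq> verts \<Gamma> \<and>
     (\<forall>K \<in> pre_digraph.sccs (\<Gamma> \<restriction> (verts \<Gamma> - S)). 2 * card (verts K) \<le> card (verts \<Gamma>))}"
  proof (intro imageI CollectI conjI ballI S)
    fix K assume "K \<in> pre_digraph.sccs (\<Gamma> \<restriction> (verts \<Gamma> - S))"
    then have ind: "induced_subgraph K (\<Gamma> \<restriction> (verts \<Gamma> - S))" and K: "strongly_connected K"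
      unfolding pre_digraph.sccs_def by auto
    then have sg: "subgraph K (\<Gamma> \<restriction> (verts \<Gamma> - S))" unfolding induced_subgraph_def by blast
    then have "wf_digraph K" "verts K \<subseteq> verts \<Gamma> - S" unfolding subgraph_def by auto
    moreover have "arcs_ends K \<subseteq> arcs_ends \<Gamma>"
      using sg unfolding subgraph_def arcs_ends_conv compatible_def by auto
    ultimately show "2 * card (verts K) \<le> card (verts \<Gamma>)"
      using small strongly_connected_connected_set[OF _ K] sub by blast
  qed
qed (use fin in simp)

lemma cutsize_le_card:
  assumes "finite (verts \<Gamma>)" "wf_digraph \<Gamma>"
  shows "cutsize \<Gamma> \<le> card (verts \<Gamma>)"
  by (rule cutsize_le[OF assms(1) order_refl assms(2), of "\<lambda>u v. (u, v) \<in> arcs_ends \<Gamma>"]) auto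

text \<open>By symmetry the points reachable from a given one form a strong component, and a
  connected set that avoids \<open>S\<close> lies inside one of these.\<close>

lemma cutsize_witness:
  assumes X: "is_pair_graph X" and fin: "finite (verts X)"
  obtains S where "S \<subseteq> verts X" "card S = cutsize X"
    "\<And>R. R \<subseteq> verts X - S \<Longrightarrow> connected_set (adjacent X) R \<Longrightarrow> 2 * card R \<le> card (verts X)"
proof -
  let ?\<S> = "{S. S \<subseteq> verts X \<and>
     (\<forall>K \<in> pre_digraph.sccs (X \<restriction> (verts X - S)). 2 * card (verts K) \<le> card (verts X))}"
  have "verts X \<in> ?\<S>"
  proof (intro CollectI conjI ballI order_refl)
    fix K assume "K \<in> pre_digraph.sccs (X \<restriction> (verts X - verts X))"
    then have "verts K \<subseteq> {}" unfolding pre_digraph.sccs_def induced_subgraph_def subgraph_def by auto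
    then show "2 * card (verts K) \<le> card (verts X)" by simp
  qed
  then have "cutsize X \<in> card ` ?\<S>"
    unfolding cutsize_def using fin by (intro Min_in) auto
  then obtain S where S: "S \<subseteq> verts X" "card S = cutsize X"
    "\<And>K. K \<in> pre_digraph.sccs (X \<restriction> (verts X - S)) \<Longrightarrow> 2 * card (verts K) \<le> card (verts X)"
    by auto
  let ?Y = "X \<restriction> (verts X - S)"
  have Y: "is_pair_graph ?Y" using X by (rule is_pair_graph_induce) blast
  interpret Y: sym_digraph ?Y using is_pair_graph_sym[OF Y] .
  have "2 * card R \<le> card (verts X)" if R: "R \<subseteq> verts X - S" "connected_set (adjacent X) R" for R
  proof (cases "R = {}")
    case False
    then obtain x where x: "x \<in> R" by blast
    let ?K = "?Y \<restriction> {v. x \<rightarrow>\<^sup>*\<^bsub>?Y\<^esub> v}"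
    have "?K \<in> Y.sccs" by (rule Y.induce_reachable_is_in_sccs) (use x R in auto)
    then have K: "2 * card (verts ?K) \<le> card (verts X)" by (rule S(3))
    have "{v \<in> R. x \<rightarrow>\<^sup>*\<^bsub>?Y\<^esub> v} = R"
    proof (rule connected_setD[OF R(2), of _ x])
      show "x \<in> {v \<in> R. x \<rightarrow>\<^sup>*\<^bsub>?Y\<^esub> v}" using x R by auto
      fix u v assume uv: "u \<in> {v \<in> R. x \<rightarrow>\<^sup>*\<^bsub>?Y\<^esub> v}" "v \<in> R" "u \<rightarrow>\<^bsub>X\<^esub> v"
      then have "u \<rightarrow>\<^bsub>?Y\<^esub> v" using R unfolding arcs_ends_conv by auto
      then show "v \<in> {v \<in> R. x \<rightarrow>\<^sup>*\<^bsub>?Y\<^esub> v}" using uv Y.reachable_adj_trans by blast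
    qed blast
    then have "R \<subseteq> verts ?K" by auto
    moreover have "finite (verts ?K)"
      using Y.reachable_in_verts(2) fin by (auto intro: finite_subset[of _ "verts X"])
    ultimately have "card R \<le> card (verts ?K)" by (rule card_mono[rotated])
    then show ?thesis using K by linarith
  qed simp
  then show thesis using that S by blast
qed

text \<open>Infinitely many subgraphs may compete in \<open>sep\<close>, but \<open>cutsize\<close>
  never exceeds the number of vertices. This gives \<open>Max\<close> its meaning.\<close>

lemma sep_set_finite:
  "finite {cutsize \<Gamma> | \<Gamma>. subgraph \<Gamma> X \<and> graph \<Gamma> \<and> card (verts \<Gamma>) \<le> r}"
proof (rule finite_subset)
  show "{cutsize \<Gamma> | \<Gamma>. subgraph \<Gamma> X \<and> graph \<Gamma> \<and> card (verts \<Gamma>) \<le> r} \<subseteq> {..r}"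
  proof clarify
    fix \<Gamma> assume G: "graph \<Gamma>" "card (verts \<Gamma>) \<le> r"
    interpret graph \<Gamma> by fact
    show "cutsize \<Gamma> \<le> r" using cutsize_le_card[OF finite_verts wf_digraph_axioms] G(2) by linarith
  qed
qed simp

lemma separable_sep:
  assumes X: "is_pair_graph X"
  shows "separable (adjacent X) (verts X) r (sep X r)"
  unfolding separable_def
proof (intro allI impI, elim conjE)
  fix F assume F: "finite F" "F \<subseteq> verts X" "card F \<le> r"
  have XF: "is_pair_graph (X \<restriction> F)" using X F by (intro is_pair_graph_induce)
  obtain S where S: "S \<subseteq> F" "card S = cutsize (X \<restriction> F)"
    "\<And>R. R \<subseteq> F - S \<Longrightarrow> connected_set (adjacent (X \<restriction> F)) R \<Longrightarrow> 2 * card R \<le> card F"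
    using cutsize_witness[OF XF] F by auto
  have "cutsize (X \<restriction> F) \<le> sep X r" unfolding sep_def
  proof (rule Max_ge[OF sep_set_finite], intro CollectI exI conjI refl)
    show "graph (X \<restriction> F)" using is_pair_graph_graph[OF XF] F by simp
    show "subgraph (X \<restriction> F) X" unfolding subgraph_def compatible_def
      using F is_pair_graph_wf[OF X] is_pair_graph_wf[OF XF] by auto
    show "card (verts (X \<restriction> F)) \<le> r" using F(3) by simp
  qed simp
  moreover have "2 * card R \<le> card F" if R: "R \<subseteq> F - S" "connected_set (adjacent X) R" for R
  proof (rule S(3)[OF R(1)])
    show "connected_set (adjacent (X \<restriction> F)) R" unfolding connected_set_def
    proof (intro allI impI)
      fix Q assume Q: "Q \<subseteq> R" "Q \<noteq> {}" "\<forall>x\<in>Q. \<forall>y\<in>R. x \<rightarrow>\<^bsub>X \<restriction> F\<^esub> y \<longrightarrow> y \<in> Q"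
      then obtain q where q: "q \<in> Q" by blast
      show "Q = R"
      proof (rule connected_setD[OF R(2) Q(1) q])
        fix x y assume xy: "x \<in> Q" "y \<in> R" "x \<rightarrow>\<^bsub>X\<^esub> y"
        then have "x \<rightarrow>\<^bsub>X \<restriction> F\<^esub> y" using R(1) Q(1) unfolding arcs_ends_conv by auto
        then show "y \<in> Q" using Q(3) xy by blast
      qed
    qed
  qed
  ultimately show "\<exists>S \<subseteq> F. card S \<le> sep X r \<and>
      (\<forall>R \<subseteq> F - S. connected_set (adjacent X) R \<longrightarrow> 2 * card R \<le> card F)"
    using S(1,2) by (intro exI[of _ S]) auto
qed

lemma sep_le_separable:
  assumes X: "wf_digraph X" and sep: "separable (adjacent X) (verts X) r k"
  shows "sep X r \<le> k"
  unfolding sep_def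
proof (rule Max.boundedI[OF sep_set_finite])
  \<comment> \<open>The empty subgraph, available for every \<open>r\<close>, shows that the maximum
    is over a nonempty set.\<close>
  let ?N = "\<lparr>verts = {}, arcs = {}, tail = tail X, head = head X\<rparr>"
  have "graph ?N" by unfold_locales (auto simp: symmetric_def sym_def arcs_ends_conv)
  moreover have "wf_digraph ?N" by unfold_locales auto
  then have "subgraph ?N X" using X unfolding subgraph_def compatible_def by auto
  ultimately have "cutsize ?N \<in> {cutsize \<Gamma> | \<Gamma>. subgraph \<Gamma> X \<and> graph \<Gamma> \<and> card (verts \<Gamma>) \<le> r}"
    by (intro CollectI exI[of _ ?N]) auto
  then show "{cutsize \<Gamma> | \<Gamma>. subgraph \<Gamma> X \<and> graph \<Gamma> \<and> card (verts \<Gamma>) \<le> r} \<noteq> {}" by blast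
  fix c assume "c \<in> {cutsize \<Gamma> | \<Gamma>. subgraph \<Gamma> X \<and> graph \<Gamma> \<and> card (verts \<Gamma>) \<le> r}"
  then obtain \<Gamma> where \<Gamma>: "c = cutsize \<Gamma>" "subgraph \<Gamma> X" "graph \<Gamma>" "card (verts \<Gamma>) \<le> r" by blast
  interpret graph \<Gamma> by fact
  have sg: "verts \<Gamma> \<subseteq> verts X" "arcs_ends \<Gamma> \<subseteq> {(u, v). adjacent X u v}"
    using \<Gamma>(2) unfolding subgraph_def arcs_ends_conv compatible_def by auto
  obtain S where S: "S \<subseteq> verts \<Gamma>" "card S \<le> k"
    "\<And>R. R \<subseteq> verts \<Gamma> - S \<Longrightarrow> connected_set (adjacent X) R \<Longrightarrow> 2 * card R \<le> card (verts \<Gamma>)"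
    by (rule separableE[OF sep finite_verts sg(1) \<Gamma>(4)]) (rule that)
  show "c \<le> k" using cutsize_le[OF finite_verts S(1) wf_digraph_axioms sg(2) S(3)] S(2) \<Gamma>(1) by simp
qed

section \<open>Geometry of Cayley graphs\<close>

lemma is_pair_graph_cayley: "is_pair_graph (cayley_graph G S)"
  unfolding is_pair_graph_def cayley_graph_def sym_def irrefl_def by auto

lemma adjacent_cayley: "adjacent (cayley_graph G S) g h \<longleftrightarrow>
    g \<in> carrier G \<and> h \<in> carrier G \<and> g \<noteq> h \<and> (\<exists>s \<in> S. h = g \<otimes>\<^bsub>G\<^esub> s \<or> g = h \<otimes>\<^bsub>G\<^esub> s)"
  by (subst is_pair_graph_arcs_ends) (auto simp: cayley_graph_def)

lemma symp_adjacent_cayley: "symp (adjacent (cayley_graph G S))"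
  unfolding symp_def adjacent_cayley by blast

text \<open>Left multiplication preserves the graph, so right multiplication by \<open>t\<close>
  moves every \<open>x\<close> by at most the word length of \<open>t\<close>. The uniformity in
  \<open>x\<close> is what makes maps between Cayley graphs Lipschitz.\<close>

lemma cayley_translate_nball:
  assumes K: "group K" and S: "S \<subseteq> carrier K" and t: "t \<in> generate K S"
  shows "\<exists>n. \<forall>x \<in> carrier K. x \<otimes>\<^bsub>K\<^esub> t \<in> nball (adjacent (cayley_graph K S)) n x"
  using t
proof (induction rule: generate.induct)
  interpret group K by fact
  {
    case one
    then show ?case by (intro exI[of _ 0]) simp
  next
    case (incl s)
    have "x \<otimes>\<^bsub>K\<^esub> s \<in> nball (adjacent (cayley_graph K S)) 1 x" if "x \<in> carrier K" for x
      using that incl S by (cases "x = x \<otimes>\<^bsub>K\<^esub> s") (auto simp: adjacent_cayley)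
    then show ?case by blast
  next
    case (inv s)
    have "x \<otimes>\<^bsub>K\<^esub> inv\<^bsub>K\<^esub> s \<in> nball (adjacent (cayley_graph K S)) 1 x" if "x \<in> carrier K" for x
    proof -
      have s: "s \<in> carrier K" using inv S by blast
      then have "x = (x \<otimes>\<^bsub>K\<^esub> inv\<^bsub>K\<^esub> s) \<otimes>\<^bsub>K\<^esub> s" using that by (simp add: m_assoc)
      then show ?thesis using that inv s
        by (cases "x = x \<otimes>\<^bsub>K\<^esub> inv\<^bsub>K\<^esub> s") (auto simp: adjacent_cayley)
    qed
    then show ?case by blast
  next
    case (eng h1 h2)
    then obtain n1 n2 where n: "\<forall>x \<in> carrier K. x \<otimes>\<^bsub>K\<^esub> h1 \<in> nball (adjacent (cayley_graph K S)) n1 x"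
      "\<forall>x \<in> carrier K. x \<otimes>\<^bsub>K\<^esub> h2 \<in> nball (adjacent (cayley_graph K S)) n2 x" by blast
    have h: "h1 \<in> carrier K" "h2 \<in> carrier K" using generate_in_carrier[OF S] eng.hyps by auto
    have "x \<otimes>\<^bsub>K\<^esub> (h1 \<otimes>\<^bsub>K\<^esub> h2) \<in> nball (adjacent (cayley_graph K S)) (n1 + n2) x" if "x \<in> carrier K" for x
      using nball_trans[OF n(1)[rule_format, OF that] n(2)[rule_format, OF m_closed[OF that h(1)]]] that h
      by (simp add: m_assoc)
    then show ?case by blast
  }
qed

lemma cayley_degree:
  assumes "group K" "finite S" "S \<subseteq> carrier K"
  shows "finite {y. adjacent (cayley_graph K S) x y} \<and>
    card {y. adjacent (cayley_graph K S) x y} \<le> 2 * card S"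
proof -
  interpret group K by fact
  let ?N = "(\<lambda>s. x \<otimes>\<^bsub>K\<^esub> s) ` S \<union> (\<lambda>s. x \<otimes>\<^bsub>K\<^esub> inv\<^bsub>K\<^esub> s) ` S"
  have sub: "{y. adjacent (cayley_graph K S) x y} \<subseteq> ?N"
  proof
    fix y assume "y \<in> {y. adjacent (cayley_graph K S) x y}"
    then obtain s where s: "x \<in> carrier K" "y \<in> carrier K" "s \<in> S" "y = x \<otimes>\<^bsub>K\<^esub> s \<or> x = y \<otimes>\<^bsub>K\<^esub> s"
      unfolding adjacent_cayley by auto
    then have "x = y \<otimes>\<^bsub>K\<^esub> s \<Longrightarrow> y = x \<otimes>\<^bsub>K\<^esub> inv\<^bsub>K\<^esub> s" using assms(3) by (auto simp: m_assoc)
    then show "y \<in> ?N" using s by blast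
  qed
  have "card ?N \<le> card ((\<lambda>s. x \<otimes>\<^bsub>K\<^esub> s) ` S) + card ((\<lambda>s. x \<otimes>\<^bsub>K\<^esub> inv\<^bsub>K\<^esub> s) ` S)"
    by (rule card_Un_le)
  also have "\<dots> \<le> 2 * card S" unfolding mult_2 by (intro add_mono card_image_le assms)
  finally have "card ?N \<le> 2 * card S" .
  moreover have "finite ?N" using assms(2) by simp
  ultimately show ?thesis using sub by (meson card_mono finite_subset le_trans)
qed

text \<open>Each generator may come with its own radius; the sum over the finite set
  \<open>S\<close> is a common one. An edge read against its generator is handled by the symmetry of
  balls.\<close>

lemma sep_le_cayley:
  assumes K: "group K" and S: "finite S" "S \<subseteq> carrier K"
    and E': "symp E'" "\<And>x y. E' x y \<Longrightarrow> y \<in> V'"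
    and deg: "\<And>x. finite {y. E' x y} \<and> card {y. E' x y} \<le> d"
    and f: "inj_on f (carrier K)" "f ` carrier K \<subseteq> V'"
    and lip: "\<And>s. s \<in> S \<Longrightarrow> \<exists>n. \<forall>x \<in> carrier K. f (x \<otimes>\<^bsub>K\<^esub> s) \<in> nball E' n (f x)"
  shows "sep_le (adjacent (cayley_graph K S)) (carrier K) E' V'"
proof -
  obtain n where n: "\<And>s x. s \<in> S \<Longrightarrow> x \<in> carrier K \<Longrightarrow> f (x \<otimes>\<^bsub>K\<^esub> s) \<in> nball E' (n s) (f x)"
    using lip by metis
  define L where "L = (\<Sum>s\<in>S. n s)"
  have L: "f (x \<otimes>\<^bsub>K\<^esub> s) \<in> nball E' L (f x)" if "s \<in> S" "x \<in> carrier K" for s x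
    using nball_mono[of "n s" L E' "f x"] n[OF that] member_le_sum[OF that(1), of n] S(1)
    unfolding L_def by auto
  show ?thesis
  proof (rule sep_le_lipschitz[OF E' deg f])
    fix x y assume "x \<in> carrier K" "y \<in> carrier K" "adjacent (cayley_graph K S) x y"
    then show "f y \<in> nball E' L (f x)"
      unfolding adjacent_cayley using L nball_sym[OF E'(1)] by auto
  qed
qed

section \<open>Normal forms\<close>

text \<open>Representatives of the left cosets of \<open>I\<close>. The value one on
  \<open>I\<close> makes a trivial syllable recognisable in \<open>reduced\<close> and
  \<open>cross\<close>; elsewhere the predicate under \<open>SOME\<close>, and hence the choice,
  depends only on the coset of \<open>g\<close>.\<close>

definition coset_rep :: "('a, 'm) monoid_scheme \<Rightarrow> 'a set \<Rightarrow> 'a \<Rightarrow> 'a" where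
  "coset_rep K I g =
    (if g \<in> I then \<one>\<^bsub>K\<^esub> else SOME r. r \<in> carrier K \<and> inv\<^bsub>K\<^esub> r \<otimes>\<^bsub>K\<^esub> g \<in> I)"

definition coset_part :: "('a, 'm) monoid_scheme \<Rightarrow> 'a set \<Rightarrow> 'a \<Rightarrow> 'a" where
  "coset_part K I g = inv\<^bsub>K\<^esub> coset_rep K I g \<otimes>\<^bsub>K\<^esub> g"

context group
begin

lemma coset_rep:
  assumes "subgroup I G" "g \<in> carrier G"
  shows "coset_rep G I g \<in> carrier G" "coset_part G I g \<in> I"
    "coset_rep G I g \<otimes> coset_part G I g = g"
proof -
  have "\<exists>r. r \<in> carrier G \<and> inv r \<otimes> g \<in> I"
    using assms subgroup.one_closed by (intro exI[of _ g]) auto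
  then have "coset_rep G I g \<in> carrier G \<and> inv coset_rep G I g \<otimes> g \<in> I"
    unfolding coset_rep_def using assms someI_ex[of "\<lambda>r. r \<in> carrier G \<and> inv r \<otimes> g \<in> I"] by auto
  then show r: "coset_rep G I g \<in> carrier G" and "coset_part G I g \<in> I"
    unfolding coset_part_def by auto
  show "coset_rep G I g \<otimes> coset_part G I g = g"
    unfolding coset_part_def using r assms(2) m_assoc[OF r inv_closed[OF r] assms(2)]
    by (simp add: r_inv[OF r])
qed

lemma coset_rep_mult:
  assumes I: "subgroup I G" and g: "g \<in> carrier G" and h: "h \<in> I"
  shows "coset_rep G I (g \<otimes> h) = coset_rep G I g"
proof -
  have hc: "h \<in> carrier G" by (rule subgroup.mem_carrier[OF I h])
  have iff: "x \<otimes> h \<in> I \<longleftrightarrow> x \<in> I" if "x \<in> carrier G" for x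
  proof
    assume "x \<otimes> h \<in> I"
    then have "x \<otimes> h \<otimes> inv h \<in> I" by (rule subgroup.m_closed[OF I _ subgroup.m_inv_closed[OF I h]])
    then show "x \<in> I" using that hc by (simp add: m_assoc)
  qed (rule subgroup.m_closed[OF I _ h])
  have "r \<in> carrier G \<and> inv r \<otimes> (g \<otimes> h) \<in> I \<longleftrightarrow> r \<in> carrier G \<and> inv r \<otimes> g \<in> I" for r
    using iff[of "inv r \<otimes> g"] g hc by (auto simp: m_assoc)
  then show ?thesis unfolding coset_rep_def using iff[OF g] by simp
qed

lemma coset_part_mult:
  assumes "subgroup I G" "g \<in> carrier G" "h \<in> I"
  shows "coset_part G I (g \<otimes> h) = coset_part G I g \<otimes> h"
proof -
  have "h \<in> carrier G" by (rule subgroup.mem_carrier[OF assms(1,3)])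
  then show ?thesis unfolding coset_part_def coset_rep_mult[OF assms]
    using assms(2) coset_rep(1)[OF assms(1,2)] by (simp add: m_assoc)
qed

lemma coset_rep_idem:
  assumes "subgroup I G" "g \<in> carrier G"
  shows "coset_rep G I (coset_rep G I g) = coset_rep G I g"
proof -
  have c: "coset_part G I g \<in> carrier G"
    by (rule subgroup.mem_carrier[OF assms(1) coset_rep(2)[OF assms]])
  have "coset_rep G I g = g \<otimes> inv coset_part G I g"
    using inv_solve_right[OF coset_rep(1)[OF assms] assms(2) c] coset_rep(3)[OF assms] by simp
  then show ?thesis
    using coset_rep_mult[OF assms subgroup.m_inv_closed[OF assms(1) coset_rep(2)[OF assms]]] by simp
qed

lemma coset_rep_subgroup:
  assumes "h \<in> I" shows "coset_rep G I h = \<one>"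
  using assms unfolding coset_rep_def by simp

lemma coset_rep_one_iff:
  assumes "subgroup I G" "g \<in> carrier G"
  shows "coset_rep G I g = \<one> \<longleftrightarrow> g \<in> I"
proof
  assume "coset_rep G I g = \<one>"
  then show "g \<in> I" using coset_rep(2,3)[OF assms] subgroup.mem_carrier[OF assms(1) coset_rep(2)[OF assms]]
    by simp
qed (rule coset_rep_subgroup)

lemma coset_rep_canonical:
  assumes I: "subgroup I G" and r: "r \<in> carrier G" "coset_rep G I r = r" and h: "h \<in> I"
  shows "coset_rep G I (r \<otimes> h) = r" "coset_part G I (r \<otimes> h) = h"
proof -
  show 1: "coset_rep G I (r \<otimes> h) = r" using coset_rep_mult[OF I r(1) h] r by simp
  have "h \<in> carrier G" by (rule subgroup.mem_carrier[OF I h])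
  then show "coset_part G I (r \<otimes> h) = h" unfolding coset_part_def 1
    using r m_assoc[of "inv r" r h] by (simp add: l_inv)
qed

lemma coset_part_subgroup:
  assumes "subgroup I G" "h \<in> I" shows "coset_part G I h = h"
  unfolding coset_part_def using coset_rep_subgroup[OF assms(2)] subgroup.mem_carrier[OF assms] by simp

end

section \<open>Reduced prefixes and the crossing of an edge\<close>

locale based_graph_of_groups = graph_of_groups \<G>
  for \<G> :: "('v, 'e, 'a, 'b) pre_graph_of_groups" +
  fixes v\<^sub>0 :: 'v
  assumes base_point: "v\<^sub>0 \<in> verts (base_graph \<G>)"
begin

definition origin :: "'e \<Rightarrow> bool \<Rightarrow> 'v" where
  "origin e b = (if b then tail (base_graph \<G>) e else head (base_graph \<G>) e)"

definition incl_map :: "'e \<Rightarrow> bool \<Rightarrow> 'b \<Rightarrow> 'a" where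
  "incl_map e b = (if b then tail_map \<G> e else head_map \<G> e)"

definition edge_image :: "'e \<Rightarrow> bool \<Rightarrow> 'a set" where
  "edge_image e b = incl_map e b ` carrier (egroup \<G> e)"

text \<open>The isomorphism between the two images of the edge group, by which an element slides
  across the edge letter. It is meaningful on \<open>edge_image e b\<close> only.\<close>

definition transfer :: "'e \<Rightarrow> bool \<Rightarrow> 'a \<Rightarrow> 'a" where
  "transfer e b h = incl_map e (\<not> b) (inv_into (carrier (egroup \<G> e)) (incl_map e b) h)"

lemma origin_in_verts: "e \<in> arcs (base_graph \<G>) \<Longrightarrow> origin e b \<in> verts (base_graph \<G>)"
  unfolding origin_def using wf_base_graph wf_digraph.tail_in_verts wf_digraph.head_in_verts by metis

context
  fixes e assumes e: "e \<in> arcs (base_graph \<G>)"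
begin

lemma incl_map_mon: "incl_map e b \<in> mon (egroup \<G> e) (vgroup \<G> (origin e b))"
  unfolding incl_map_def origin_def using tail_map_mon[OF e] head_map_mon[OF e] by simp

lemma incl_map_hom: "group_hom (egroup \<G> e) (vgroup \<G> (origin e b)) (incl_map e b)"
  using incl_map_mon[of b] group_egroup[OF e] group_vgroup[OF origin_in_verts[OF e]]
  by (simp add: group_hom_def group_hom_axioms_def mon_def)

lemma incl_map_inj: "inj_on (incl_map e b) (carrier (egroup \<G> e))"
  using incl_map_mon[of b] by (simp add: mon_def)

lemma incl_map_mult:
  "a \<in> carrier (egroup \<G> e) \<Longrightarrow> a' \<in> carrier (egroup \<G> e) \<Longrightarrow>
    incl_map e b (a \<otimes>\<^bsub>egroup \<G> e\<^esub> a') = incl_map e b a \<otimes>\<^bsub>vgroup \<G> (origin e b)\<^esub> incl_map e b a'"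
  by (rule group_hom.hom_mult[OF incl_map_hom])

lemma edge_image_subgroup: "subgroup (edge_image e b) (vgroup \<G> (origin e b))"
  unfolding edge_image_def by (rule group_hom.img_is_subgroup[OF incl_map_hom])

lemma transfer_incl_map:
  "a \<in> carrier (egroup \<G> e) \<Longrightarrow> transfer e b (incl_map e b a) = incl_map e (\<not> b) a"
  unfolding transfer_def by (simp add: inv_into_f_f[OF incl_map_inj])

lemma transfer_in: "h \<in> edge_image e b \<Longrightarrow> transfer e b h \<in> edge_image e (\<not> b)"
  unfolding edge_image_def using transfer_incl_map by auto

lemma transfer_transfer: "h \<in> edge_image e b \<Longrightarrow> transfer e (\<not> b) (transfer e b h) = h"
  unfolding edge_image_def using transfer_incl_map[of _ "\<not> b"] transfer_incl_map[of _ b] by auto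

lemma transfer_mult:
  assumes "h \<in> edge_image e b" "h' \<in> edge_image e b"
  shows "transfer e b (h \<otimes>\<^bsub>vgroup \<G> (origin e b)\<^esub> h') =
    transfer e b h \<otimes>\<^bsub>vgroup \<G> (origin e (\<not> b))\<^esub> transfer e b h'"
proof -
  obtain a a' where a: "a \<in> carrier (egroup \<G> e)" "a' \<in> carrier (egroup \<G> e)"
    "h = incl_map e b a" "h' = incl_map e b a'"
    using assms unfolding edge_image_def by auto
  have c: "a \<otimes>\<^bsub>egroup \<G> e\<^esub> a' \<in> carrier (egroup \<G> e)"
    using a(1,2) group_egroup[OF e] by (simp add: group.is_monoid monoid.m_closed)
  show ?thesis
    using transfer_incl_map[OF c, of b] unfolding incl_map_mult[OF a(1,2)] a(3,4)
    by (simp only: transfer_incl_map[OF a(1)] transfer_incl_map[OF a(2)])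
qed

end

text \<open>Prefixes are stored with the last edge first.\<close>

fun end_of :: "('a \<times> 'e \<times> bool) list \<Rightarrow> 'v" where
  "end_of [] = v\<^sub>0"
| "end_of ((r, e, b) # p) = origin e (\<not> b)"

text \<open>The forbidden pattern is an edge followed by its reverse with the trivial representative
  in between, the only case in which the two edge letters cancel.\<close>

fun reduced :: "('a \<times> 'e \<times> bool) list \<Rightarrow> bool" where
  "reduced [] \<longleftrightarrow> True"
| "reduced ((r, e, b) # p) \<longleftrightarrow> reduced p \<and> e \<in> arcs (base_graph \<G>) \<and> origin e b = end_of p \<and>
     r \<in> carrier (vgroup \<G> (origin e b)) \<and> coset_rep (vgroup \<G> (origin e b)) (edge_image e b) r = r \<and>
     \<not> (r = \<one>\<^bsub>vgroup \<G> (origin e b)\<^esub> \<and> p \<noteq> [] \<and> snd (hd p) = (e, \<not> b))"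

definition normal_forms :: "(('a \<times> 'e \<times> bool) list \<times> 'a) set" where
  "normal_forms = {(p, g). reduced p \<and> g \<in> carrier (vgroup \<G> (end_of p))}"

text \<open>Right multiplication by an edge letter: split \<open>g\<close> as representative times
  \<open>h\<close>, and slide \<open>h\<close> across the edge. If the representative is one and the
  last edge is the reverse, the two edges cancel and \<open>h\<close> is absorbed by the
  representative that preceded them.\<close>

definition cross :: "'e \<Rightarrow> bool \<Rightarrow> ('a \<times> 'e \<times> bool) list \<times> 'a \<Rightarrow> ('a \<times> 'e \<times> bool) list \<times> 'a" where
  "cross e b = (\<lambda>(p, g).
     let r = coset_rep (vgroup \<G> (origin e b)) (edge_image e b) g;
         h = transfer e b (coset_part (vgroup \<G> (origin e b)) (edge_image e b) g)
     in if r = \<one>\<^bsub>vgroup \<G> (origin e b)\<^esub> \<and> p \<noteq> [] \<and> snd (hd p) = (e, \<not> b)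
        then (tl p, fst (hd p) \<otimes>\<^bsub>vgroup \<G> (origin e (\<not> b))\<^esub> h)
        else ((r, e, b) # p, h))"

text \<open>
  Words need not be paths, yet congruent words must act alike on all normal forms. Hence a vertex
  letter fixes the forms ending elsewhere, and an edge letter also acts, by its reverse, on the forms
  ending at its terminus when this differs from its origin.
\<close>

definition act1 :: "('a \<times> 'e \<times> bool) list \<times> 'a \<Rightarrow> ('v, 'e, 'a) letter \<Rightarrow> ('a \<times> 'e \<times> bool) list \<times> 'a" where
  "act1 x l = (case l of
     Vert v g \<Rightarrow> if end_of (fst x) = v then (fst x, snd x \<otimes>\<^bsub>vgroup \<G> v\<^esub> g) else x
   | Edge e b \<Rightarrow> if end_of (fst x) = origin e b then cross e b x
       else if end_of (fst x) = origin e (\<not> b) then cross e (\<not> b) x else x)"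

definition act :: "('a \<times> 'e \<times> bool) list \<times> 'a \<Rightarrow> ('v, 'e, 'a) letter list \<Rightarrow> ('a \<times> 'e \<times> bool) list \<times> 'a" where
  "act = foldl act1"

lemma end_of_in_verts: "reduced p \<Longrightarrow> end_of p \<in> verts (base_graph \<G>)"
  by (cases p rule: end_of.cases) (auto simp: base_point origin_in_verts)

lemma cross_backtrack:
  assumes "coset_rep (vgroup \<G> (origin e b)) (edge_image e b) g = \<one>\<^bsub>vgroup \<G> (origin e b)\<^esub>"
  shows "cross e b ((r, e, \<not> b) # p, g) = (p, r \<otimes>\<^bsub>vgroup \<G> (origin e (\<not> b))\<^esub>
    transfer e b (coset_part (vgroup \<G> (origin e b)) (edge_image e b) g))"
  using assms unfolding cross_def by simp

lemma cross_extend: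
  assumes "\<not> (coset_rep (vgroup \<G> (origin e b)) (edge_image e b) g = \<one>\<^bsub>vgroup \<G> (origin e b)\<^esub> \<and>
    p \<noteq> [] \<and> snd (hd p) = (e, \<not> b))"
  shows "cross e b (p, g) = ((coset_rep (vgroup \<G> (origin e b)) (edge_image e b) g, e, b) # p,
    transfer e b (coset_part (vgroup \<G> (origin e b)) (edge_image e b) g))"
  unfolding cross_def Let_def split by (rule if_not_P[OF assms])

lemma cross_cases:
  assumes "(p, g) \<in> normal_forms" "e \<in> arcs (base_graph \<G>)" "end_of p = origin e b"
  obtains (backtrack) r p' where "p = (r, e, \<not> b) # p'" "g \<in> edge_image e b"
      "cross e b (p, g) = (p', r \<otimes>\<^bsub>vgroup \<G> (origin e (\<not> b))\<^esub> transfer e b g)"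
  | (extend) r h where "r \<in> carrier (vgroup \<G> (origin e b))" "h \<in> edge_image e b"
      "g = r \<otimes>\<^bsub>vgroup \<G> (origin e b)\<^esub> h" "reduced ((r, e, b) # p)"
      "cross e b (p, g) = ((r, e, b) # p, transfer e b h)"
proof -
  interpret group "vgroup \<G> (origin e b)" using group_vgroup origin_in_verts assms(2) by blast
  let ?K = "vgroup \<G> (origin e b)" and ?I = "edge_image e b"
  have I: "subgroup ?I ?K" by (rule edge_image_subgroup[OF assms(2)])
  have g: "g \<in> carrier ?K" "reduced p" using assms(1,3) unfolding normal_forms_def by auto
  let ?r = "coset_rep ?K ?I g"
  show thesis
  proof (cases "?r = \<one>\<^bsub>?K\<^esub> \<and> p \<noteq> [] \<and> snd (hd p) = (e, \<not> b)")
    case True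
    then obtain r p' where p: "p = (r, e, \<not> b) # p'" by (cases p) auto
    have gI: "g \<in> ?I" using True coset_rep_one_iff[OF I g(1)] by blast
    then have "coset_part ?K ?I g = g" by (rule coset_part_subgroup[OF I])
    then show thesis using backtrack[OF p gI] cross_backtrack[of e b g r p'] True p by simp
  next
    case False
    show thesis
    proof (rule extend)
      show "cross e b (p, g) = ((?r, e, b) # p, transfer e b (coset_part ?K ?I g))"
        by (rule cross_extend[OF False])
    qed (use coset_rep[OF I g(1)] coset_rep_idem[OF I g(1)] False g assms in auto)
  qed
qed

lemma cross_closed:
  assumes "(p, g) \<in> normal_forms" "e \<in> arcs (base_graph \<G>)" "end_of p = origin e b"
  shows "cross e b (p, g) \<in> normal_forms \<and> end_of (fst (cross e b (p, g))) = origin e (\<not> b)"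
  using assms
proof (cases rule: cross_cases)
  case (backtrack r p')
  interpret group "vgroup \<G> (origin e (\<not> b))" using group_vgroup origin_in_verts assms(2) by blast
  have "transfer e b g \<in> carrier (vgroup \<G> (origin e (\<not> b)))"
    by (rule subgroup.mem_carrier[OF edge_image_subgroup transfer_in]) (use assms backtrack in auto)
  moreover have "reduced p'" "end_of p' = origin e (\<not> b)" "r \<in> carrier (vgroup \<G> (origin e (\<not> b)))"
    using assms(1) backtrack(1) unfolding normal_forms_def by auto
  ultimately show ?thesis using backtrack(3) unfolding normal_forms_def by simp
next
  case (extend r h)
  have "transfer e b h \<in> carrier (vgroup \<G> (origin e (\<not> b)))"
    by (rule subgroup.mem_carrier[OF edge_image_subgroup transfer_in]) (use assms extend in auto)
  then show ?thesis using extend(4,5) unfolding normal_forms_def by (simp del: reduced.simps)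
qed

text \<open>After a cancellation, reducedness of the old prefix forbids a second one, and the
  removed entry is restored because its representative is canonical. After an extension, the
  remaining element lies in the edge image, so the way back cancels the new entry.\<close>

lemma cross_cross:
  assumes "(p, g) \<in> normal_forms" "e \<in> arcs (base_graph \<G>)" "end_of p = origin e b"
  shows "cross e (\<not> b) (cross e b (p, g)) = (p, g)"
  using assms
proof (cases rule: cross_cases)
  case (backtrack r p')
  let ?K = "vgroup \<G> (origin e (\<not> b))" and ?I = "edge_image e (\<not> b)"
  interpret group ?K using group_vgroup origin_in_verts assms(2) by blast
  have I: "subgroup ?I ?K" by (rule edge_image_subgroup[OF assms(2)])
  have r: "r \<in> carrier ?K" "coset_rep ?K ?I r = r"
    "\<not> (r = \<one>\<^bsub>?K\<^esub> \<and> p' \<noteq> [] \<and> snd (hd p') = (e, \<not> \<not> b))"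
    using assms(1) backtrack(1) unfolding normal_forms_def by auto
  have t: "transfer e b g \<in> ?I" using transfer_in assms(2) backtrack(2) by blast
  have "cross e (\<not> b) (p', r \<otimes>\<^bsub>?K\<^esub> transfer e b g) =
      ((r, e, \<not> b) # p', transfer e (\<not> b) (transfer e b g))"
    using cross_extend[of e "\<not> b" "r \<otimes>\<^bsub>?K\<^esub> transfer e b g" p']
    unfolding coset_rep_canonical[OF I r(1,2) t] using r(3) by blast
  then show ?thesis
    using transfer_transfer[OF assms(2) backtrack(2)] backtrack(1,3) by simp
next
  case (extend r h)
  let ?K = "vgroup \<G> (origin e (\<not> b))" and ?I = "edge_image e (\<not> b)"
  interpret group ?K using group_vgroup origin_in_verts assms(2) by blast
  have I: "subgroup ?I ?K" by (rule edge_image_subgroup[OF assms(2)])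
  have t: "transfer e b h \<in> ?I" using transfer_in assms(2) extend(2) by blast
  show ?thesis
    using cross_backtrack[OF coset_rep_subgroup[OF t], of r p] coset_part_subgroup[OF I t]
      transfer_transfer[OF assms(2) extend(2)] extend(3,5) by simp
qed

text \<open>Multiplying by an element of the edge image keeps the coset, hence the branch taken by
  \<open>cross\<close>. This is what the relation \<open>edge_conj\<close> demands of the
  action.\<close>

lemma cross_mult:
  assumes "(p, g) \<in> normal_forms" "e \<in> arcs (base_graph \<G>)" "end_of p = origin e b"
    and h: "h \<in> edge_image e b"
  shows "cross e b (p, g \<otimes>\<^bsub>vgroup \<G> (origin e b)\<^esub> h) = (fst (cross e b (p, g)),
    snd (cross e b (p, g)) \<otimes>\<^bsub>vgroup \<G> (origin e (\<not> b))\<^esub> transfer e b h)"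
proof -
  let ?K = "vgroup \<G> (origin e b)" and ?I = "edge_image e b" and ?K' = "vgroup \<G> (origin e (\<not> b))"
  interpret group ?K using group_vgroup origin_in_verts assms(2) by blast
  interpret K': group ?K' using group_vgroup origin_in_verts assms(2) by blast
  have I: "subgroup ?I ?K" by (rule edge_image_subgroup[OF assms(2)])
  have g: "g \<in> carrier ?K" "reduced p" using assms(1,3) unfolding normal_forms_def by auto
  have c: "coset_part ?K ?I g \<in> ?I" by (rule coset_rep(2)[OF I g(1)])
  have t: "transfer e b x \<in> carrier ?K'" if "x \<in> ?I" for x
    by (rule subgroup.mem_carrier[OF edge_image_subgroup[OF assms(2)] transfer_in[OF assms(2) that]])
  have "fst (hd p) \<in> carrier ?K'" if "p \<noteq> []" "snd (hd p) = (e, \<not> b)"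
    using g(2) that by (cases p rule: reduced.cases) auto
  then show ?thesis
    unfolding cross_def Let_def split coset_rep_mult[OF I g(1) h] coset_part_mult[OF I g(1) h]
      transfer_mult[OF assms(2) c h]
    using t[OF c] t[OF h] K'.m_assoc by auto
qed

end

section \<open>The action of words on normal forms\<close>

context based_graph_of_groups
begin

lemma act1_Vert: "act1 (p, x) (Vert v g) = (if end_of p = v then (p, x \<otimes>\<^bsub>vgroup \<G> v\<^esub> g) else (p, x))"
  unfolding act1_def by simp

lemma act1_Edge: "act1 x (Edge e b) = (if end_of (fst x) = origin e b then cross e b x
    else if end_of (fst x) = origin e (\<not> b) then cross e (\<not> b) x else x)"
  unfolding act1_def by simp

lemma act_Nil [simp]: "act x [] = x"
  and act_Cons [simp]: "act x (l # w) = act (act1 x l) w"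
  and act_append [simp]: "act x (u @ w) = act (act x u) w"
  unfolding act_def by simp_all

lemma Vert_letters: "Vert v g \<in> letters \<G> \<longleftrightarrow> v \<in> verts (base_graph \<G>) \<and> g \<in> carrier (vgroup \<G> v)"
  and Edge_letters: "Edge e b \<in> letters \<G> \<longleftrightarrow> e \<in> arcs (base_graph \<G>)"
  unfolding letters_def by auto

lemma vgroup_mult_closed:
  "v \<in> verts (base_graph \<G>) \<Longrightarrow> g \<in> carrier (vgroup \<G> v) \<Longrightarrow> h \<in> carrier (vgroup \<G> v) \<Longrightarrow>
    g \<otimes>\<^bsub>vgroup \<G> v\<^esub> h \<in> carrier (vgroup \<G> v)"
  by (rule monoid.m_closed[OF group.is_monoid[OF group_vgroup]])

lemma act1_closed:
  assumes x: "x \<in> normal_forms" and l: "l \<in> letters \<G>"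
  shows "act1 x l \<in> normal_forms"
proof (cases l)
  case (Vert v g)
  obtain p y where "x = (p, y)" by (cases x)
  then show ?thesis using x l vgroup_mult_closed[of v y g] unfolding Vert
    by (auto simp: act1_Vert normal_forms_def Vert_letters)
next
  case (Edge e b)
  obtain p y where p: "x = (p, y)" by (cases x)
  show ?thesis using x l cross_closed[of p y e] unfolding Edge p
    by (auto simp: act1_Edge Edge_letters)
qed

lemma act_closed: "x \<in> normal_forms \<Longrightarrow> w \<in> lists (letters \<G>) \<Longrightarrow> act x w \<in> normal_forms"
  by (induction w arbitrary: x) (auto simp: act1_closed)

lemma act1_edge_inv:
  assumes x: "x \<in> normal_forms" and e: "e \<in> arcs (base_graph \<G>)"
  shows "act1 (act1 x (Edge e b)) (Edge e (\<not> b)) = x"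
proof -
  obtain p y where p: "x = (p, y)" by (cases x)
  have x': "(p, y) \<in> normal_forms" using x p by simp
  consider "end_of p = origin e b" | "end_of p = origin e (\<not> b)" "origin e (\<not> b) \<noteq> origin e b"
    | "end_of p \<noteq> origin e b" "end_of p \<noteq> origin e (\<not> b)" by argo
  then show ?thesis
  proof cases
    case 1
    then show ?thesis using cross_closed[OF x' e 1] cross_cross[OF x' e 1] p by (simp add: act1_Edge)
  next
    case 2
    then show ?thesis using cross_closed[OF x' e 2(1)] cross_cross[OF x' e 2(1)] p by (simp add: act1_Edge)
  next
    case 3
    then show ?thesis using p by (simp add: act1_Edge)
  qed
qed

text \<open>At the origin of the edge this is \<open>cross_mult\<close>. On all other forms both
  vertex letters act trivially, since the edge letter moves forms at a different terminus back to
  the origin.\<close>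

lemma act1_edge_slide:
  assumes x: "x \<in> normal_forms" and e: "e \<in> arcs (base_graph \<G>)" and a: "a \<in> carrier (egroup \<G> e)"
  shows "act1 (act1 x (Edge e b)) (Vert (origin e (\<not> b)) (incl_map e (\<not> b) a)) =
    act1 (act1 x (Vert (origin e b) (incl_map e b a))) (Edge e b)"
proof -
  obtain p y where p: "x = (p, y)" by (cases x)
  have x': "(p, y) \<in> normal_forms" using x p by simp
  have h: "incl_map e b a \<in> edge_image e b" unfolding edge_image_def using a by blast
  consider "end_of p = origin e b" | "end_of p = origin e (\<not> b)" "origin e (\<not> b) \<noteq> origin e b"
    | "end_of p \<noteq> origin e b" "end_of p \<noteq> origin e (\<not> b)" by argo
  then show ?thesis
  proof cases
    case 1
    obtain p' y' where c: "cross e b (p, y) = (p', y')" by (cases "cross e b (p, y)")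
    show ?thesis using cross_mult[OF x' e 1 h] cross_closed[OF x' e 1] transfer_incl_map[OF e a, of b] 1
      by (simp add: p act1_Edge act1_Vert c)
  next
    case 2
    obtain p' y' where c: "cross e (\<not> b) (p, y) = (p', y')" by (cases "cross e (\<not> b) (p, y)")
    show ?thesis using cross_closed[OF x' e 2(1)] 2 by (simp add: p act1_Edge act1_Vert c)
  next
    case 3
    then show ?thesis using p by (simp add: act1_Edge act1_Vert)
  qed
qed

lemma incl_map_letter:
  assumes "e \<in> arcs (base_graph \<G>)" "a \<in> carrier (egroup \<G> e)"
  shows "Vert (origin e b) (incl_map e b a) \<in> letters \<G>"
  unfolding Vert_letters
  using origin_in_verts[OF assms(1)] group_hom.hom_closed[OF incl_map_hom[OF assms(1)] assms(2)] by blast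

lemma word_cong_letters:
  "(u, w) \<in> word_cong \<G> \<Longrightarrow> u \<in> lists (letters \<G>) \<and> w \<in> lists (letters \<G>)"
proof (induction rule: word_cong.induct)
  case (vert_mult v g h)
  then show ?case using vgroup_mult_closed by (simp add: Vert_letters)
next
  case (vert_one v)
  then show ?case using group.is_monoid[OF group_vgroup] by (simp add: Vert_letters monoid.one_closed)
next
  case (edge_conj e a)
  then show ?case
    using incl_map_letter[of e a True] incl_map_letter[of e a False]
    by (auto simp: Edge_letters origin_def incl_map_def)
qed (auto simp: Edge_letters)

text \<open>The point of the action: each defining relation holds for it, so words with different
  effects on some normal form are not congruent.\<close>

lemma act_word_cong:
  "(u, w) \<in> word_cong \<G> \<Longrightarrow> x \<in> normal_forms \<Longrightarrow> act x u = act x w"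
proof (induction arbitrary: x rule: word_cong.induct)
  case (vert_mult v g h)
  obtain p y where p: "x = (p, y)" by (cases x)
  interpret group "vgroup \<G> v" using group_vgroup vert_mult by blast
  have "y \<in> carrier (vgroup \<G> v)" if "end_of p = v"
    using vert_mult(4) p that unfolding normal_forms_def by auto
  then show ?case using vert_mult(2,3) m_assoc[of y g h] by (simp add: p act1_Vert)
next
  case (vert_one v)
  obtain p y where p: "x = (p, y)" by (cases x)
  interpret group "vgroup \<G> v" using group_vgroup vert_one by blast
  have "y \<in> carrier (vgroup \<G> v)" if "end_of p = v"
    using vert_one(2) p that unfolding normal_forms_def by auto
  then show ?case by (simp add: p act1_Vert)
next
  case (edge_inv e b)
  then show ?case using act1_edge_inv by simp
next
  case (edge_conj e a)
  let ?t = "Vert (origin e True) (incl_map e True a)"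
  have "?t \<in> letters \<G>" using incl_map_letter edge_conj(1,2) by blast
  then have "act1 x ?t \<in> normal_forms" using act1_closed edge_conj by blast
  then have "act1 (act1 (act1 x ?t) (Edge e True)) (Edge e False) = act1 x ?t"
    using act1_edge_inv[of _ e True] edge_conj by simp
  moreover have "act1 (act1 x (Edge e True)) (Vert (origin e False) (incl_map e False a)) =
      act1 (act1 x ?t) (Edge e True)"
    using act1_edge_slide[OF edge_conj(3,1,2), of True] by simp
  ultimately show ?case by (simp add: origin_def incl_map_def)
next
  case (append u u' w w')
  then show ?case using act_closed word_cong_letters by simp
qed auto

lemma word_cong_context:
  assumes "(u, w) \<in> word_cong \<G>" "p \<in> lists (letters \<G>)" "s \<in> lists (letters \<G>)"
  shows "(p @ u @ s, p @ w @ s) \<in> word_cong \<G>"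
  using assms by (intro word_cong.append word_cong.refl)

text \<open>\<open>edge_conj\<close> is given for one orientation only; cancelling against the edge
  letters yields both.\<close>

lemma edge_slide:
  assumes e: "e \<in> arcs (base_graph \<G>)" and a: "a \<in> carrier (egroup \<G> e)"
  shows "([Vert (origin e b) (incl_map e b a), Edge e b],
    [Edge e b, Vert (origin e (\<not> b)) (incl_map e (\<not> b) a)]) \<in> word_cong \<G>"
proof -
  let ?t = "Vert (origin e True) (incl_map e True a)" and ?h = "Vert (origin e False) (incl_map e False a)"
  have conj: "([Edge e True, ?h, Edge e False], [?t]) \<in> word_cong \<G>"
    using word_cong.edge_conj[OF e a] by (simp add: origin_def incl_map_def)
  have th: "[?t] \<in> lists (letters \<G>)" "[?h] \<in> lists (letters \<G>)" "[Edge e c] \<in> lists (letters \<G>)" for c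
    using incl_map_letter[OF e a] e by (auto simp: Edge_letters)
  show ?thesis
  proof (cases b)
    case True
    have "([?t, Edge e True], [Edge e True, ?h, Edge e False, Edge e True]) \<in> word_cong \<G>"
      using word_cong_context[OF word_cong.sym[OF conj], of "[]" "[Edge e True]"] th by simp
    moreover have "([Edge e True, ?h, Edge e False, Edge e True], [Edge e True, ?h]) \<in> word_cong \<G>"
      using word_cong_context[OF word_cong.edge_inv[OF e, of False], of "[Edge e True, ?h]" "[]"] th by simp
    ultimately show ?thesis using True word_cong.trans by fastforce
  next
    case False
    have "([?h, Edge e False], [Edge e False, Edge e True, ?h, Edge e False]) \<in> word_cong \<G>"
      using word_cong_context[OF word_cong.sym[OF word_cong.edge_inv[OF e, of False]], of "[]" "[?h, Edge e False]"] th
      by simp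
    moreover have "([Edge e False, Edge e True, ?h, Edge e False], [Edge e False, ?t]) \<in> word_cong \<G>"
      using word_cong_context[OF conj, of "[Edge e False]" "[]"] th by simp
    ultimately show ?thesis using False word_cong.trans by fastforce
  qed
qed

lemma edge_slide_transfer:
  assumes "e \<in> arcs (base_graph \<G>)" "h \<in> edge_image e b"
  shows "([Vert (origin e b) h, Edge e b], [Edge e b, Vert (origin e (\<not> b)) (transfer e b h)]) \<in> word_cong \<G>"
  using assms edge_slide transfer_incl_map unfolding edge_image_def by auto

fun prefix_word :: "('a \<times> 'e \<times> bool) list \<Rightarrow> ('v, 'e, 'a) letter list" where
  "prefix_word [] = []"
| "prefix_word ((r, e, b) # p) = prefix_word p @ [Vert (origin e b) r, Edge e b]"

definition nf_word :: "('a \<times> 'e \<times> bool) list \<times> 'a \<Rightarrow> ('v, 'e, 'a) letter list" where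
  "nf_word x = prefix_word (fst x) @ [Vert (end_of (fst x)) (snd x)]"

lemma prefix_word_letters: "reduced p \<Longrightarrow> prefix_word p \<in> lists (letters \<G>)"
  by (induction p rule: reduced.induct) (auto simp: Vert_letters Edge_letters end_of_in_verts)

lemma nf_word_letters: "x \<in> normal_forms \<Longrightarrow> nf_word x \<in> lists (letters \<G>)"
  unfolding nf_word_def normal_forms_def
  using prefix_word_letters[of "fst x"] end_of_in_verts by (auto simp: Vert_letters)

lemma is_path_Edge: "is_path \<G> u (Edge e b # w) v \<longleftrightarrow>
    e \<in> arcs (base_graph \<G>) \<and> origin e b = u \<and> is_path \<G> (origin e (\<not> b)) w v"
  unfolding origin_def by auto

text \<open>Along a path, \<open>cross\<close> does nothing but slide, cancel and multiply, each of
  which is a congruence of words. Hence every path from the base point is congruent to the word of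
  its normal form.\<close>

lemma nf_word_act1:
  assumes x: "x \<in> normal_forms" and l: "is_path \<G> (end_of (fst x)) [l] u"
  shows "(nf_word x @ [l], nf_word (act1 x l)) \<in> word_cong \<G> \<and> end_of (fst (act1 x l)) = u"
proof -
  obtain p y where p: "x = (p, y)" by (cases x)
  have red: "reduced p" "y \<in> carrier (vgroup \<G> (end_of p))" "(p, y) \<in> normal_forms"
    using x p unfolding normal_forms_def by auto
  have pw: "prefix_word p \<in> lists (letters \<G>)" using prefix_word_letters red by blast
  show ?thesis
  proof (cases l)
    case (Vert v g)
    then have v: "v = end_of p" "u = v" "v \<in> verts (base_graph \<G>)" "g \<in> carrier (vgroup \<G> v)"
      using l p by auto
    have "([Vert v y, Vert v g], [Vert v (y \<otimes>\<^bsub>vgroup \<G> v\<^esub> g)]) \<in> word_cong \<G>"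
      by (rule word_cong.vert_mult) (use v red in auto)
    from word_cong_context[OF this pw, of "[]"] show ?thesis
      using v Vert p by (simp add: nf_word_def act1_Vert)
  next
    case (Edge e b)
    then have e: "e \<in> arcs (base_graph \<G>)" "end_of p = origin e b" "u = origin e (\<not> b)"
      using l p by (auto simp: origin_def split: if_splits)
    have a1: "act1 x l = cross e b (p, y)" using Edge e(2) p by (simp add: act1_Edge)
    have "(nf_word (p, y) @ [Edge e b], nf_word (cross e b (p, y))) \<in> word_cong \<G>"
      using red(3) e(1,2)
    proof (cases rule: cross_cases)
      case (backtrack r p')
      let ?v = "origin e (\<not> b)"
      let ?t = "transfer e b y"
      have p': "reduced p'" "end_of p' = ?v" "r \<in> carrier (vgroup \<G> ?v)"
        using red(1) backtrack(1) by auto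
      have t: "?t \<in> carrier (vgroup \<G> ?v)"
        by (rule subgroup.mem_carrier[OF edge_image_subgroup transfer_in]) (use e backtrack in auto)
      let ?q = "prefix_word p' @ [Vert ?v r]"
      have q: "?q \<in> lists (letters \<G>)"
        using prefix_word_letters p' origin_in_verts[OF e(1)] by (simp add: Vert_letters)
      have lt: "[Vert ?v ?t] \<in> lists (letters \<G>)" "[Edge e (\<not> b)] \<in> lists (letters \<G>)"
        using t origin_in_verts e(1) by (auto simp: Vert_letters Edge_letters)
      \<comment> \<open>Slide \<open>y\<close> across the edge, cancel the opposite edge letters,
        then merge the two letters that meet at \<open>?v\<close>.\<close>
      have "(?q @ [Edge e (\<not> b)] @ [Vert (origin e b) y, Edge e b] @ [],
          ?q @ [Edge e (\<not> b)] @ [Edge e b, Vert ?v ?t] @ []) \<in> word_cong \<G>"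
        using word_cong_context[OF edge_slide_transfer[OF e(1) backtrack(2)], of "?q @ [Edge e (\<not> b)]" "[]"] q lt
        by simp
      moreover have "(?q @ [Edge e (\<not> b), Edge e b] @ [Vert ?v ?t], ?q @ [] @ [Vert ?v ?t]) \<in> word_cong \<G>"
        using word_cong_context[OF word_cong.edge_inv[OF e(1), of "\<not> b"] q lt(1)] by simp
      moreover have "(prefix_word p' @ [Vert ?v r, Vert ?v ?t] @ [],
          prefix_word p' @ [Vert ?v (r \<otimes>\<^bsub>vgroup \<G> ?v\<^esub> ?t)] @ []) \<in> word_cong \<G>"
        by (rule word_cong_context[OF word_cong.vert_mult])
          (use p' t origin_in_verts[OF e(1)] prefix_word_letters in auto)
      ultimately show ?thesis
        unfolding nf_word_def backtrack(3) using backtrack(1) p'(2) e(2)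
        by (auto intro: word_cong.trans)
    next
      case (extend r h)
      let ?v = "origin e b"
      have v: "?v \<in> verts (base_graph \<G>)" using origin_in_verts e by blast
      have h: "h \<in> carrier (vgroup \<G> ?v)"
        by (rule subgroup.mem_carrier[OF edge_image_subgroup]) (use e extend in auto)
      have "(prefix_word p @ [Vert ?v (r \<otimes>\<^bsub>vgroup \<G> ?v\<^esub> h)] @ [Edge e b],
          prefix_word p @ [Vert ?v r, Vert ?v h] @ [Edge e b]) \<in> word_cong \<G>"
        by (rule word_cong_context[OF word_cong.sym[OF word_cong.vert_mult]])
          (use v h extend pw e in \<open>auto simp: Edge_letters\<close>)
      moreover have "((prefix_word p @ [Vert ?v r]) @ [Vert ?v h, Edge e b] @ [],
          (prefix_word p @ [Vert ?v r]) @ [Edge e b, Vert (origin e (\<not> b)) (transfer e b h)] @ []) \<in> word_cong \<G>"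
        by (rule word_cong_context[OF edge_slide_transfer[OF e(1) extend(2)]])
          (use v extend pw in \<open>auto simp: Vert_letters\<close>)
      ultimately show ?thesis
        unfolding nf_word_def extend(5) using extend(3) e(2) by (auto intro: word_cong.trans)
    qed
    then show ?thesis using cross_closed[OF red(3) e(1,2)] a1 e(3) Edge p by simp
  qed
qed

lemma is_path_letters:
  "is_path \<G> u w v \<Longrightarrow> w \<in> lists (letters \<G>) \<and> u \<in> verts (base_graph \<G>) \<and> v \<in> verts (base_graph \<G>)"
proof (induction w arbitrary: u)
  case (Cons l w)
  then show ?case
    by (cases l) (auto simp: is_path_Edge Vert_letters Edge_letters origin_in_verts simp del: is_path.simps(3))
qed auto

end

context based_graph_of_groups
begin

lemma is_path_append:
  "is_path \<G> u w v \<Longrightarrow> is_path \<G> v w' z \<Longrightarrow> is_path \<G> u (w @ w') z"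
proof (induction w arbitrary: u)
  case (Cons l w)
  then show ?case by (cases l) (auto simp: is_path_Edge simp del: is_path.simps(3))
qed simp

lemma act_path:
  "x \<in> normal_forms \<Longrightarrow> is_path \<G> (end_of (fst x)) w u \<Longrightarrow>
    (nf_word x @ w, nf_word (act x w)) \<in> word_cong \<G> \<and> end_of (fst (act x w)) = u"
proof (induction w arbitrary: x)
  case Nil
  then show ?case using word_cong.refl[OF nf_word_letters] by simp
next
  case (Cons l w)
  obtain u' where u': "is_path \<G> (end_of (fst x)) [l] u'" "is_path \<G> u' w u"
  proof (cases l)
    case (Vert v g)
    then show ?thesis using Cons.prems(2) that[of v] by simp
  next
    case (Edge e b)
    then show ?thesis using Cons.prems(2) that[of "origin e (\<not> b)"] is_path_letters[of "origin e (\<not> b)" w u]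
      by (simp add: is_path_Edge del: is_path.simps(3))
  qed
  have l: "l \<in> letters \<G>" "w \<in> lists (letters \<G>)" using is_path_letters[OF Cons.prems(2)] by auto
  note step = nf_word_act1[OF Cons.prems(1) u'(1)]
  have "(nf_word (act1 x l) @ w, nf_word (act (act1 x l) w)) \<in> word_cong \<G> \<and> end_of (fst (act (act1 x l) w)) = u"
    by (rule Cons.IH) (use act1_closed Cons.prems(1) l step u'(2) in auto)
  moreover have "((nf_word x @ [l]) @ w, nf_word (act1 x l) @ w) \<in> word_cong \<G>"
    using step l(2) word_cong.append word_cong.refl by blast
  ultimately show ?case using word_cong.trans by fastforce
qed

definition base_nf :: "('a \<times> 'e \<times> bool) list \<times> 'a" where
  "base_nf = ([], \<one>\<^bsub>vgroup \<G> v\<^sub>0\<^esub>)"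

lemma base_nf: "base_nf \<in> normal_forms" "end_of (fst base_nf) = v\<^sub>0"
  unfolding base_nf_def normal_forms_def
  using group.is_monoid[OF group_vgroup[OF base_point]] by (auto simp: monoid.one_closed)

lemma path_cong_nf_word:
  assumes "is_path \<G> v\<^sub>0 w u"
  shows "(w, nf_word (act base_nf w)) \<in> word_cong \<G>"
proof -
  have "([Vert v\<^sub>0 \<one>\<^bsub>vgroup \<G> v\<^sub>0\<^esub>] @ w, [] @ w) \<in> word_cong \<G>"
    using is_path_letters[OF assms] word_cong.vert_one[OF base_point] word_cong.append word_cong.refl by blast
  moreover have "nf_word base_nf = [Vert v\<^sub>0 \<one>\<^bsub>vgroup \<G> v\<^sub>0\<^esub>]" unfolding nf_word_def base_nf_def by simp
  ultimately show ?thesis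
    using act_path[of base_nf w u] base_nf assms word_cong.sym word_cong.trans by (metis append_Nil)
qed

text \<open>The normal form theorem. Congruent words act alike, and conversely a path can be
  recovered up to congruence from its effect on \<open>base_nf\<close>.\<close>

lemma path_cong_iff:
  assumes "is_path \<G> v\<^sub>0 w u" "is_path \<G> v\<^sub>0 w' u'"
  shows "(w, w') \<in> word_cong \<G> \<longleftrightarrow> act base_nf w = act base_nf w'"
  using act_word_cong[OF _ base_nf(1)] path_cong_nf_word[OF assms(1)] path_cong_nf_word[OF assms(2)]
    word_cong.sym word_cong.trans by metis

definition inv_letter :: "('v, 'e, 'a) letter \<Rightarrow> ('v, 'e, 'a) letter" where
  "inv_letter l = (case l of Vert v g \<Rightarrow> Vert v (inv\<^bsub>vgroup \<G> v\<^esub> g) | Edge e b \<Rightarrow> Edge e (\<not> b))"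

definition inv_word :: "('v, 'e, 'a) letter list \<Rightarrow> ('v, 'e, 'a) letter list" where
  "inv_word w = rev (map inv_letter w)"

lemma inv_letter_simps [simp]:
  "inv_letter (Vert v g) = Vert v (inv\<^bsub>vgroup \<G> v\<^esub> g)" "inv_letter (Edge e b) = Edge e (\<not> b)"
  unfolding inv_letter_def by simp_all

lemma inv_letter:
  assumes "l \<in> letters \<G>"
  shows "inv_letter l \<in> letters \<G>" "inv_letter (inv_letter l) = l" "([l, inv_letter l], []) \<in> word_cong \<G>"
proof -
  have "inv_letter l \<in> letters \<G> \<and> inv_letter (inv_letter l) = l \<and> ([l, inv_letter l], []) \<in> word_cong \<G>"
  proof (cases l)
    case (Vert v g)
    then have v: "v \<in> verts (base_graph \<G>)" "g \<in> carrier (vgroup \<G> v)" using assms by (auto simp: Vert_letters)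
    interpret group "vgroup \<G> v" using group_vgroup[OF v(1)] .
    have "([Vert v g, Vert v (inv\<^bsub>vgroup \<G> v\<^esub> g)], []) \<in> word_cong \<G>"
      using word_cong.trans[OF word_cong.vert_mult[OF v inv_closed[OF v(2)]]] word_cong.vert_one[OF v(1)] v
      by simp
    then show ?thesis using Vert v by (simp add: Vert_letters)
  next
    case (Edge e b)
    then show ?thesis using assms word_cong.edge_inv[of e \<G> b] by (simp add: Edge_letters)
  qed
  then show "inv_letter l \<in> letters \<G>" "inv_letter (inv_letter l) = l" "([l, inv_letter l], []) \<in> word_cong \<G>"
    by blast+
qed

lemma act1_inv_letter:
  assumes "x \<in> normal_forms" "l \<in> letters \<G>"
  shows "act1 (act1 x l) (inv_letter l) = x"
  using act_word_cong[OF inv_letter(3)[OF assms(2)] assms(1)] by simp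

lemma inv_word_letters: "w \<in> lists (letters \<G>) \<Longrightarrow> inv_word w \<in> lists (letters \<G>)"
  unfolding inv_word_def using inv_letter(1) by auto

lemma word_inv_right: "w \<in> lists (letters \<G>) \<Longrightarrow> (w @ inv_word w, []) \<in> word_cong \<G>"
proof (induction w)
  case Nil
  show ?case unfolding inv_word_def using word_cong.refl[of "[]" \<G>] by simp
next
  case (Cons l w)
  then have l: "[l] \<in> lists (letters \<G>)" "[inv_letter l] \<in> lists (letters \<G>)" "l \<in> letters \<G>"
    using inv_letter by auto
  have "([l] @ (w @ inv_word w) @ [inv_letter l], [l] @ [] @ [inv_letter l]) \<in> word_cong \<G>"
    by (rule word_cong_context[OF _ l(1,2)]) (use Cons in auto)
  then show ?case using word_cong.trans[OF _ inv_letter(3)[OF l(3)]] by (simp add: inv_word_def)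
qed

lemma word_inv_left:
  assumes "w \<in> lists (letters \<G>)"
  shows "(inv_word w @ w, []) \<in> word_cong \<G>"
proof -
  have "map (\<lambda>l. inv_letter (inv_letter l)) w = map (\<lambda>l. l) w"
    by (rule map_cong) (use assms inv_letter(2) in auto)
  then have "inv_word (inv_word w) = w" unfolding inv_word_def by (simp add: rev_map o_def)
  then show ?thesis using word_inv_right[OF inv_word_letters[OF assms]] by simp
qed

lemma inv_word_path: "is_path \<G> u w v \<Longrightarrow> is_path \<G> v (inv_word w) u"
proof (induction w arbitrary: u)
  case Nil
  then show ?case by (auto simp: inv_word_def)
next
  case (Cons l w)
  have eq: "inv_word (l # w) = inv_word w @ [inv_letter l]" by (simp add: inv_word_def)
  have l: "inv_letter l \<in> letters \<G>" "u \<in> verts (base_graph \<G>)" "l \<in> letters \<G>"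
    using is_path_letters[OF Cons.prems] inv_letter by auto
  show ?case
  proof (cases l)
    case (Vert x g)
    then show ?thesis unfolding eq
      using Cons l by (auto intro!: is_path_append[where v = u] simp: Vert_letters)
  next
    case (Edge e b)
    then show ?thesis unfolding eq using Cons l
      by (auto intro!: is_path_append[where v = "origin e (\<not> b)"] simp: is_path_Edge Edge_letters
        simp del: is_path.simps(3))
  qed
qed

abbreviation word_class :: "('v, 'e, 'a) letter list \<Rightarrow> ('v, 'e, 'a) letter list set" where
  "word_class w \<equiv> word_cong \<G> `` {w}"

lemma word_class_eq:
  assumes "u \<in> lists (letters \<G>)"
  shows "word_class u = word_class w \<longleftrightarrow> (u, w) \<in> word_cong \<G>"
proof
  assume "word_class u = word_class w"
  then show "(u, w) \<in> word_cong \<G>" using word_cong.refl[OF assms] by (blast intro: word_cong.sym)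
next
  assume "(u, w) \<in> word_cong \<G>"
  then have "(u, z) \<in> word_cong \<G> \<longleftrightarrow> (w, z) \<in> word_cong \<G>" for z
    by (meson word_cong.sym word_cong.trans)
  then show "word_class u = word_class w" by blast
qed

lemma word_class_mult:
  assumes "u \<in> lists (letters \<G>)" "w \<in> lists (letters \<G>)"
  shows "word_class u \<otimes>\<^bsub>fundamental_group \<G> v\<^sub>0\<^esub> word_class w = word_class (u @ w)"
proof -
  have "word_class (u' @ w') = word_class (u @ w)" if "(u, u') \<in> word_cong \<G>" "(w, w') \<in> word_cong \<G>" for u' w'
    using word_class_eq[of "u @ w" "u' @ w'"] word_cong.append[OF that] assms by auto
  then have "(\<Union>u'\<in>word_class u. \<Union>w'\<in>word_class w. word_class (u' @ w')) =
      (\<Union>u'\<in>word_class u. \<Union>w'\<in>word_class w. word_class (u @ w))"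
    by (intro SUP_cong) (simp_all add: Image_singleton_iff)
  also have "\<dots> = word_class (u @ w)"
  proof -
    have "word_class u \<noteq> {}" "word_class w \<noteq> {}"
      using word_cong.refl[OF assms(1)] word_cong.refl[OF assms(2)] by blast+
    then show ?thesis by simp
  qed
  finally have "(\<Union>u'\<in>word_class u. \<Union>w'\<in>word_class w. word_class (u' @ w')) = word_class (u @ w)" .
  then show ?thesis unfolding fundamental_group_def path_group_def by simp
qed

lemma path_exists:
  assumes "v \<in> verts (base_graph \<G>)"
  shows "\<exists>w. is_path \<G> v\<^sub>0 w v"
proof -
  have "v\<^sub>0 \<rightarrow>\<^sup>*\<^bsub>with_proj (mk_symmetric (base_graph \<G>))\<^esub> v"
    using connected_base_graph assms base_point unfolding connected_def strongly_connected_def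
    by (simp add: mk_symmetric_def)
  then have "(v\<^sub>0, v) \<in> (arcs_ends (with_proj (mk_symmetric (base_graph \<G>))))\<^sup>*" by (rule reachable_rtranclI)
  then show ?thesis
  proof (induction rule: rtrancl_induct)
    case base
    then show ?case using base_point by (intro exI[of _ "[]"]) simp
  next
    case (step y z)
    then obtain w where w: "is_path \<G> v\<^sub>0 w y" by blast
    obtain e b where e: "e \<in> arcs (base_graph \<G>)" "origin e b = y" "origin e (\<not> b) = z"
    proof -
      obtain e where "e \<in> arcs (base_graph \<G>)"
        "(y, z) = (tail (base_graph \<G>) e, head (base_graph \<G>) e) \<or> (y, z) = (head (base_graph \<G>) e, tail (base_graph \<G>) e)"
        using step(2) by (auto simp: arcs_ends_conv mk_symmetric_def)
      then show ?thesis using that[of e True] that[of e False] by (auto simp: origin_def)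
    qed
    then have "is_path \<G> y [Edge e b] z"
      using origin_in_verts[OF e(1), of "\<not> b"] by (simp add: is_path_Edge del: is_path.simps(3))
    then show ?case using is_path_append[OF w] by blast
  qed
qed

end

section \<open>The graph of normal forms\<close>

locale generated_graph_of_groups = based_graph_of_groups \<G> v\<^sub>0
  for \<G> :: "('v, 'e, 'a, 'b) pre_graph_of_groups" and v\<^sub>0 :: 'v +
  fixes S :: "'v \<Rightarrow> 'a set"
  assumes finite_base: "fin_digraph (base_graph \<G>)"
    and gens: "v \<in> verts (base_graph \<G>) \<Longrightarrow> finite_generating_set (vgroup \<G> v) (S v)"
    and finite_egroup: "e \<in> arcs (base_graph \<G>) \<Longrightarrow> finite (carrier (egroup \<G> e))"
begin

lemma finite_verts: "finite (verts (base_graph \<G>))" and finite_arcs: "finite (arcs (base_graph \<G>))"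
  using finite_base fin_digraph.finite_verts fin_digraph.finite_arcs by blast+

lemma gens_simps:
  assumes "v \<in> verts (base_graph \<G>)"
  shows "finite (S v)" "S v \<subseteq> carrier (vgroup \<G> v)" "generate (vgroup \<G> v) (S v) = carrier (vgroup \<G> v)"
  using gens[OF assms] unfolding finite_generating_set_def by auto

definition gen_letters :: "('v, 'e, 'a) letter set" where
  "gen_letters = (\<Union>v\<in>verts (base_graph \<G>). Vert v ` S v) \<union>
     (\<lambda>(e, b). Edge e b) ` (arcs (base_graph \<G>) \<times> UNIV)"

lemma finite_gen_letters: "finite gen_letters"
  unfolding gen_letters_def using finite_verts finite_arcs gens_simps by auto

lemma gen_letters_subset: "gen_letters \<subseteq> letters \<G>"
  unfolding gen_letters_def using gens_simps(2)[THEN subsetD] by (auto simp: Vert_letters Edge_letters)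

text \<open>The Schreier graph of the letters on all normal forms, wherever they end.
  \<open>G\<close> will occupy only forms ending at \<open>v\<^sub>0\<close>, but here the forms
  over every reduced prefix make up a full copy of a vertex group.\<close>

definition nf_adj :: "('a \<times> 'e \<times> bool) list \<times> 'a \<Rightarrow> ('a \<times> 'e \<times> bool) list \<times> 'a \<Rightarrow> bool" where
  "nf_adj x y \<longleftrightarrow> x \<in> normal_forms \<and> y \<in> normal_forms \<and> x \<noteq> y \<and>
     (\<exists>l \<in> gen_letters. act1 x l = y \<or> act1 y l = x)"

lemma symp_nf_adj: "symp nf_adj"
  unfolding symp_def nf_adj_def by auto

lemma nf_adj_degree:
  "finite {y. nf_adj x y} \<and> card {y. nf_adj x y} \<le> 2 * card gen_letters"
proof -
  let ?N = "act1 x ` gen_letters \<union> (\<lambda>l. act1 x (inv_letter l)) ` gen_letters"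
  have sub: "{y. nf_adj x y} \<subseteq> ?N"
  proof
    fix y assume "y \<in> {y. nf_adj x y}"
    then obtain l where l: "x \<in> normal_forms" "y \<in> normal_forms" "l \<in> gen_letters" "act1 x l = y \<or> act1 y l = x"
      unfolding nf_adj_def by blast
    then have "act1 y l = x \<Longrightarrow> y = act1 x (inv_letter l)"
      using act1_inv_letter[of y l] gen_letters_subset by auto
    then show "y \<in> ?N" using l by blast
  qed
  have "card ?N \<le> card (act1 x ` gen_letters) + card ((\<lambda>l. act1 x (inv_letter l)) ` gen_letters)"
    by (rule card_Un_le)
  also have "\<dots> \<le> 2 * card gen_letters"
    unfolding mult_2 by (intro add_mono card_image_le finite_gen_letters)
  finally have "card ?N \<le> 2 * card gen_letters" .
  moreover have "finite ?N" using finite_gen_letters by simp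
  ultimately show ?thesis using sub by (meson card_mono finite_subset le_trans)
qed

lemma nf_adj_gen_letter:
  assumes "x \<in> normal_forms" "l \<in> gen_letters"
  shows "act1 x l \<in> nball nf_adj 1 x"
proof (cases "act1 x l = x")
  case False
  then have "nf_adj x (act1 x l)"
    using assms act1_closed[OF assms(1) subsetD[OF gen_letters_subset assms(2)]]
    unfolding nf_adj_def by metis
  then show ?thesis by simp
qed simp

lemma nball_Vert:
  assumes v: "v \<in> verts (base_graph \<G>)" and g: "g \<in> generate (vgroup \<G> v) (S v)"
  shows "\<exists>n. \<forall>x \<in> normal_forms. act1 x (Vert v g) \<in> nball nf_adj n x"
  using g
proof (induction rule: generate.induct)
  case one
  have "act1 x (Vert v \<one>\<^bsub>vgroup \<G> v\<^esub>) = x" if "x \<in> normal_forms" for x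
    using act_word_cong[OF word_cong.vert_one[OF v] that] by simp
  then show ?case by (intro exI[of _ 0]) simp
next
  case (incl s)
  then have "Vert v s \<in> gen_letters" using v unfolding gen_letters_def by blast
  then show ?case using nf_adj_gen_letter by blast
next
  case (inv s)
  then have l: "Vert v s \<in> gen_letters" "Vert v s \<in> letters \<G>"
    using v gen_letters_subset unfolding gen_letters_def by blast+
  have "act1 x (inv_letter (Vert v s)) \<in> nball nf_adj 1 x" if x: "x \<in> normal_forms" for x
  proof -
    let ?y = "act1 x (inv_letter (Vert v s))"
    have y: "?y \<in> normal_forms" using act1_closed x inv_letter(1)[OF l(2)] by blast
    have "act1 ?y (Vert v s) = x"
      using act1_inv_letter[OF x inv_letter(1)[OF l(2)]] inv_letter(2)[OF l(2)] by simp
    then show ?thesis using nball_sym[OF symp_nf_adj] nf_adj_gen_letter[OF y l(1)] by metis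
  qed
  then show ?case unfolding inv_letter_simps by blast
next
  case (eng h1 h2)
  then obtain n1 n2 where n: "\<forall>x \<in> normal_forms. act1 x (Vert v h1) \<in> nball nf_adj n1 x"
    "\<forall>x \<in> normal_forms. act1 x (Vert v h2) \<in> nball nf_adj n2 x" by blast
  have h: "h1 \<in> carrier (vgroup \<G> v)" "h2 \<in> carrier (vgroup \<G> v)" using eng gens_simps(3)[OF v] by auto
  have "act1 x (Vert v (h1 \<otimes>\<^bsub>vgroup \<G> v\<^esub> h2)) \<in> nball nf_adj (n1 + n2) x" if x: "x \<in> normal_forms" for x
  proof -
    have "act1 x (Vert v (h1 \<otimes>\<^bsub>vgroup \<G> v\<^esub> h2)) = act1 (act1 x (Vert v h1)) (Vert v h2)"
      using act_word_cong[OF word_cong.vert_mult[OF v h] x] by simp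
    moreover have "act1 x (Vert v h1) \<in> normal_forms" using act1_closed[OF x] v h by (simp add: Vert_letters)
    ultimately show ?thesis using nball_trans n x by metis
  qed
  then show ?case by blast
qed

text \<open>An element of \<open>G\<close> is represented by a fixed word, so right multiplication
  by it displaces all normal forms by a bounded distance. This is the Lipschitz bound in
  \<open>sep_le_normal_forms\<close>.\<close>

lemma nball_act:
  "w \<in> lists (letters \<G>) \<Longrightarrow> \<exists>n. \<forall>x \<in> normal_forms. act x w \<in> nball nf_adj n x"
proof (induction w)
  case Nil
  then show ?case by (intro exI[of _ 0]) simp
next
  case (Cons l w)
  then obtain n where n: "\<forall>x \<in> normal_forms. act x w \<in> nball nf_adj n x" by auto
  have l: "l \<in> letters \<G>" using Cons.prems by simp
  obtain n' where n': "\<forall>x \<in> normal_forms. act1 x l \<in> nball nf_adj n' x"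
  proof (cases l)
    case (Vert v g)
    then show ?thesis using nball_Vert[of v g] l gens_simps(3) that by (auto simp: Vert_letters)
  next
    case (Edge e b)
    then have "l \<in> gen_letters" using l unfolding gen_letters_def by (auto simp: Edge_letters)
    then show ?thesis using nf_adj_gen_letter that by blast
  qed
  have "act x (l # w) \<in> nball nf_adj (n' + n) x" if x: "x \<in> normal_forms" for x
  proof -
    have "act1 x l \<in> nball nf_adj n' x" using n' x by blast
    moreover have "act (act1 x l) w \<in> nball nf_adj n (act1 x l)" using n act1_closed[OF x l] by blast
    ultimately show ?thesis using nball_trans by simp
  qed
  then show ?case by blast
qed

definition edge_images :: "'v \<Rightarrow> 'a set" where
  "edge_images v = \<Union> {edge_image e b | e b. e \<in> arcs (base_graph \<G>) \<and> origin e b = v}"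

lemma finite_edge_image: "e \<in> arcs (base_graph \<G>) \<Longrightarrow> finite (edge_image e b)"
  unfolding edge_image_def using finite_egroup by blast

lemma edge_images_subset: "edge_images v \<subseteq> carrier (vgroup \<G> v)"
  unfolding edge_images_def using subgroup.subset[OF edge_image_subgroup] by blast

lemma edge_images_bounded:
  obtains D where "\<And>v. finite (edge_images v) \<and> card (edge_images v) \<le> D"
    "\<And>e b. e \<in> arcs (base_graph \<G>) \<Longrightarrow> card (edge_image e b) \<le> D"
proof -
  let ?U = "\<Union>(e, b) \<in> arcs (base_graph \<G>) \<times> UNIV. edge_image e b"
  have fin: "finite ?U" using finite_arcs finite_edge_image by auto
  have "edge_images v \<subseteq> ?U" for v unfolding edge_images_def by blast
  then have "finite (edge_images v) \<and> card (edge_images v) \<le> card ?U" for v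
    using fin by (meson card_mono finite_subset)
  moreover have "card (edge_image e b) \<le> card ?U" if "e \<in> arcs (base_graph \<G>)" for e b
    using fin that by (intro card_mono) auto
  ultimately show thesis using that by blast
qed

lemma edge_imagesI: "e \<in> arcs (base_graph \<G>) \<Longrightarrow> h \<in> edge_image e b \<Longrightarrow> h \<in> edge_images (origin e b)"
  unfolding edge_images_def by blast

text \<open>The edge images are added as generators so that every point of \<open>attach p r\<close>
  is equal or adjacent to \<open>r\<close>, as the projection in \<open>tree_separable\<close>
  requires.\<close>

definition piece_adj :: "'v \<Rightarrow> 'a \<Rightarrow> 'a \<Rightarrow> bool" where
  "piece_adj v = adjacent (cayley_graph (vgroup \<G> v) (S v \<union> edge_images v))"

text \<open>A branch with representative \<open>r\<close> is entered from points \<open>r h\<close>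
  with \<open>h\<close> in one edge image. Taking all edge images at the vertex gives a set that
  depends on \<open>r\<close> alone, not on the edge.\<close>

definition attach :: "('a \<times> 'e \<times> bool) list \<Rightarrow> 'a \<Rightarrow> 'a set" where
  "attach p r = (if reduced p \<and> r \<in> carrier (vgroup \<G> (end_of p))
     then (\<lambda>h. r \<otimes>\<^bsub>vgroup \<G> (end_of p)\<^esub> h) ` edge_images (end_of p) else {})"

text \<open>The points of the piece at \<open>p\<close> from which the last edge of \<open>p\<close>
  can be cancelled, that is, the exits towards the parent.\<close>

definition port :: "('a \<times> 'e \<times> bool) list \<Rightarrow> 'a set" where
  "port p = (case p of [] \<Rightarrow> {} | (r, e, b) # p' \<Rightarrow> if e \<in> arcs (base_graph \<G>) then edge_image e (\<not> b) else {})"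

lemma cross_adjacent:
  assumes x: "(p, g) \<in> normal_forms" and e: "e \<in> arcs (base_graph \<G>)" "end_of p = origin e b"
    and c: "cross e b (p, g) = (p', g')"
  shows "(\<exists>c. p' = c # p \<and> g \<in> attach p (fst c) \<and> g' \<in> port p') \<or>
      (\<exists>c. p = c # p' \<and> g' \<in> attach p' (fst c) \<and> g \<in> port p)"
  using x e
proof (cases rule: cross_cases)
  case (backtrack r q)
  have q: "reduced q" "end_of q = origin e (\<not> b)" "r \<in> carrier (vgroup \<G> (origin e (\<not> b)))"
    using x backtrack(1) unfolding normal_forms_def by auto
  have "transfer e b g \<in> edge_images (end_of q)"
    unfolding q(2) by (rule edge_imagesI[OF e(1) transfer_in[OF e(1) backtrack(2)]])
  then have "g' \<in> attach p' (fst (r, e, \<not> b))" using backtrack(3) c q unfolding attach_def by auto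
  moreover have "g \<in> port p" unfolding port_def backtrack(1) using e backtrack(2) by simp
  ultimately show ?thesis using backtrack(1,3) c by auto
next
  case (extend r h)
  have "h \<in> edge_images (end_of p)" unfolding e(2) by (rule edge_imagesI[OF e(1) extend(2)])
  then have "g \<in> attach p (fst (r, e, b))"
    using extend(1,3) x e unfolding attach_def normal_forms_def by auto
  moreover have "g' \<in> port p'" unfolding port_def using extend(5) c e transfer_in[OF e(1) extend(2)] by auto
  ultimately show ?thesis using extend(5) c by auto
qed

lemma gen_letter_adjacent:
  assumes x: "(p, g) \<in> normal_forms" and l: "l \<in> gen_letters"
    and a: "act1 (p, g) l = (p', g')" and ne: "(p, g) \<noteq> (p', g')"
  shows "p = p' \<and> piece_adj (end_of p) g g' \<or>
      (\<exists>c. p' = c # p \<and> g \<in> attach p (fst c) \<and> g' \<in> port p') \<or>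
      (\<exists>c. p = c # p' \<and> g' \<in> attach p' (fst c) \<and> g \<in> port p)"
proof (cases l)
  case (Vert v s)
  then have s: "v \<in> verts (base_graph \<G>)" "s \<in> S v" using l unfolding gen_letters_def by auto
  have v: "end_of p = v" using a ne unfolding Vert act1_Vert by (auto split: if_splits)
  then have g': "p' = p" "g' = g \<otimes>\<^bsub>vgroup \<G> v\<^esub> s" using a unfolding Vert act1_Vert by auto
  have gc: "g \<in> carrier (vgroup \<G> v)" "s \<in> carrier (vgroup \<G> v)"
    using x v s gens_simps(2) unfolding normal_forms_def by auto
  then have "piece_adj v g g'"
    unfolding piece_adj_def adjacent_cayley using g' s ne vgroup_mult_closed[OF s(1)] by auto
  then show ?thesis using g' v by simp
next
  case (Edge e b)
  then have e: "e \<in> arcs (base_graph \<G>)" using l unfolding gen_letters_def by auto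
  obtain b' where "end_of p = origin e b'" "cross e b' (p, g) = (p', g')"
    using a ne unfolding Edge act1_Edge by (auto split: if_splits)
  then show ?thesis using cross_adjacent[OF x e] by blast
qed

lemma nf_adj_cases:
  assumes "nf_adj (p, g) (p', g')"
  shows "p = p' \<and> piece_adj (end_of p) g g' \<or>
      (\<exists>c. p' = c # p \<and> g \<in> attach p (fst c) \<and> g' \<in> port p') \<or>
      (\<exists>c. p = c # p' \<and> g' \<in> attach p' (fst c) \<and> g \<in> port p)"
proof -
  obtain l where l: "(p, g) \<in> normal_forms" "(p', g') \<in> normal_forms" "(p, g) \<noteq> (p', g')" "l \<in> gen_letters"
    "act1 (p, g) l = (p', g') \<or> act1 (p', g') l = (p, g)"
    using assms unfolding nf_adj_def by blast
  have sym: "piece_adj v x y \<Longrightarrow> piece_adj v y x" for v x y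
    unfolding piece_adj_def using symp_adjacent_cayley by (metis symp_def)
  show ?thesis
    using gen_letter_adjacent[OF l(1,4) _ l(3)] gen_letter_adjacent[OF l(2,4) _ l(3)[symmetric]] l(5) sym by metis
qed

lemma reduced_append: "reduced (l @ p) \<Longrightarrow> reduced p"
  by (induction l rule: reduced.induct) auto

lemma normal_forms_separable:
  "\<exists>C. \<forall>m a. (\<forall>v \<in> verts (base_graph \<G>). separable (piece_adj v) (carrier (vgroup \<G> v)) (2 * m) a)
    \<longrightarrow> separable nf_adj normal_forms m (C * a + C)"
proof -
  obtain D where D: "\<And>v. finite (edge_images v) \<and> card (edge_images v) \<le> D"
    "\<And>e b. e \<in> arcs (base_graph \<G>) \<Longrightarrow> card (edge_image e b) \<le> D"
    by (rule edge_images_bounded) (rule that)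
  have "separable nf_adj normal_forms m (400 * Suc a * Suc D + D)"
    if piece: "\<And>v. v \<in> verts (base_graph \<G>) \<Longrightarrow> separable (piece_adj v) (carrier (vgroup \<G> v)) (2 * m) a" for m a
  proof (rule tree_separable[where P = "\<lambda>p. piece_adj (end_of p)" and At = attach and Pt = port and rp = fst
        and W = "\<lambda>p. if reduced p then carrier (vgroup \<G> (end_of p)) else {}"])
    show "symp (piece_adj (end_of p))" for p unfolding piece_adj_def by (rule symp_adjacent_cayley)
    show "finite (attach p r) \<and> card (attach p r) \<le> D" for p r
    proof -
      have "card ((\<lambda>h. r \<otimes>\<^bsub>vgroup \<G> (end_of p)\<^esub> h) ` edge_images (end_of p)) \<le> D"
        using D(1) card_image_le le_trans by blast
      then show ?thesis unfolding attach_def using D(1) by auto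
    qed
    show "g = r \<or> piece_adj (end_of p) r g" if g: "g \<in> attach p r" for p r g
    proof -
      have p: "reduced p" "r \<in> carrier (vgroup \<G> (end_of p))" using g unfolding attach_def by (auto split: if_splits)
      then obtain h where h: "h \<in> edge_images (end_of p)" "g = r \<otimes>\<^bsub>vgroup \<G> (end_of p)\<^esub> h"
        using g unfolding attach_def by auto
      then have "g \<in> carrier (vgroup \<G> (end_of p))"
        using vgroup_mult_closed[OF end_of_in_verts[OF p(1)] p(2)] edge_images_subset by blast
      then show ?thesis using h p unfolding piece_adj_def adjacent_cayley by blast
    qed
    show "finite (port p) \<and> card (port p) \<le> D" for p
      unfolding port_def using D(2) finite_edge_image by (auto split: list.splits)
    show "g \<in> (if reduced p then carrier (vgroup \<G> (end_of p)) else {})" if "(p, g) \<in> normal_forms" for p g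
      using that unfolding normal_forms_def by auto
    show "fst c \<in> (if reduced p then carrier (vgroup \<G> (end_of p)) else {})"
      if "(l @ c # p, g) \<in> normal_forms" for l c p g
      using that reduced_append[of l "c # p"] unfolding normal_forms_def by (cases c) auto
    show "separable (piece_adj (end_of p)) (if reduced p then carrier (vgroup \<G> (end_of p)) else {}) (2 * m) a" for p
    proof (cases "reduced p")
      case True
      then show ?thesis using piece end_of_in_verts by simp
    next
      case False
      then show ?thesis unfolding separable_def by auto
    qed
  qed (rule nf_adj_cases)
  moreover have "400 * Suc a * Suc D + D \<le> (400 * Suc D + D) * a + (400 * Suc D + D)" for a
    by (simp add: algebra_simps)
  ultimately have "separable nf_adj normal_forms m ((400 * Suc D + D) * a + (400 * Suc D + D))"
    if "\<And>v. v \<in> verts (base_graph \<G>) \<Longrightarrow> separable (piece_adj v) (carrier (vgroup \<G> v)) (2 * m) a" for m a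
    using that separable_mono[OF _ order_refl _ order_refl] by blast
  then show ?thesis by blast
qed

text \<open>The finitely many elements added to \<open>S v\<close> are words in \<open>S v\<close>,
  so the identity map is Lipschitz.\<close>

lemma piece_sep_le:
  assumes v: "v \<in> verts (base_graph \<G>)"
  shows "sep_le (piece_adj v) (carrier (vgroup \<G> v))
    (adjacent (cayley_graph (vgroup \<G> v) (S v))) (carrier (vgroup \<G> v))"
  unfolding piece_adj_def
proof (rule sep_le_cayley[OF group_vgroup[OF v], where f = id])
  show "symp (adjacent (cayley_graph (vgroup \<G> v) (S v)))" by (rule symp_adjacent_cayley)
  show "finite (S v \<union> edge_images v)" using gens_simps(1)[OF v] edge_images_bounded by (metis finite_UnI)
  show "S v \<union> edge_images v \<subseteq> carrier (vgroup \<G> v)" using gens_simps(2)[OF v] edge_images_subset by blast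
  show "finite {y. adjacent (cayley_graph (vgroup \<G> v) (S v)) x y} \<and>
    card {y. adjacent (cayley_graph (vgroup \<G> v) (S v)) x y} \<le> 2 * card (S v)" for x
    by (rule cayley_degree[OF group_vgroup[OF v] gens_simps(1,2)[OF v]])
  fix s assume "s \<in> S v \<union> edge_images v"
  then have "s \<in> generate (vgroup \<G> v) (S v)" using gens_simps(2,3)[OF v] edge_images_subset by blast
  from cayley_translate_nball[OF group_vgroup[OF v] gens_simps(2)[OF v] this]
  show "\<exists>n. \<forall>x\<in>carrier (vgroup \<G> v). id (x \<otimes>\<^bsub>vgroup \<G> v\<^esub> s)
      \<in> nball (adjacent (cayley_graph (vgroup \<G> v) (S v))) n (id x)" by simp
qed (auto simp: adjacent_cayley)

end

section \<open>The fundamental group\<close>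

locale generated_fundamental_group = generated_graph_of_groups \<G> v\<^sub>0 S
  for \<G> :: "('v, 'e, 'a, 'b) pre_graph_of_groups" and v\<^sub>0 :: 'v and S +
  fixes G :: "('g, 'm) monoid_scheme" and \<theta>
  assumes group_G: "group G"
    and iso: "\<theta> \<in> Group.iso G (fundamental_group \<G> v\<^sub>0)"
begin

lemma carrier_fundamental_group:
  "carrier (fundamental_group \<G> v\<^sub>0) = {word_class w | w. is_path \<G> v\<^sub>0 w v\<^sub>0}"
  unfolding fundamental_group_def by simp

definition word_elem :: "('v, 'e, 'a) letter list \<Rightarrow> 'g" where
  "word_elem w = inv_into (carrier G) \<theta> (word_class w)"

lemma \<theta>_inj: "inj_on \<theta> (carrier G)" and \<theta>_image: "\<theta> ` carrier G = carrier (fundamental_group \<G> v\<^sub>0)"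
  using iso unfolding iso_def bij_betw_def by auto

lemma word_elem:
  assumes "is_path \<G> v\<^sub>0 w v\<^sub>0"
  shows "word_elem w \<in> carrier G" "\<theta> (word_elem w) = word_class w"
proof -
  have "word_class w \<in> \<theta> ` carrier G" unfolding \<theta>_image carrier_fundamental_group using assms by blast
  then show "word_elem w \<in> carrier G" "\<theta> (word_elem w) = word_class w"
    unfolding word_elem_def by (rule inv_into_into, rule f_inv_into_f)
qed

lemma word_elem_eq_iff:
  assumes "is_path \<G> v\<^sub>0 u v\<^sub>0" "is_path \<G> v\<^sub>0 w v\<^sub>0"
  shows "word_elem u = word_elem w \<longleftrightarrow> (u, w) \<in> word_cong \<G>"
  using word_elem[OF assms(1)] word_elem[OF assms(2)] \<theta>_inj word_class_eq is_path_letters[OF assms(1)]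
  by (metis inj_onD)

lemma word_elem_append:
  assumes "is_path \<G> v\<^sub>0 u v\<^sub>0" "is_path \<G> v\<^sub>0 w v\<^sub>0"
  shows "word_elem (u @ w) = word_elem u \<otimes>\<^bsub>G\<^esub> word_elem w"
proof (rule inj_onD[OF \<theta>_inj])
  have "\<theta> (word_elem u \<otimes>\<^bsub>G\<^esub> word_elem w) = word_class u \<otimes>\<^bsub>fundamental_group \<G> v\<^sub>0\<^esub> word_class w"
  proof -
    have "\<theta> \<in> hom G (fundamental_group \<G> v\<^sub>0)" using iso unfolding iso_def by blast
    from hom_mult[OF this word_elem(1)[OF assms(1)] word_elem(1)[OF assms(2)]]
    show ?thesis by (simp only: word_elem(2)[OF assms(1)] word_elem(2)[OF assms(2)])
  qed
  also have "\<dots> = word_class (u @ w)"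
    using is_path_letters[OF assms(1)] is_path_letters[OF assms(2)] by (intro word_class_mult) auto
  also have "\<dots> = \<theta> (word_elem (u @ w))" using word_elem(2)[OF is_path_append[OF assms]] by simp
  finally show "\<theta> (word_elem (u @ w)) = \<theta> (word_elem u \<otimes>\<^bsub>G\<^esub> word_elem w)" by simp
  show "word_elem (u @ w) \<in> carrier G" using word_elem(1)[OF is_path_append[OF assms]] .
  show "word_elem u \<otimes>\<^bsub>G\<^esub> word_elem w \<in> carrier G"
    using word_elem(1)[OF assms(1)] word_elem(1)[OF assms(2)] group_G by (simp add: group.is_monoid monoid.m_closed)
qed

lemma word_elem_surj:
  assumes "g \<in> carrier G"
  shows "\<exists>w. is_path \<G> v\<^sub>0 w v\<^sub>0 \<and> word_elem w = g"
proof -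
  have "\<theta> g \<in> carrier (fundamental_group \<G> v\<^sub>0)" using \<theta>_image assms by blast
  then obtain w where w: "is_path \<G> v\<^sub>0 w v\<^sub>0" "\<theta> g = word_class w"
    unfolding carrier_fundamental_group by blast
  then show ?thesis using inv_into_f_f[OF \<theta>_inj assms] unfolding word_elem_def by auto
qed

text \<open>The empty path at the base point ensures that \<open>loop_word\<close> leaves loops at
  \<open>v\<^sub>0\<close> unchanged, which \<open>finite_generating_set_G\<close> uses.\<close>

definition path_to :: "'v \<Rightarrow> ('v, 'e, 'a) letter list" where
  "path_to v = (if v = v\<^sub>0 then [] else SOME w. is_path \<G> v\<^sub>0 w v)"

lemma path_to:
  assumes "v \<in> verts (base_graph \<G>)"
  shows "is_path \<G> v\<^sub>0 (path_to v) v"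
  unfolding path_to_def using someI_ex[OF path_exists[OF assms]] base_point by auto

lemma path_to_letters: "v \<in> verts (base_graph \<G>) \<Longrightarrow> path_to v \<in> lists (letters \<G>)"
  using path_to is_path_letters by blast

definition loop_word :: "'v \<Rightarrow> ('v, 'e, 'a) letter list \<Rightarrow> 'v \<Rightarrow> ('v, 'e, 'a) letter list" where
  "loop_word u w v = path_to u @ w @ inv_word (path_to v)"

lemma loop_word:
  assumes "is_path \<G> u w v"
  shows "is_path \<G> v\<^sub>0 (loop_word u w v) v\<^sub>0"
  unfolding loop_word_def using is_path_letters[OF assms]
  by (intro is_path_append[OF path_to is_path_append[OF assms inv_word_path[OF path_to]]]) auto

lemma word_elem_loop_word_cong:
  assumes "is_path \<G> u w v" "is_path \<G> u w' v" "(w, w') \<in> word_cong \<G>"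
  shows "word_elem (loop_word u w v) = word_elem (loop_word u w' v)"
  unfolding word_elem_eq_iff[OF loop_word[OF assms(1)] loop_word[OF assms(2)]] unfolding loop_word_def
  using is_path_letters[OF assms(1)] assms(3) path_to_letters inv_word_letters
  by (intro word_cong_context) auto

text \<open>The return from \<open>v\<close> and the way out to \<open>v\<close> cancel, so closing
  up paths turns concatenation into multiplication.\<close>

lemma word_elem_loop_word_append:
  assumes "is_path \<G> u w v" "is_path \<G> v w' z"
  shows "word_elem (loop_word u (w @ w') z) = word_elem (loop_word u w v) \<otimes>\<^bsub>G\<^esub> word_elem (loop_word v w' z)"
proof -
  have V: "u \<in> verts (base_graph \<G>)" "v \<in> verts (base_graph \<G>)" "z \<in> verts (base_graph \<G>)"
    and L: "w \<in> lists (letters \<G>)" "w' \<in> lists (letters \<G>)"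
    using is_path_letters[OF assms(1)] is_path_letters[OF assms(2)] by auto
  have "((path_to u @ w) @ (inv_word (path_to v) @ path_to v) @ (w' @ inv_word (path_to z)),
      (path_to u @ w) @ [] @ (w' @ inv_word (path_to z))) \<in> word_cong \<G>"
  proof (rule word_cong_context[OF word_inv_left])
    show "path_to v \<in> lists (letters \<G>)" "path_to u @ w \<in> lists (letters \<G>)"
      using V L path_to_letters by auto
    have "inv_word (path_to z) \<in> lists (letters \<G>)" using V path_to_letters inv_word_letters by blast
    then show "w' @ inv_word (path_to z) \<in> lists (letters \<G>)" using L by auto
  qed
  then have "word_elem (loop_word u w v @ loop_word v w' z) = word_elem (loop_word u (w @ w') z)"
    by (subst word_elem_eq_iff[OF is_path_append[OF loop_word[OF assms(1)] loop_word[OF assms(2)]]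
        loop_word[OF is_path_append[OF assms]]]) (simp add: loop_word_def)
  then show ?thesis using word_elem_append[OF loop_word[OF assms(1)] loop_word[OF assms(2)]] by simp
qed

definition vertex_embed :: "'v \<Rightarrow> 'a \<Rightarrow> 'g" where
  "vertex_embed v x = word_elem (loop_word v [Vert v x] v)"

lemma vertex_embed_hom:
  assumes v: "v \<in> verts (base_graph \<G>)"
  shows "group_hom (vgroup \<G> v) G (vertex_embed v)"
proof (rule group_hom.intro[OF group_vgroup[OF v] group_G], unfold_locales, rule homI)
  fix x y assume xy: "x \<in> carrier (vgroup \<G> v)" "y \<in> carrier (vgroup \<G> v)"
  then have p: "is_path \<G> v [Vert v x] v" "is_path \<G> v [Vert v y] v"
    "is_path \<G> v [Vert v (x \<otimes>\<^bsub>vgroup \<G> v\<^esub> y)] v"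
    using v vgroup_mult_closed[OF v] by auto
  show "vertex_embed v x \<in> carrier G" unfolding vertex_embed_def by (rule word_elem(1)[OF loop_word[OF p(1)]])
  have "word_elem (loop_word v ([Vert v x] @ [Vert v y]) v) = vertex_embed v (x \<otimes>\<^bsub>vgroup \<G> v\<^esub> y)"
    unfolding vertex_embed_def
    by (rule word_elem_loop_word_cong[OF is_path_append[OF p(1,2)] p(3)]) (use word_cong.vert_mult[OF v xy] in simp)
  then show "vertex_embed v (x \<otimes>\<^bsub>vgroup \<G> v\<^esub> y) = vertex_embed v x \<otimes>\<^bsub>G\<^esub> vertex_embed v y"
    using word_elem_loop_word_append[OF p(1,2)] unfolding vertex_embed_def by simp
qed

text \<open>Acting on \<open>base_nf\<close> along \<open>path_to v\<close> gives a form
  \<open>(p, g)\<close> ending at \<open>v\<close>, which the letter of \<open>x\<close> turns into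
  \<open>(p, g x)\<close>. The return path acts injectively, so equal images give
  \<open>g x = g y\<close>.\<close>

lemma vertex_embed_inj:
  assumes v: "v \<in> verts (base_graph \<G>)"
  shows "inj_on (vertex_embed v) (carrier (vgroup \<G> v))"
proof (rule inj_onI)
  fix x y assume xy: "x \<in> carrier (vgroup \<G> v)" "y \<in> carrier (vgroup \<G> v)" and eq: "vertex_embed v x = vertex_embed v y"
  have p: "is_path \<G> v [Vert v x] v" "is_path \<G> v [Vert v y] v" using v xy by auto
  have cong: "(loop_word v [Vert v x] v, loop_word v [Vert v y] v) \<in> word_cong \<G>"
    using eq word_elem_eq_iff[OF loop_word[OF p(1)] loop_word[OF p(2)]] unfolding vertex_embed_def by simp
  let ?q = "path_to v" and ?z = "act base_nf (path_to v)"
  have q: "?q \<in> lists (letters \<G>)" by (rule path_to_letters[OF v])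
  have z: "?z \<in> normal_forms" "end_of (fst ?z) = v"
    using act_closed[OF base_nf(1) q] act_path[OF base_nf(1), of ?q v] path_to[OF v] base_nf(2) by auto
  obtain p g where pg: "?z = (p, g)" by (cases ?z)
  have cancel: "act (act y' (inv_word ?q)) ?q = y'" if "y' \<in> normal_forms" for y'
    using act_word_cong[OF word_inv_left[OF q] that] by simp
  have "act (act1 ?z (Vert v x)) (inv_word ?q) = act (act1 ?z (Vert v y)) (inv_word ?q)"
    using act_word_cong[OF cong base_nf(1)] unfolding loop_word_def by simp
  then have "act1 ?z (Vert v x) = act1 ?z (Vert v y)"
    using cancel[OF act1_closed[OF z(1)]] v xy by (metis Vert_letters)
  then have "g \<otimes>\<^bsub>vgroup \<G> v\<^esub> x = g \<otimes>\<^bsub>vgroup \<G> v\<^esub> y"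
    using z(2) unfolding pg by (simp add: act1_Vert)
  moreover have "g \<in> carrier (vgroup \<G> v)" using z pg unfolding normal_forms_def by auto
  ultimately show "x = y"
    using monoid.Units_l_cancel[OF group.is_monoid[OF group_vgroup[OF v]]] group.Units_eq[OF group_vgroup[OF v]] xy
    by metis
qed

definition gen_elem :: "('v, 'e, 'a) letter \<Rightarrow> 'g" where
  "gen_elem l = (case l of Vert v s \<Rightarrow> vertex_embed v s
     | Edge e b \<Rightarrow> word_elem (loop_word (origin e b) [Edge e b] (origin e (\<not> b))))"

lemma edge_path: "e \<in> arcs (base_graph \<G>) \<Longrightarrow> is_path \<G> (origin e b) [Edge e b] (origin e (\<not> b))"
  by (simp add: is_path_Edge origin_in_verts del: is_path.simps(3))

lemma gen_elem_subset: "gen_elem ` gen_letters \<subseteq> carrier G"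
proof clarify
  fix l assume l: "l \<in> gen_letters"
  show "gen_elem l \<in> carrier G"
  proof (cases l)
    case (Vert v s)
    then have "v \<in> verts (base_graph \<G>)" "s \<in> carrier (vgroup \<G> v)"
      using l gen_letters_subset by (auto simp: Vert_letters)
    then show ?thesis unfolding Vert gen_elem_def using group_hom.hom_closed[OF vertex_embed_hom] by simp
  next
    case (Edge e b)
    then have "e \<in> arcs (base_graph \<G>)" using l gen_letters_subset by (auto simp: Edge_letters)
    then show ?thesis unfolding Edge gen_elem_def using word_elem(1)[OF loop_word[OF edge_path]] by simp
  qed
qed

lemma vertex_embed_in_generate:
  assumes v: "v \<in> verts (base_graph \<G>)" and x: "x \<in> carrier (vgroup \<G> v)"
  shows "vertex_embed v x \<in> generate G (gen_elem ` gen_letters)"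
proof -
  have "vertex_embed v x \<in> generate G (vertex_embed v ` S v)"
    using group_hom.generate_img[OF vertex_embed_hom[OF v] gens_simps(2)[OF v]] gens_simps(3)[OF v] x by blast
  moreover have "vertex_embed v ` S v \<subseteq> gen_elem ` gen_letters"
  proof clarify
    fix s assume "s \<in> S v"
    then have "Vert v s \<in> gen_letters" using v unfolding gen_letters_def by blast
    then show "vertex_embed v s \<in> gen_elem ` gen_letters" by (rule rev_image_eqI) (simp add: gen_elem_def)
  qed
  ultimately show ?thesis using group.mono_generate[OF group_G] by blast
qed

lemma word_elem_Nil: "word_elem [] = \<one>\<^bsub>G\<^esub>"
proof -
  have "is_path \<G> v\<^sub>0 [] v\<^sub>0" using base_point by simp
  then have "word_elem [] \<otimes>\<^bsub>G\<^esub> word_elem [] = word_elem []" "word_elem [] \<in> carrier G"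
    using word_elem_append[of "[]" "[]"] word_elem(1) by auto
  then show ?thesis using group.r_cancel_one[OF group_G] by blast
qed

text \<open>Closing up every single letter of the path writes the loop as a product of elements of
  vertex groups and of edge generators.\<close>

lemma word_elem_loop_word_in_generate:
  "is_path \<G> u w v \<Longrightarrow> word_elem (loop_word u w v) \<in> generate G (gen_elem ` gen_letters)"
proof (induction w arbitrary: u)
  case Nil
  then have u: "u = v" "u \<in> verts (base_graph \<G>)" by auto
  have "(loop_word u [] u, []) \<in> word_cong \<G>"
    unfolding loop_word_def using word_inv_right[OF path_to_letters[OF u(2)]] by simp
  then have "word_elem (loop_word u [] u) = word_elem []"
    by (subst word_elem_eq_iff[OF loop_word]) (use u base_point in auto)
  then show ?case using u word_elem_Nil generate.one by metis
next
  case (Cons l w)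
  obtain u' where u': "is_path \<G> u [l] u'" "is_path \<G> u' w v" "word_elem (loop_word u [l] u') \<in> generate G (gen_elem ` gen_letters)"
  proof (cases l)
    case (Vert x g)
    then have "x = u" "u \<in> verts (base_graph \<G>)" "g \<in> carrier (vgroup \<G> u)" "is_path \<G> u w v"
      using Cons.prems by auto
    then show ?thesis using that[of u] Vert vertex_embed_in_generate[of u g] unfolding vertex_embed_def by simp
  next
    case (Edge e b)
    then have e: "e \<in> arcs (base_graph \<G>)" "origin e b = u" "is_path \<G> (origin e (\<not> b)) w v"
      using Cons.prems by (auto simp: is_path_Edge simp del: is_path.simps(3))
    then have "gen_elem (Edge e b) \<in> gen_elem ` gen_letters" unfolding gen_letters_def by blast
    then have "word_elem (loop_word u [l] (origin e (\<not> b))) \<in> generate G (gen_elem ` gen_letters)"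
      using generate.incl[of "gen_elem (Edge e b)" "gen_elem ` gen_letters" G] e(2)
        gen_elem_def[of "Edge e b"] Edge by simp
    then show ?thesis using that[of "origin e (\<not> b)"] edge_path[OF e(1), of b] e Edge by simp
  qed
  have "word_elem (loop_word u ([l] @ w) v) = word_elem (loop_word u [l] u') \<otimes>\<^bsub>G\<^esub> word_elem (loop_word u' w v)"
    by (rule word_elem_loop_word_append[OF u'(1,2)])
  then show ?case using generate.eng[OF u'(3) Cons.IH[OF u'(2)]] by simp
qed

lemma finite_generating_set_G: "finite_generating_set G (gen_elem ` gen_letters)"
proof -
  have "g \<in> generate G (gen_elem ` gen_letters)" if g: "g \<in> carrier G" for g
  proof -
    obtain w where w: "is_path \<G> v\<^sub>0 w v\<^sub>0" "word_elem w = g" using word_elem_surj[OF g] by blast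
    have "loop_word v\<^sub>0 w v\<^sub>0 = w" unfolding loop_word_def path_to_def by (simp add: inv_word_def)
    then show ?thesis using word_elem_loop_word_in_generate[OF w(1)] w(2) by simp
  qed
  then show ?thesis unfolding finite_generating_set_def
    using finite_gen_letters gen_elem_subset group.generate_in_carrier[OF group_G gen_elem_subset] by auto
qed

text \<open>An element is sent to the normal form of a chosen word. The choice does not affect the
  form, and \<open>path_cong_iff\<close> makes the map injective; right multiplication becomes the
  action of a fixed word.\<close>

lemma sep_le_normal_forms:
  assumes "finite_generating_set G T"
  shows "sep_le (adjacent (cayley_graph G T)) (carrier G) nf_adj normal_forms"
proof -
  have T: "finite T" "T \<subseteq> carrier G" using assms unfolding finite_generating_set_def by auto
  obtain wd where wd: "\<And>g. g \<in> carrier G \<Longrightarrow> is_path \<G> v\<^sub>0 (wd g) v\<^sub>0 \<and> word_elem (wd g) = g"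
    using word_elem_surj by metis
  show ?thesis
  proof (rule sep_le_cayley[OF group_G T symp_nf_adj _ nf_adj_degree, where f = "\<lambda>g. act base_nf (wd g)"])
    show "inj_on (\<lambda>g. act base_nf (wd g)) (carrier G)"
      using path_cong_iff word_elem_eq_iff wd by (intro inj_onI) metis
    show "(\<lambda>g. act base_nf (wd g)) ` carrier G \<subseteq> normal_forms"
      using act_closed[OF base_nf(1)] is_path_letters wd by blast
    fix t assume t: "t \<in> T"
    then have tG: "t \<in> carrier G" using T by blast
    have "act base_nf (wd (g \<otimes>\<^bsub>G\<^esub> t)) = act (act base_nf (wd g)) (wd t)" if g: "g \<in> carrier G" for g
    proof -
      have gt: "g \<otimes>\<^bsub>G\<^esub> t \<in> carrier G" using g tG group_G by (simp add: group.is_monoid monoid.m_closed)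
      have p: "is_path \<G> v\<^sub>0 (wd g @ wd t) v\<^sub>0" using wd[OF g] wd[OF tG] is_path_append by blast
      have "word_elem (wd (g \<otimes>\<^bsub>G\<^esub> t)) = word_elem (wd g @ wd t)"
        using wd[OF g] wd[OF tG] wd[OF gt] word_elem_append by simp
      then have "(wd (g \<otimes>\<^bsub>G\<^esub> t), wd g @ wd t) \<in> word_cong \<G>" using word_elem_eq_iff wd[OF gt] p by blast
      from act_word_cong[OF this base_nf(1)] show ?thesis by simp
    qed
    moreover obtain n where "\<forall>x \<in> normal_forms. act x (wd t) \<in> nball nf_adj n x"
      using nball_act is_path_letters wd[OF tG] by blast
    moreover have "act base_nf (wd g) \<in> normal_forms" if "g \<in> carrier G" for g
      using act_closed[OF base_nf(1)] is_path_letters wd[OF that] by blast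
    ultimately show "\<exists>n. \<forall>x\<in>carrier G. act base_nf (wd (x \<otimes>\<^bsub>G\<^esub> t)) \<in> nball nf_adj n (act base_nf (wd x))"
      by metis
  qed (simp add: nf_adj_def)
qed

lemma sep_le_vgroup:
  assumes v: "v \<in> verts (base_graph \<G>)" and "finite_generating_set G T"
  shows "sep_le (adjacent (cayley_graph (vgroup \<G> v) (S v))) (carrier (vgroup \<G> v))
    (adjacent (cayley_graph G T)) (carrier G)"
proof -
  have T: "finite T" "T \<subseteq> carrier G" "generate G T = carrier G"
    using assms(2) unfolding finite_generating_set_def by auto
  interpret emb: group_hom "vgroup \<G> v" G "vertex_embed v" by (rule vertex_embed_hom[OF v])
  show ?thesis
  proof (rule sep_le_cayley[OF group_vgroup[OF v] gens_simps(1,2)[OF v] symp_adjacent_cayley _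
        cayley_degree[OF group_G T(1,2)] vertex_embed_inj[OF v]])
    fix s assume "s \<in> S v"
    then have s: "s \<in> carrier (vgroup \<G> v)" using gens_simps(2)[OF v] by blast
    then have "vertex_embed v s \<in> generate G T" using T(3) emb.hom_closed by simp
    from cayley_translate_nball[OF group_G T(2) this] obtain n where
      "\<forall>x\<in>carrier G. x \<otimes>\<^bsub>G\<^esub> vertex_embed v s \<in> nball (adjacent (cayley_graph G T)) n x" ..
    then show "\<exists>n. \<forall>x\<in>carrier (vgroup \<G> v). vertex_embed v (x \<otimes>\<^bsub>vgroup \<G> v\<^esub> s)
        \<in> nball (adjacent (cayley_graph G T)) n (vertex_embed v x)"
      using emb.hom_mult[OF _ s] emb.hom_closed by (intro exI[of _ n]) simp
  qed (auto simp: adjacent_cayley)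
qed

end

lemma verts_cayley_graph [simp]: "verts (cayley_graph G S) = carrier G"
  unfolding cayley_graph_def by simp

lemma separable_sep_cayley:
  "separable (adjacent (cayley_graph G S)) (carrier G) r (sep (cayley_graph G S) r)"
  using separable_sep[OF is_pair_graph_cayley, of G S r] by simp

lemma sep_cayley_le:
  "separable (adjacent (cayley_graph G S)) (carrier G) r k \<Longrightarrow> sep (cayley_graph G S) r \<le> k"
  by (rule sep_le_separable[OF is_pair_graph_wf[OF is_pair_graph_cayley]]) simp

section \<open>The two asymptotic inequalities\<close>

context generated_fundamental_group
begin

lemma max_sep_asymp_le:
  assumes T: "finite_generating_set G T"
  shows "(\<lambda>r. MAX v \<in> verts (base_graph \<G>). sep (cayley_graph (vgroup \<G> v) (S v)) r) \<lesssim> sep (cayley_graph G T)"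
proof -
  let ?V = "verts (base_graph \<G>)" and ?f = "sep (cayley_graph G T)"
  have "\<exists>C. \<forall>m a. separable (adjacent (cayley_graph G T)) (carrier G) (C * m) a \<longrightarrow>
      separable (adjacent (cayley_graph (vgroup \<G> v) (S v))) (carrier (vgroup \<G> v)) m (C * a + C)"
    if "v \<in> ?V" for v
    using sep_le_vgroup[OF that T] unfolding sep_le_def .
  then obtain c where c: "\<And>v m a. v \<in> ?V \<Longrightarrow>
      separable (adjacent (cayley_graph G T)) (carrier G) (c v * m) a \<Longrightarrow>
      separable (adjacent (cayley_graph (vgroup \<G> v) (S v))) (carrier (vgroup \<G> v)) m (c v * a + c v)"
    by metis
  define C where "C = sum c ?V"
  have cC: "c v \<le> C" if "v \<in> ?V" for v unfolding C_def using member_le_sum[OF that] finite_verts by auto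
  have "sep (cayley_graph (vgroup \<G> v) (S v)) r \<le> C * ?f (C * r) + C" if v: "v \<in> ?V" for v r
  proof -
    have "separable (adjacent (cayley_graph G T)) (carrier G) (c v * r) (?f (C * r))"
      by (rule separable_mono[OF separable_sep_cayley[of G T "C * r"]]) (use cC[OF v] in auto)
    from sep_cayley_le[OF c[OF v this]]
    have "sep (cayley_graph (vgroup \<G> v) (S v)) r \<le> c v * ?f (C * r) + c v" .
    also have "\<dots> \<le> C * ?f (C * r) + C" by (intro add_mono mult_le_mono1 cC[OF v])
    finally show ?thesis .
  qed
  then show ?thesis unfolding asymp_le_def
    using finite_verts base_point by (intro exI[of _ C] allI Max.boundedI) auto
qed

lemma asymp_le_max_sep:
  assumes T: "finite_generating_set G T"
  shows "sep (cayley_graph G T) \<lesssim> (\<lambda>r. MAX v \<in> verts (base_graph \<G>). sep (cayley_graph (vgroup \<G> v) (S v)) r)"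
proof -
  let ?V = "verts (base_graph \<G>)"
  let ?g = "\<lambda>r. MAX v \<in> ?V. sep (cayley_graph (vgroup \<G> v) (S v)) r"
  obtain C1 where C1: "\<And>m a. separable nf_adj normal_forms (C1 * m) a \<Longrightarrow>
      separable (adjacent (cayley_graph G T)) (carrier G) m (C1 * a + C1)"
    using sep_le_normal_forms[OF T] unfolding sep_le_def by blast
  obtain C2 where C2: "\<And>m a. (\<And>v. v \<in> ?V \<Longrightarrow> separable (piece_adj v) (carrier (vgroup \<G> v)) (2 * m) a)
      \<Longrightarrow> separable nf_adj normal_forms m (C2 * a + C2)"
    using normal_forms_separable by metis
  have "\<exists>C. \<forall>m a. separable (adjacent (cayley_graph (vgroup \<G> v) (S v))) (carrier (vgroup \<G> v)) (C * m) a \<longrightarrow>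
      separable (piece_adj v) (carrier (vgroup \<G> v)) m (C * a + C)"
    if "v \<in> ?V" for v
    using piece_sep_le[OF that] unfolding sep_le_def .
  then obtain c where c: "\<And>v m a. v \<in> ?V \<Longrightarrow>
      separable (adjacent (cayley_graph (vgroup \<G> v) (S v))) (carrier (vgroup \<G> v)) (c v * m) a \<Longrightarrow>
      separable (piece_adj v) (carrier (vgroup \<G> v)) m (c v * a + c v)"
    by metis
  define C3 where "C3 = sum c ?V"
  have cC: "c v \<le> C3" if "v \<in> ?V" for v unfolding C3_def using member_le_sum[OF that] finite_verts by auto
  \<comment> \<open>The first summand absorbs the rescaling of the argument by \<open>c v\<close>,
    \<open>2\<close> and \<open>C1\<close>; the others bound the coefficients of the three composed
    estimates.\<close>
  define C where "C = C3 * 2 * C1 + C1 * C2 * C3 + C1 * C2 + C1"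
  have "sep (cayley_graph G T) r \<le> C * ?g (C * r) + C" for r
  proof -
    let ?a = "?g (C * r)"
    have "separable (piece_adj v) (carrier (vgroup \<G> v)) (2 * (C1 * r)) (C3 * ?a + C3)" if v: "v \<in> ?V" for v
    proof -
      have "sep (cayley_graph (vgroup \<G> v) (S v)) (C * r) \<le> ?a"
        using v finite_verts by (intro Max_ge) auto
      moreover have "c v * (2 * (C1 * r)) \<le> C * r"
      proof -
        have "c v * (2 * C1) \<le> C3 * 2 * C1" using cC[OF v] by simp
        also have "\<dots> \<le> C" unfolding C_def by simp
        finally have "c v * (2 * C1) * r \<le> C * r" by (rule mult_le_mono1)
        then show ?thesis by (simp add: mult.assoc)
      qed
      ultimately have "separable (adjacent (cayley_graph (vgroup \<G> v) (S v))) (carrier (vgroup \<G> v))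
          (c v * (2 * (C1 * r))) ?a"
        using separable_mono[OF separable_sep_cayley] by blast
      from c[OF v this] show ?thesis
        by (rule separable_mono) (use cC[OF v] in \<open>auto intro: add_mono mult_le_mono1\<close>)
    qed
    from sep_cayley_le[OF C1[OF C2[OF this]]]
    have "sep (cayley_graph G T) r \<le> C1 * (C2 * (C3 * ?a + C3) + C2) + C1" by simp
    also have "\<dots> = (C1 * C2 * C3) * ?a + (C1 * C2 * C3 + C1 * C2 + C1)" by (simp add: algebra_simps)
    also have "\<dots> \<le> C * ?a + C" unfolding C_def by (intro add_mono mult_le_mono1) auto
    finally show ?thesis .
  qed
  then show ?thesis unfolding asymp_le_def by blast
qed

end

text \<open>Quantifying over all \<open>T\<close> and \<open>S\<close> includes independence of the
  generating sets, and the first conjunct guarantees that there is some \<open>T\<close> to which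
  the second applies.\<close>

theorem corollary1p4:
  fixes \<G> :: "('v, 'e, 'a, 'b) pre_graph_of_groups"
    and v\<^sub>0 :: 'v
    and G :: "('g, 'm) monoid_scheme"
  assumes "finite_graph_of_groups \<G>"
    and "v\<^sub>0 \<in> verts (base_graph \<G>)"
    and "\<And>v. v \<in> verts (base_graph \<G>) \<Longrightarrow> finitely_generated (vgroup \<G> v)"
    and "\<And>e. e \<in> arcs (base_graph \<G>) \<Longrightarrow> finite (carrier (egroup \<G> e))"
    and "group G"
    and "G \<cong> fundamental_group \<G> v\<^sub>0"
  shows "finitely_generated G \<and>
    (\<forall>T S. finite_generating_set G T \<longrightarrow>
       (\<forall>v \<in> verts (base_graph \<G>). finite_generating_set (vgroup \<G> v) (S v)) \<longrightarrow>
       sep (cayley_graph G T) \<simeq>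
         (\<lambda>r. MAX v \<in> verts (base_graph \<G>). sep (cayley_graph (vgroup \<G> v) (S v)) r))"
proof (intro conjI allI impI)
  obtain \<theta> where \<theta>: "\<theta> \<in> Group.iso G (fundamental_group \<G> v\<^sub>0)" using assms(6) unfolding is_iso_def by blast
  interpret finite_graph_of_groups \<G> by fact
  interpret G: group G by fact
  have generated: "generated_fundamental_group \<G> v\<^sub>0 S G \<theta>"
    if "\<And>v. v \<in> verts (base_graph \<G>) \<Longrightarrow> finite_generating_set (vgroup \<G> v) (S v)" for S
    using that assms(2,4,5) \<theta> fin_digraph by unfold_locales auto
  obtain S where "\<And>v. v \<in> verts (base_graph \<G>) \<Longrightarrow> finite_generating_set (vgroup \<G> v) (S v)"
    using assms(3) unfolding finitely_generated_def by metis
  then show "finitely_generated G"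
    using generated_fundamental_group.finite_generating_set_G[OF generated]
    unfolding finitely_generated_def by blast
  fix T S
  assume T: "finite_generating_set G T"
    and S: "\<forall>v \<in> verts (base_graph \<G>). finite_generating_set (vgroup \<G> v) (S v)"
  interpret generated_fundamental_group \<G> v\<^sub>0 S G \<theta> by (rule generated) (use S in blast)
  show "sep (cayley_graph G T) \<simeq>
      (\<lambda>r. MAX v \<in> verts (base_graph \<G>). sep (cayley_graph (vgroup \<G> v) (S v)) r)"
    unfolding asymp_eq_def using asymp_le_max_sep[OF T] max_sep_asymp_le[OF T] by blast
qed

end
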